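(* Let $\{f_n(x,v)\}_{n=0}^\infty$ be a bounded sequence in $L^1\left(\mathbb{R}^D_x;B^0_{1,1}(\mathbb{R}^D_v)\right)$ such that $f_n\ge0$ and $$v\cdot\nabla_xf_n=(1-\Delta_v)^{\frac\gamma2}g_n$$ for some sequence $\{g_n(x,v)\}_{n=0}^\infty$ bounded in $L^1(\mathbb{R}^D_x\times\mathbb{R}^D_v)$ and some $\gamma\in\mathbb{R}$. Then $\{f_n\}_{n=0}^\infty$ is equi-integrable (in all variables $x$ and $v$).
   Context: $D\ge1$ is the dimension. $\Delta_v$ (in the transport equation) is the Laplacian in $v$, and the equation holds in the sense of distributions. Besov space: with $\mathcal{F}f(\xi)=\int e^{-i\xi\cdot v}f(v)\,dv$, fix radial nonnegative $\psi,\varphi\in C_0^\infty(\mathbb{R}^D)$ with $\mathrm{supp}\,\psi\subset\{|\xi|\le1\}$, $\mathrm{supp}\,\varphi\subset\{\frac12\le|\xi|\le2\}$ and $1=\psi(\xi)+\sum_{k\ge0}\varphi(2^{-k}\xi)$; let $\Delta_0$ and $\Delta_{2^k}$ be the Fourier multipliers with symbols $\psi(\xi)$ and $\varphi(2^{-k}\xi)$. Then $\|f\|_{B^0_{1,1}(\mathbb{R}^D)}=\|\Delta_0f\|_{L^1}+\sum_{k\ge0}\|\Delta_{2^k}f\|_{L^1}$. A bounded sequence $\{f_n\}$ in $L^1_{\mathrm{loc}}(\mathbb{R}^D_x\times\mathbb{R}^D_v)$ is equi-integrable (in all variables) if for every $\eta>0$ and each compact $K\subset\mathbb{R}^D\times\mathbb{R}^D$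 there exists $\delta>0$ such that for any measurable $\Omega\subset\mathbb{R}^D\times\mathbb{R}^D$ with Lebesgue measure $|\Omega|<\delta$ one has $\int_{\Omega\cap K}|f_n|\,dx\,dv<\eta$ for every $n$. *)

theory Defs
  imports "HOL-Analysis.Analysis"
begin

primrec C_k :: "nat \<Rightarrow> ('a::euclidean_space \<Rightarrow> 'b::real_normed_vector) \<Rightarrow> bool" where
  "C_k 0 f \<longleftrightarrow> continuous_on UNIV f"
| "C_k (Suc k) f \<longleftrightarrow>
     (\<forall>x. f differentiable (at x)) \<and>
     (\<forall>b\<in>Basis. C_k k (\<lambda>x. frechet_derivative f (at x) b))"

definition topological_support :: "('a::topological_space \<Rightarrow> 'b::zero) \<Rightarrow> 'a set" where
  "topological_support f = closure {x. f x \<noteq> 0}"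

definition test_function :: "('a::euclidean_space \<Rightarrow> 'b::real_normed_vector) \<Rightarrow> bool" where
  "test_function f \<longleftrightarrow> (\<forall>k. C_k k f) \<and> compact (topological_support f)"

definition fourier :: "(real^'d \<Rightarrow> complex) \<Rightarrow> real^'d \<Rightarrow> complex" where
  "fourier f \<xi> = (LINT v|lebesgue. exp (- (\<i> * complex_of_real (\<xi> \<bullet> v))) * f v)"

definition inverse_fourier :: "(real^'d \<Rightarrow> complex) \<Rightarrow> real^'d \<Rightarrow> complex" where
  "inverse_fourier h v =
     (LINT \<xi>|lebesgue. exp (\<i> * complex_of_real (\<xi> \<bullet> v)) * h \<xi>)
       / complex_of_real ((2 * pi) ^ CARD('d))"

text \<open>
  The integrals below are absolutely convergent in the two situations in which
  multipliers are used: a symbol in \<open>C\<^sub>c\<^sup>\<infinity>\<close> acting on an integrable function, and a symbol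
  of polynomial growth acting on a test function.
\<close>

definition fourier_multiplier ::
    "(real^'d \<Rightarrow> real) \<Rightarrow> (real^'d \<Rightarrow> complex) \<Rightarrow> real^'d \<Rightarrow> complex" where
  "fourier_multiplier m f =
     inverse_fourier (\<lambda>\<xi>. complex_of_real (m \<xi>) * fourier f \<xi>)"

definition littlewood_paley :: "(real^'d \<Rightarrow> real) \<Rightarrow> (real^'d \<Rightarrow> real) \<Rightarrow> bool" where
  "littlewood_paley \<psi> \<phi> \<longleftrightarrow>
     test_function \<psi> \<and> test_function \<phi> \<and>
     (\<forall>\<xi>. 0 \<le> \<psi> \<xi>) \<and> (\<forall>\<xi>. 0 \<le> \<phi> \<xi>) \<and>
     (\<forall>\<xi> \<eta>. norm \<xi> = norm \<eta> \<longrightarrow> \<psi> \<xi> = \<psi> \<eta>) \<and>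
     (\<forall>\<xi> \<eta>. norm \<xi> = norm \<eta> \<longrightarrow> \<phi> \<xi> = \<phi> \<eta>) \<and>
     topological_support \<psi> \<subseteq> {\<xi>. norm \<xi> \<le> 1} \<and>
     topological_support \<phi> \<subseteq> {\<xi>. 1 / 2 \<le> norm \<xi> \<and> norm \<xi> \<le> 2} \<and>
     (\<forall>\<xi>. (\<lambda>k. \<phi> ((1 / 2) ^ k *\<^sub>R \<xi>)) sums (1 - \<psi> \<xi>))"

text \<open>
  The norm of \<open>B\<^sup>0\<^sub>1\<^sub>,\<^sub>1\<close>. Every tempered distribution in this space is an integrable function,
  being the \<open>L\<^sup>1\<close>-convergent sum of its dyadic blocks, so the value \<open>\<infinity>\<close> off \<open>L\<^sup>1\<close> loses
  nothing; on \<open>L\<^sup>1\<close> the dyadic blocks are given by convergent integrals.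
\<close>

definition besov_norm ::
    "(real^'d \<Rightarrow> real) \<Rightarrow> (real^'d \<Rightarrow> real) \<Rightarrow> (real^'d \<Rightarrow> complex) \<Rightarrow> ennreal" where
  "besov_norm \<psi> \<phi> f =
     (if integrable lebesgue f
      then (\<integral>\<^sup>+v. ennreal (norm (fourier_multiplier \<psi> f v)) \<partial>lebesgue)
         + (\<Sum>k. \<integral>\<^sup>+v. ennreal (norm
              (fourier_multiplier (\<lambda>\<xi>. \<phi> ((1 / 2) ^ k *\<^sub>R \<xi>)) f v)) \<partial>lebesgue)
      else \<infinity>)"

text \<open>
  Joint measurability is the right condition here: as \<open>B\<^sup>0\<^sub>1\<^sub>,\<^sub>1\<close> is separable and embeds
  isometrically in \<open>\<ell>\<^sup>1(L\<^sup>1)\<close>, it yields strong measurability of \<open>x \<mapsto> f(x,\<cdot>)\<close> as soon as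
  the norm is finite.
\<close>

definition bounded_in_L1_besov ::
    "(real^'d \<Rightarrow> real) \<Rightarrow> (real^'d \<Rightarrow> real)
      \<Rightarrow> (nat \<Rightarrow> (real^'d) \<times> (real^'d) \<Rightarrow> real) \<Rightarrow> bool" where
  "bounded_in_L1_besov \<psi> \<phi> f \<longleftrightarrow>
     (\<forall>n. f n \<in> borel_measurable lebesgue) \<and>
     (\<exists>C::real. \<forall>n. (\<integral>\<^sup>+x. besov_norm \<psi> \<phi> (\<lambda>v. complex_of_real (f n (x, v))) \<partial>lebesgue)
                    \<le> ennreal C)"

definition bounded_in_L1 ::
    "(nat \<Rightarrow> 'a::euclidean_space \<Rightarrow> 'b::{banach, second_countable_topology}) \<Rightarrow> bool" where
  "bounded_in_L1 g \<longleftrightarrow>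
     (\<forall>n. integrable lebesgue (g n)) \<and>
     (\<exists>C::real. \<forall>n. (LINT z|lebesgue. norm (g n z)) \<le> C)"

definition bessel ::
    "real \<Rightarrow> (real^'d \<Rightarrow> complex) \<Rightarrow> real^'d \<Rightarrow> complex" where
  "bessel \<gamma> = fourier_multiplier (\<lambda>\<xi>. (1 + (norm \<xi>)\<^sup>2) powr (\<gamma> / 2))"

text \<open>
  The equation \<open>v \<cdot> \<nabla>\<^sub>x f = (1 - \<Delta>\<^sub>v)\<^bsup>\<gamma>/2\<^esup> g\<close> in the sense of distributions.  The symbol
  \<open>(1 + \<bar>\<xi>\<bar>\<^sup>2)\<^bsup>\<gamma>/2\<^esup>\<close> is even, so the multiplier is its own transpose for the bilinear
  pairing and is moved onto the test function without a change of sign.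
\<close>

definition transport_equation ::
    "real \<Rightarrow> ((real^'d) \<times> (real^'d) \<Rightarrow> real) \<Rightarrow> ((real^'d) \<times> (real^'d) \<Rightarrow> complex) \<Rightarrow> bool" where
  "transport_equation \<gamma> f g \<longleftrightarrow>
     (\<forall>\<theta> :: (real^'d) \<times> (real^'d) \<Rightarrow> complex. test_function \<theta> \<longrightarrow>
        - (LINT (x, v)|lebesgue. f (x, v) *\<^sub>R frechet_derivative \<theta> (at (x, v)) (v, 0))
        = (LINT (x, v)|lebesgue. g (x, v) * bessel \<gamma> (\<lambda>w. \<theta> (x, w)) v))"

definition bounded_in_L1_loc :: "(nat \<Rightarrow> 'a::euclidean_space \<Rightarrow> real) \<Rightarrow> bool" where
  "bounded_in_L1_loc f \<longleftrightarrow>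
     (\<forall>n. f n \<in> borel_measurable lebesgue) \<and>
     (\<forall>K. compact K \<longrightarrow>
        (\<exists>C::real. \<forall>n. (\<integral>\<^sup>+z\<in>K. ennreal \<bar>f n z\<bar> \<partial>lebesgue) \<le> ennreal C))"

definition equi_integrable :: "(nat \<Rightarrow> 'a::euclidean_space \<Rightarrow> real) \<Rightarrow> bool" where
  "equi_integrable f \<longleftrightarrow>
     bounded_in_L1_loc f \<and>
     (\<forall>\<eta>>0. \<forall>K. compact K \<longrightarrow>
        (\<exists>\<delta>>0. \<forall>\<Omega>. \<Omega> \<in> sets lebesgue \<and> emeasure lebesgue \<Omega> < ennreal \<delta> \<longrightarrow>
           (\<forall>n. (\<integral>\<^sup>+z\<in>\<Omega> \<inter> K. ennreal \<bar>f n z\<bar> \<partial>lebesgue) < ennreal \<eta>)))"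

end

theory Submission
  imports Defs
begin

text \<open>
  The proof measures oscillations in physical space.  The low-frequency cut-off \<open>\<psi>\<close> is itself a
  nonnegative bump that equals \<open>1\<close> near the origin, so it can serve as a convolution kernel.  Let
  \<open>G\<^sub>m(x) = 2\<^bsup>mD\<^esup> \<psi>(2\<^sup>m x)\<close> and \<open>N\<^sub>m = G\<^sub>m\<^sub>+\<^sub>1 - G\<^sub>m\<close>; the norm \<open>osc_norm\<close> of \<open>u\<close> is
  \<open>\<parallel>G\<^sub>0 * u\<parallel>\<^sub>1 + \<Sum>\<^sub>m \<parallel>N\<^sub>m * u\<parallel>\<^sub>1\<close>.  It plays the role of the norm of \<open>B\<^sup>0\<^sub>1\<^sub>,\<^sub>1\<close>, but its kernels have compact
  support and can therefore be inserted in the transport equation as test functions.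

  The Besov norm controls \<open>osc_norm\<close> (\<open>osc_norm_le_besov_norm\<close>).  A dyadic block of frequency \<open>2\<^sup>k\<close> is
  reproduced by a kernel of scale \<open>2\<^sup>-\<^sup>k\<close>, and such a kernel is almost orthogonal to \<open>N\<^sub>m\<close>, with a gain
  \<open>2\<^bsup>-\<bar>m - k\<bar>\<^esup>\<close> (\<open>conv_dil_almost_orthogonal\<close>).

  For a nonnegative \<open>u\<close> the local averages at scale \<open>2\<^sup>-\<^sup>m\<close> are bounded by \<open>G\<^sub>m * u\<close>, which telescopes into
  the kernels above.  Hence the local maximal function of \<open>u\<close> is integrable, and a reverse weak-type
  inequality turns this into an \<open>L log L\<close> bound: the mass of \<open>u\<close> on a set \<open>E\<close> is at most
  \<open>(K / n + K 2\<^sup>n \<bar>E\<bar>) osc_norm u\<close> for every \<open>n\<close> (\<open>osc_norm_equi_integrable\<close>).  Applied for fixed \<open>x\<close>, this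
  gives equi-integrability in the velocity.

  Position is reached through the velocity averages \<open>\<rho>(x) = \<integral> f(x, v) \<kappa>(v) dv\<close>, where \<open>\<kappa>\<close> is a cut-off.
  Free transport during a time \<open>t\<close> replaces the position kernel \<open>N\<^sub>m(y - x)\<close> by \<open>N\<^sub>m(y - x - t v)\<close>, which in
  the variable \<open>v\<close> is a kernel of scale \<open>2\<^sup>-\<^sup>m / t\<close>.  With \<open>t = 2\<^bsup>j - m\<^esup>\<close> the oscillation of \<open>\<rho>\<close> at scale
  \<open>2\<^sup>-\<^sup>m\<close> is thus bounded by the velocity oscillation of \<open>f\<close> at scale \<open>2\<^sup>-\<^sup>j\<close>, up to an error
  \<open>t 2\<^bsup>jk\<^esup> \<parallel>g\<parallel>\<^sub>1\<close>, where \<open>k\<close> counts the velocity derivatives that the operator of order \<open>\<gamma>\<close> can cost.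
  If \<open>j\<close> is the integer part of \<open>m / (k + 2)\<close>, then the errors are summable and every velocity scale is
  used \<open>k + 2\<close> times, so \<open>osc_norm \<rho>\<close> is bounded whatever \<open>\<gamma>\<close> is (\<open>velocity_average_osc_norm\<close>).

  Finally, a set \<open>\<Omega>\<close> of small measure has small sections \<open>{v. (x, v) \<in> \<Omega>}\<close> except for \<open>x\<close> in a small
  set \<open>A\<close>.  Over the good positions the mass is small by equi-integrability in \<open>v\<close>; over \<open>A\<close> it is bounded
  by the integral of \<open>\<rho>\<close> over \<open>A\<close>, which is small because \<open>\<rho> \<ge> 0\<close> has a bounded \<open>osc_norm\<close>.
\<close>

section \<open>Smooth functions and test functions\<close>

abbreviation smooth :: "('a::euclidean_space \<Rightarrow> 'b::real_normed_vector) \<Rightarrow> bool" where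
  "smooth f \<equiv> \<forall>k. C_k k f"

lemma C_k_SucD: "C_k (Suc k) f \<Longrightarrow> C_k k f"
proof (induction k arbitrary: f)
  case 0
  then show ?case
    by (auto simp: continuous_on_eq_continuous_at dest: differentiable_imp_continuous_within)
next
  case (Suc k)
  then show ?case by (auto simp del: C_k.simps simp: C_k.simps(2)[of "Suc k" f] C_k.simps(2)[of k f])
qed

lemma C_k_SucI:
  assumes "\<And>x. (f has_derivative f' x) (at x)"
    and "\<And>b. b \<in> Basis \<Longrightarrow> C_k k (\<lambda>x. f' x b)"
  shows "C_k (Suc k) f"
proof -
  have "frechet_derivative f (at x) = f' x" for x
    using frechet_derivative_at[OF assms(1)] by simp
  then show ?thesis using assms by (auto simp: differentiable_def)
qed

lemma C_k_SucE:
  assumes "C_k (Suc k) f"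
  shows "(f has_derivative frechet_derivative f (at x)) (at x)"
    and "b \<in> Basis \<Longrightarrow> C_k k (\<lambda>x. frechet_derivative f (at x) b)"
  using assms by (auto simp: frechet_derivative_works)

lemma C_k_const: "C_k k (\<lambda>x. c)"
proof (induction k arbitrary: c)
  case (Suc k)
  show ?case by (rule C_k_SucI[where f'="\<lambda>x h. 0"]) (auto simp: Suc)
qed auto

lemma C_k_add: "C_k k f \<Longrightarrow> C_k k g \<Longrightarrow> C_k k (\<lambda>x. f x + g x)"
proof (induction k arbitrary: f g)
  case (Suc k)
  show ?case
    by (rule C_k_SucI[OF has_derivative_add[OF C_k_SucE(1)[OF Suc.prems(1)] C_k_SucE(1)[OF Suc.prems(2)]]])
       (rule Suc.IH[OF C_k_SucE(2)[OF Suc.prems(1)] C_k_SucE(2)[OF Suc.prems(2)]])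
qed (auto intro: continuous_on_add)

lemma C_k_linear_outer: "bounded_linear L \<Longrightarrow> C_k k f \<Longrightarrow> C_k k (\<lambda>x. L (f x))"
proof (induction k arbitrary: f)
  case 0
  then show ?case by (auto intro: bounded_linear.continuous_on)
next
  case (Suc k)
  show ?case
    by (rule C_k_SucI[OF bounded_linear.has_derivative[OF Suc.prems(1) C_k_SucE(1)[OF Suc.prems(2)]]])
       (rule Suc.IH[OF Suc.prems(1) C_k_SucE(2)[OF Suc.prems(2)]])
qed

lemma C_k_sum: "(\<And>i. i \<in> I \<Longrightarrow> C_k k (f i)) \<Longrightarrow> C_k k (\<lambda>x. \<Sum>i\<in>I. f i x)"
  by (induction I rule: infinite_finite_induct) (auto intro: C_k_const C_k_add)

lemma C_k_bilinear:
  assumes "bounded_bilinear B"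
  shows "C_k k f \<Longrightarrow> C_k k g \<Longrightarrow> C_k k (\<lambda>x. B (f x) (g x))"
proof (induction k arbitrary: f g)
  case 0
  then show ?case using bounded_bilinear.continuous_on[OF assms] by auto
next
  case (Suc k)
  show ?case
    by (rule C_k_SucI[OF bounded_bilinear.FDERIV[OF assms C_k_SucE(1)[OF Suc.prems(1)] C_k_SucE(1)[OF Suc.prems(2)]]])
       (intro C_k_add Suc.IH C_k_SucE(2)[OF Suc.prems(1)] C_k_SucE(2)[OF Suc.prems(2)]
              C_k_SucD[OF Suc.prems(1)] C_k_SucD[OF Suc.prems(2)]; assumption)
qed

lemma frechet_derivative_Basis_expand:
  assumes "f differentiable (at x)"
  shows "frechet_derivative f (at x) v = (\<Sum>i\<in>Basis. (v \<bullet> i) *\<^sub>R frechet_derivative f (at x) i)"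
proof -
  have l: "linear (frechet_derivative f (at x))"
    using assms by (rule linear_frechet_derivative)
  have "frechet_derivative f (at x) v = frechet_derivative f (at x) (\<Sum>i\<in>Basis. (v \<bullet> i) *\<^sub>R i)"
    by (simp add: euclidean_representation)
  then show ?thesis by (simp add: linear_sum[OF l] linear_scale[OF l])
qed

lemma C_k_affine:
  fixes A :: "'a::euclidean_space \<Rightarrow> 'b::euclidean_space"
  assumes A: "bounded_linear A"
  shows "C_k k f \<Longrightarrow> C_k k (\<lambda>x. f (A x + c))"
proof (induction k arbitrary: f)
  case 0
  then show ?case
    by (auto intro!: continuous_on_compose2[of UNIV f] continuous_intros
        linear_continuous_on[OF A])
next
  case (Suc k)
  have d: "((\<lambda>x. f (A x + c)) has_derivative (\<lambda>h. frechet_derivative f (at (A x + c)) (A h))) (at x)" for x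
  proof -
    have "((\<lambda>x. A x + c) has_derivative A) (at x)"
      using bounded_linear_imp_has_derivative[OF A] by (auto intro!: derivative_eq_intros)
    from has_derivative_compose[OF this C_k_SucE(1)[OF Suc.prems]] show ?thesis .
  qed
  show ?case
  proof (rule C_k_SucI[OF d])
    fix b :: 'a assume "b \<in> Basis"
    have "(\<lambda>x. frechet_derivative f (at (A x + c)) (A b)) =
        (\<lambda>x. \<Sum>i\<in>Basis. (A b \<bullet> i) *\<^sub>R frechet_derivative f (at (A x + c)) i)"
      using Suc.prems by (intro ext frechet_derivative_Basis_expand) auto
    then show "C_k k (\<lambda>x. frechet_derivative f (at (A x + c)) (A b))"
      by (auto intro!: C_k_sum C_k_linear_outer[OF bounded_linear_scaleR_right]
          Suc.IH[OF C_k_SucE(2)[OF Suc.prems]])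
  qed
qed

lemma test_function_iff:
  "test_function f \<longleftrightarrow> smooth f \<and> (\<exists>R>0. \<forall>x. R < norm x \<longrightarrow> f x = 0)"
proof -
  have "compact (topological_support f) \<longleftrightarrow> bounded {x. f x \<noteq> 0}"
    unfolding topological_support_def compact_eq_bounded_closed
    using bounded_subset closure_subset by auto
  also have "\<dots> \<longleftrightarrow> (\<exists>R>0. \<forall>x. R < norm x \<longrightarrow> f x = 0)"
    unfolding bounded_pos by force
  finally show ?thesis unfolding test_function_def by blast
qed

lemma test_function_smooth: "test_function f \<Longrightarrow> C_k k f"
  by (simp add: test_function_def)

lemma test_function_continuous: "test_function f \<Longrightarrow> continuous_on UNIV f"
  using test_function_smooth[of f 0] by simp

lemma test_function_has_derivative:
  "test_function f \<Longrightarrow> (f has_derivative frechet_derivative f (at x)) (at x)"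
  by (rule C_k_SucE(1)[OF test_function_smooth[of f "Suc 0"]])

lemma test_function_support:
  assumes "test_function f" obtains R where "R > 0" "\<And>x. R < norm x \<Longrightarrow> f x = 0"
  using assms test_function_iff by metis

lemma test_function_linear_outer:
  assumes "test_function f" "bounded_linear L"
  shows "test_function (\<lambda>x. L (f x))"
  using assms C_k_linear_outer[OF assms(2)] unfolding test_function_iff
  by (metis linear_simps(3))

lemma test_function_add:
  assumes "test_function f" "test_function g"
  shows "test_function (\<lambda>x. f x + g x)"
proof -
  obtain R S where "R > 0" "\<And>x. R < norm x \<Longrightarrow> f x = 0" "S > 0" "\<And>x. S < norm x \<Longrightarrow> g x = 0"
    using assms by (metis test_function_support)
  then have "\<exists>R>0. \<forall>x. R < norm x \<longrightarrow> f x + g x = 0" by (intro exI[of _ "max R S"]) auto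
  then show ?thesis using assms C_k_add unfolding test_function_iff by blast
qed

lemma test_function_diff:
  assumes "test_function f" "test_function g"
  shows "test_function (\<lambda>x. f x - g x)"
  using test_function_add[OF assms(1) test_function_linear_outer[OF assms(2) bounded_linear_minus[OF bounded_linear_ident]]]
  by simp

lemma test_function_dilate:
  fixes f :: "'a::euclidean_space \<Rightarrow> 'b::real_normed_vector"
  assumes "test_function f" "r \<noteq> 0"
  shows "test_function (\<lambda>x. f (r *\<^sub>R x))"
proof -
  obtain R where R: "R > 0" "\<And>x. R < norm x \<Longrightarrow> f x = 0"
    using assms by (metis test_function_support)
  have "\<exists>R>0. \<forall>x. R < norm x \<longrightarrow> f (r *\<^sub>R x) = 0"
    using R assms(2) by (intro exI[of _ "R / \<bar>r\<bar>"]) (auto simp: field_simps)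
  then show ?thesis
    using C_k_affine[OF bounded_linear_scaleR_right[of r], of _ f 0] test_function_smooth[OF assms(1)]
    unfolding test_function_iff by simp
qed

lemma test_function_deriv:
  assumes "test_function f" "b \<in> Basis"
  shows "test_function (\<lambda>x. frechet_derivative f (at x) b)"
proof -
  obtain R where R: "R > 0" "\<And>x. R < norm x \<Longrightarrow> f x = 0"
    using assms by (metis test_function_support)
  have "frechet_derivative f (at x) b = 0" if "R < norm x" for x
  proof -
    have "open {x. R < norm x}" by (intro open_Collect_less continuous_intros)
    from has_derivative_transform_within_open[OF has_derivative_const[of 0] this]
    have "(f has_derivative (\<lambda>h. 0)) (at x)" using R(2) that by auto
    then show ?thesis by (metis frechet_derivative_at)
  qed
  then have "\<exists>R>0. \<forall>x. R < norm x \<longrightarrow> frechet_derivative f (at x) b = 0" using R(1) by blast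
  moreover have "C_k k (\<lambda>x. frechet_derivative f (at x) b)" for k
    using test_function_smooth[OF assms(1), of "Suc k"] assms(2) by (rule C_k_SucE(2))
  ultimately show ?thesis unfolding test_function_iff by blast
qed

lemma test_function_bounded:
  fixes f :: "'a::euclidean_space \<Rightarrow> 'b::real_normed_vector"
  assumes "test_function f" obtains B where "B > 0" "\<And>x. norm (f x) \<le> B"
proof -
  obtain R where R: "R > 0" "\<And>x. R < norm x \<Longrightarrow> f x = 0"
    using assms by (metis test_function_support)
  have "compact (f ` cball 0 R)"
    using test_function_continuous[OF assms] by (intro compact_continuous_image) (auto intro: continuous_on_subset)
  from compact_imp_bounded[OF this] obtain B where B: "B > 0" "\<And>x. x \<in> cball 0 R \<Longrightarrow> norm (f x) \<le> B"
    unfolding bounded_pos by blast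
  have "norm (f x) \<le> B" for x using B R by (cases "norm x \<le> R") auto
  with B(1) show ?thesis using that by blast
qed

lemma test_function_measurable [measurable_dest]:
  "test_function f \<Longrightarrow> f \<in> borel_measurable borel"
  using test_function_continuous borel_measurable_continuous_onI by blast

lemma test_function_integrable:
  fixes f :: "'a::euclidean_space \<Rightarrow> 'b::{banach,second_countable_topology}"
  assumes "test_function f" shows "integrable lborel f"
proof -
  obtain R where R: "R > 0" "\<And>x. R < norm x \<Longrightarrow> f x = 0"
    using assms by (metis test_function_support)
  have "integrable lborel (\<lambda>x. indicator (cball 0 R) x *\<^sub>R f x)"
    using test_function_continuous[OF assms]
    by (intro borel_integrable_compact) (auto intro: continuous_on_subset)
  moreover have "(\<lambda>x. indicator (cball 0 R) x *\<^sub>R f x) = f" using R by (auto simp: indicator_def fun_eq_iff)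
  ultimately show ?thesis by simp
qed

lemma smooth_shear:
  fixes P :: "'a::euclidean_space \<Rightarrow> 'b::real_normed_vector"
  assumes "smooth P" shows "C_k k (\<lambda>z. P (y - fst z - s *\<^sub>R snd z))"
proof -
  have "bounded_linear (\<lambda>z::'a\<times>'a. - fst z - s *\<^sub>R snd z)"
    by (intro bounded_linear_sub bounded_linear_minus bounded_linear_fst bounded_linear_snd
        bounded_linear_compose[OF bounded_linear_scaleR_right])
  from C_k_affine[OF this, of k P y] show ?thesis using assms by (simp add: algebra_simps)
qed

text \<open>These are the test functions on phase space used below: the product \<open>P(y - x) Q(v)\<close> carried along the
  free flow during the time \<open>s\<close>.  For fixed \<open>s\<close> the support stays bounded because \<open>Q\<close> bounds \<open>v\<close>.\<close>

lemma test_function_shear_product: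
  fixes P Q :: "'a::euclidean_space \<Rightarrow> 'b::real_normed_algebra"
  assumes "test_function P" "test_function Q"
  shows "test_function (\<lambda>z. P (y - fst z - s *\<^sub>R snd z) * Q (snd z))"
proof -
  obtain R S where R: "R > 0" "\<And>x. R < norm x \<Longrightarrow> P x = 0" and S: "S > 0" "\<And>x. S < norm x \<Longrightarrow> Q x = 0"
    using assms by (metis test_function_support)
  have "C_k k (\<lambda>z::'a\<times>'a. Q (snd z))" for k
    using C_k_affine[OF bounded_linear_snd, of k Q 0] test_function_smooth[OF assms(2)] by simp
  then have "smooth (\<lambda>z. P (y - fst z - s *\<^sub>R snd z) * Q (snd z))"
    using smooth_shear[of P _ y s] test_function_smooth[OF assms(1)] C_k_bilinear[OF bounded_bilinear_mult] by blast
  moreover have "P (y - fst z - s *\<^sub>R snd z) * Q (snd z) = 0" if "norm y + R + \<bar>s\<bar> * S + S < norm z" for z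
  proof (rule ccontr)
    assume "P (y - fst z - s *\<^sub>R snd z) * Q (snd z) \<noteq> 0"
    then have "\<not> R < norm (y - fst z - s *\<^sub>R snd z)" and s: "\<not> S < norm (snd z)" using R S by auto
    moreover have "norm (fst z) \<le> norm y + norm (y - fst z - s *\<^sub>R snd z) + norm (s *\<^sub>R snd z)"
      using norm_triangle_ineq4[of "y - (y - fst z - s *\<^sub>R snd z)" "s *\<^sub>R snd z"]
        norm_triangle_ineq4[of y "y - fst z - s *\<^sub>R snd z"] by simp
    moreover have "norm (s *\<^sub>R snd z) \<le> \<bar>s\<bar> * S" using s by (auto intro: mult_left_mono)
    moreover have "norm z \<le> norm (fst z) + norm (snd z)"
      by (metis norm_Pair_le prod.collapse)
    ultimately show False using that by linarith
  qed
  moreover have "norm y + R + \<bar>s\<bar> * S + S > 0" using R S by (simp add: add_nonneg_pos)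
  ultimately show ?thesis unfolding test_function_iff by blast
qed

lemma test_function_shear_section:
  fixes P Q :: "'a::euclidean_space \<Rightarrow> 'b::real_normed_algebra"
  assumes "test_function P" "test_function Q"
  shows "test_function (\<lambda>w. P (z - \<tau> *\<^sub>R w) * Q w)"
proof -
  obtain S where S: "S > 0" "\<And>x. S < norm x \<Longrightarrow> Q x = 0"
    using assms by (metis test_function_support)
  have "C_k k (\<lambda>w. P (z - \<tau> *\<^sub>R w))" for k
    using C_k_affine[OF bounded_linear_scaleR_right[of "-\<tau>"], of k P z] test_function_smooth[OF assms(1)] by simp
  then have "smooth (\<lambda>w. P (z - \<tau> *\<^sub>R w) * Q w)"
    using test_function_smooth[OF assms(2)] C_k_bilinear[OF bounded_bilinear_mult] by blast
  then show ?thesis using S unfolding test_function_iff by (metis mult_zero_right)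
qed

abbreviation L1norm :: "('a::euclidean_space \<Rightarrow> 'b::real_normed_vector) \<Rightarrow> ennreal" where
  "L1norm u \<equiv> \<integral>\<^sup>+x. ennreal (norm (u x)) \<partial>lborel"

section \<open>Affine changes of variables\<close>

lemma nn_integral_lborel_affine:
  fixes f :: "'a::euclidean_space \<Rightarrow> ennreal"
  assumes [measurable]: "f \<in> borel_measurable borel" and c: "c \<noteq> 0"
  shows "(\<integral>\<^sup>+x. f x \<partial>lborel) = ennreal (\<bar>c\<bar> ^ DIM('a)) * (\<integral>\<^sup>+x. f (t + c *\<^sub>R x) \<partial>lborel)"
  by (subst lborel_affine[OF c, of t]) (simp add: nn_integral_density nn_integral_distr nn_integral_cmult)

lemma lborel_integrable_affine:
  fixes f :: "'a::euclidean_space \<Rightarrow> 'b::{banach,second_countable_topology}"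
  assumes f: "integrable lborel f" and c: "c \<noteq> 0"
  shows "integrable lborel (\<lambda>x. f (t + c *\<^sub>R x))"
proof -
  note [measurable] = borel_measurable_integrable[OF f, simplified]
  have "L1norm f < \<infinity>"
    using f unfolding integrable_iff_bounded by simp
  then have "(\<integral>\<^sup>+x. ennreal (norm (f (t + c *\<^sub>R x))) \<partial>lborel) < \<infinity>"
    using c by (subst (asm) nn_integral_lborel_affine[of _ c t]) (auto simp: ennreal_mult_less_top)
  then show ?thesis unfolding integrable_iff_bounded by simp
qed

lemma lborel_integral_affine:
  fixes f :: "'a::euclidean_space \<Rightarrow> 'b::{banach,second_countable_topology}"
  assumes [measurable]: "f \<in> borel_measurable borel" and c: "c \<noteq> 0"
  shows "(LINT x|lborel. f x) = \<bar>c\<bar> ^ DIM('a) *\<^sub>R (LINT x|lborel. f (t + c *\<^sub>R x))"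
  by (subst lborel_affine[OF c, of t]) (simp add: integral_density integral_distr)

lemma lborel_integral_reflect:
  fixes f :: "'a::euclidean_space \<Rightarrow> 'b::{banach,second_countable_topology}"
  assumes [measurable]: "f \<in> borel_measurable borel"
  shows "(LINT x|lborel. f (t - x)) = (LINT x|lborel. f x)"
  using lborel_integral_affine[of f "-1" t] by simp

lemma lborel_integral_shift:
  fixes f :: "'a::euclidean_space \<Rightarrow> 'b::{banach,second_countable_topology}"
  assumes [measurable]: "f \<in> borel_measurable borel"
  shows "(LINT x|lborel. f (t + x)) = (LINT x|lborel. f x)"
  using lborel_integral_affine[of f 1 t] by simp

lemma nn_integral_lborel_reflect:
  fixes f :: "'a::euclidean_space \<Rightarrow> ennreal"
  assumes [measurable]: "f \<in> borel_measurable borel"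
  shows "(\<integral>\<^sup>+x. f (t - x) \<partial>lborel) = (\<integral>\<^sup>+x. f x \<partial>lborel)"
  using nn_integral_lborel_affine[of f "-1" t] by simp

lemma nn_integral_lborel_shift:
  fixes f :: "'a::euclidean_space \<Rightarrow> ennreal"
  assumes [measurable]: "f \<in> borel_measurable borel"
  shows "(\<integral>\<^sup>+x. f (x - t) \<partial>lborel) = (\<integral>\<^sup>+x. f x \<partial>lborel)"
  using nn_integral_lborel_affine[of f 1 "-t"] by simp

lemma lborel_integrable_reflect:
  fixes f :: "'a::euclidean_space \<Rightarrow> 'b::{banach,second_countable_topology}"
  assumes "integrable lborel f"
  shows "integrable lborel (\<lambda>x. f (t - x))"
  using lborel_integrable_affine[of f "-1" t] assms by simp

section \<open>Polynomial weights\<close>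

lemma nn_integral_weight_real: "(\<integral>\<^sup>+(x::real). ennreal (1 / (1 + \<bar>x\<bar>)\<^sup>2) \<partial>lborel) \<le> 2"
proof -
  have 1: "(\<integral>\<^sup>+(x::real). ennreal (1 / (1 + x)\<^sup>2) * indicator {0..} x \<partial>lborel) = ennreal (0 - (- 1 / (1 + 0)))"
  proof (rule nn_integral_FTC_atLeast)
    show "((\<lambda>x. - 1 / (1 + x)) has_real_derivative 1 / (1 + x)\<^sup>2) (at x)" if "0 \<le> x" for x :: real
      using that by (auto intro!: derivative_eq_intros simp: power2_eq_square)
    show "((\<lambda>x::real. - 1 / (1 + x)) \<longlongrightarrow> 0) at_top"
      by (intro tendsto_divide_0[OF tendsto_const] filterlim_at_top_imp_at_infinity
          filterlim_tendsto_add_at_top[OF tendsto_const] filterlim_ident)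
  qed auto
  let ?f = "\<lambda>x::real. ennreal (1 / (1 + x)\<^sup>2) * indicator {0..} x"
  have "(\<integral>\<^sup>+(x::real). ennreal (1 / (1 + \<bar>x\<bar>)\<^sup>2) \<partial>lborel) \<le> (\<integral>\<^sup>+x. ?f x + ?f (0 - x) \<partial>lborel)"
    by (intro nn_integral_mono) (auto simp: indicator_def)
  also have "\<dots> = (\<integral>\<^sup>+x. ?f x \<partial>lborel) + (\<integral>\<^sup>+x. ?f (0 - x) \<partial>lborel)"
    by (rule nn_integral_add) measurable
  also have "(\<integral>\<^sup>+x. ?f (0 - x) \<partial>lborel) = (\<integral>\<^sup>+x. ?f x \<partial>lborel)"
    by (rule nn_integral_lborel_reflect) measurable
  finally show ?thesis using 1 by (simp add: one_add_one[symmetric] del: one_add_one)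
qed

text \<open>The weight is compared with the product over the coordinates of \<open>(1 + \<bar>x\<^sub>b\<bar>)\<^sup>-\<^sup>2\<close>, whose integral
  factorises.\<close>

lemma integrable_weight:
  fixes k :: nat
  assumes "2 * DIM('a) \<le> k"
  shows "integrable lborel (\<lambda>x::'a::euclidean_space. 1 / (1 + norm x) ^ k)"
proof -
  have "(\<integral>\<^sup>+(x::'a). ennreal (norm (1 / (1 + norm x) ^ k)) \<partial>lborel)
     \<le> (\<integral>\<^sup>+(x::'a). (\<Prod>b\<in>Basis. ennreal (1 / (1 + \<bar>x \<bullet> b\<bar>)\<^sup>2)) \<partial>lborel)"
  proof (rule nn_integral_mono)
    fix x :: 'a
    have "1 / (1 + norm x) ^ k \<le> 1 / (1 + norm x) ^ (2 * DIM('a))"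
      by (intro divide_left_mono power_increasing assms mult_pos_pos zero_less_power add_pos_nonneg) auto
    also have "\<dots> = (\<Prod>b\<in>(Basis::'a set). 1 / (1 + norm x)\<^sup>2)"
      by (simp add: power_mult power_divide)
    also have "\<dots> \<le> (\<Prod>b\<in>Basis. 1 / (1 + \<bar>x \<bullet> b\<bar>)\<^sup>2)"
      by (intro prod_mono conjI divide_left_mono power_mono add_left_mono Basis_le_norm
          mult_pos_pos zero_less_power add_pos_nonneg) auto
    finally have "1 / (1 + norm x) ^ k \<le> (\<Prod>b\<in>Basis. 1 / (1 + \<bar>x \<bullet> b\<bar>)\<^sup>2)" .
    then show "ennreal (norm (1 / (1 + norm x) ^ k)) \<le> (\<Prod>b\<in>Basis. ennreal (1 / (1 + \<bar>x \<bullet> b\<bar>)\<^sup>2))"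
      by (simp add: prod_ennreal ennreal_leI)
  qed
  also have "\<dots> = (\<Prod>b\<in>(Basis::'a set). \<integral>\<^sup>+x. ennreal (1 / (1 + \<bar>x\<bar>)\<^sup>2) \<partial>lborel)"
    by (rule nn_integral_lborel_prod) auto
  also have "\<dots> < \<infinity>"
    using order_le_less_trans[OF nn_integral_weight_real] by (simp add: power_less_top_ennreal)
  finally show ?thesis unfolding integrable_iff_bounded by simp
qed

lemma integrable_decay:
  fixes f :: "'a::euclidean_space \<Rightarrow> 'b::{banach,second_countable_topology}"
  assumes "f \<in> borel_measurable borel" "\<And>x. (1 + norm x) ^ (2 * DIM('a)) * norm (f x) \<le> C"
  shows "integrable lborel f"
proof (rule Bochner_Integration.integrable_bound)
  show "integrable lborel (\<lambda>x::'a. C * (1 / (1 + norm x) ^ (2 * DIM('a))))"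
    by (intro integrable_mult_right integrable_weight) simp
  show "AE x in lborel. norm (f x) \<le> norm (C * (1 / (1 + norm x) ^ (2 * DIM('a))))"
  proof (rule AE_I2)
    fix x :: 'a
    have "0 < (1 + norm x) ^ (2 * DIM('a))" by (simp add: add_pos_nonneg)
    with assms(2)[of x] have "norm (f x) \<le> C * (1 / (1 + norm x) ^ (2 * DIM('a)))"
      by (simp add: field_simps)
    then show "norm (f x) \<le> norm (C * (1 / (1 + norm x) ^ (2 * DIM('a))))"
      by (rule order_trans) (unfold real_norm_def, rule abs_ge_self)
  qed
qed (use assms in simp)

section \<open>Integration by parts\<close>

lemma has_vector_derivative_limit:
  assumes "(\<phi> has_vector_derivative D) (at 0)"
  shows "((\<lambda>t. (1 / t) *\<^sub>R (\<phi> t - \<phi> 0)) \<longlongrightarrow> D) (at 0)"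
proof -
  have "((\<lambda>t. norm (\<phi> (0 + t) - \<phi> 0 - t *\<^sub>R D) / norm t) \<longlongrightarrow> 0) (at 0)"
    using assms unfolding has_vector_derivative_def has_derivative_at by blast
  moreover have "norm (\<phi> (0 + t) - \<phi> 0 - t *\<^sub>R D) / norm t = norm ((1 / t) *\<^sub>R (\<phi> t - \<phi> 0) - D)"
    if "t \<noteq> 0" for t
  proof -
    have "(1 / t) *\<^sub>R (\<phi> t - \<phi> 0) - D = (1 / t) *\<^sub>R (\<phi> t - \<phi> 0 - t *\<^sub>R D)"
      using that by (simp add: algebra_simps)
    then show ?thesis by (simp add: divide_inverse mult.commute)
  qed
  ultimately have "((\<lambda>t. norm ((1 / t) *\<^sub>R (\<phi> t - \<phi> 0) - D)) \<longlongrightarrow> 0) (at 0)"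
    by (simp add: LIM_equal cong: LIM_cong)
  then show ?thesis by (metis Lim_null tendsto_norm_zero_iff)
qed

lemma norm_increment_le:
  fixes h :: "'a::euclidean_space \<Rightarrow> 'b::real_normed_vector"
  assumes h: "\<And>x. (h has_derivative h' x) (at x)" and B: "\<And>x. norm (h' x v) \<le> B"
  shows "norm (h (x + s *\<^sub>R v) - h x) \<le> B * \<bar>s\<bar>"
proof -
  have "norm (h (x + s *\<^sub>R v) - h (x + 0 *\<^sub>R v)) \<le> B * norm (s - 0)"
  proof (rule differentiable_bound[where S = UNIV])
    show "((\<lambda>t. h (x + t *\<^sub>R v)) has_derivative (\<lambda>dt. h' (x + t *\<^sub>R v) (dt *\<^sub>R v))) (at t within UNIV)" for t
      by (rule has_derivative_compose[of _ "\<lambda>dt. dt *\<^sub>R v", OF _ h]) (auto intro!: derivative_eq_intros)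
    show "onorm (\<lambda>dt. h' (x + t *\<^sub>R v) (dt *\<^sub>R v)) \<le> B" for t
    proof (rule onorm_le)
      fix dt :: real
      have "h' (x + t *\<^sub>R v) (dt *\<^sub>R v) = dt *\<^sub>R h' (x + t *\<^sub>R v) v"
        using has_derivative_linear[OF h] by (simp add: linear_scale)
      then show "norm (h' (x + t *\<^sub>R v) (dt *\<^sub>R v)) \<le> B * norm dt"
        using mult_right_mono[OF B, of "\<bar>dt\<bar>"] by (simp add: mult.commute)
    qed
  qed auto
  then show ?thesis by simp
qed

text \<open>All difference quotients in the direction \<open>b\<close> have integral zero by translation invariance, and they
  converge to the derivative under a common bound of bounded support.\<close>

lemma integral_directional_derivative_zero:
  fixes h :: "'a::euclidean_space \<Rightarrow> 'b::{banach,second_countable_topology}"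
  assumes h: "\<And>x. (h has_derivative h' x) (at x)" and B: "\<And>x. norm (h' x b) \<le> B"
    and [measurable]: "(\<lambda>x. h' x b) \<in> borel_measurable borel"
    and R: "\<And>x. R < norm x \<Longrightarrow> h x = 0" and int: "integrable lborel h"
  shows "(LINT x|lborel. h' x b) = 0"
proof -
  define s where "s n x = real (Suc n) *\<^sub>R (h (x + (1 / real (Suc n)) *\<^sub>R b) - h x)" for n x
  have [measurable]: "h \<in> borel_measurable borel"
    using h by (intro borel_measurable_continuous_onI continuous_at_imp_continuous_on)
       (auto dest: has_derivative_continuous)
  have "(\<lambda>n. LINT x|lborel. s n x) \<longlonglongrightarrow> (LINT x|lborel. h' x b)"
  proof (rule integral_dominated_convergence)
    show "integrable lborel (\<lambda>x::'a. B *\<^sub>R indicator (cball 0 (R + norm b)) x :: real)"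
      by (intro integrable_scaleR_right integrable_real_indicator)
         (use emeasure_lborel_cball_finite[of "0::'a" "R + norm b"] in \<open>auto simp: less_top\<close>)
    show "AE x in lborel. (\<lambda>n. s n x) \<longlonglongrightarrow> h' x b"
    proof (rule AE_I2)
      fix x
      have "((\<lambda>t. x + t *\<^sub>R b) has_derivative (\<lambda>dt. dt *\<^sub>R b)) (at 0)"
        by (auto intro!: derivative_eq_intros)
      from has_derivative_compose[OF this, of h "h' x"] h[of x]
      have "((\<lambda>t. h (x + t *\<^sub>R b)) has_derivative (\<lambda>dt. h' x (dt *\<^sub>R b))) (at 0)" by simp
      then have "((\<lambda>t. h (x + t *\<^sub>R b)) has_vector_derivative h' x b) (at 0)"
        unfolding has_vector_derivative_def
        using has_derivative_linear[OF h] by (simp add: linear_scale)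
      from has_vector_derivative_limit[OF this]
      have "((\<lambda>t. (1 / t) *\<^sub>R (h (x + t *\<^sub>R b) - h x)) \<longlongrightarrow> h' x b) (at 0)" by simp
      moreover have "filterlim (\<lambda>n. 1 / real (Suc n)) (at 0) sequentially"
        unfolding filterlim_at using LIMSEQ_inverse_real_of_nat by (simp add: inverse_eq_divide)
      ultimately have "(\<lambda>n. (1 / (1 / real (Suc n))) *\<^sub>R (h (x + (1 / real (Suc n)) *\<^sub>R b) - h x)) \<longlonglongrightarrow> h' x b"
        by (rule filterlim_compose)
      then show "(\<lambda>n. s n x) \<longlonglongrightarrow> h' x b" unfolding s_def by simp
    qed
    show "AE x in lborel. norm (s n x) \<le> B *\<^sub>R indicator (cball 0 (R + norm b)) x" for n
    proof (rule AE_I2)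
      fix x
      show "norm (s n x) \<le> B *\<^sub>R indicator (cball 0 (R + norm b)) x"
      proof (cases "norm x \<le> R + norm b")
        case True
        have "norm (s n x) \<le> real (Suc n) * (B * \<bar>1 / real (Suc n)\<bar>)"
          unfolding s_def norm_scaleR abs_of_nat
          by (intro mult_left_mono norm_increment_le[OF h B]) simp
        also have "\<dots> = B" by simp
        finally show ?thesis using True by simp
      next
        case False
        have "norm x \<le> norm (x + (1 / real (Suc n)) *\<^sub>R b) + norm ((1 / real (Suc n)) *\<^sub>R b)"
          using norm_triangle_ineq4[of "x + (1 / real (Suc n)) *\<^sub>R b" "(1 / real (Suc n)) *\<^sub>R b"] by simp
        moreover have "norm ((1 / real (Suc n)) *\<^sub>R b) \<le> norm b"
          by (simp add: field_simps mult_le_cancel_left1)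
        ultimately have "R < norm (x + (1 / real (Suc n)) *\<^sub>R b)" "R < norm x" using False
          by (auto, smt (verit) norm_ge_zero)
        then have "h x = 0" "h (x + (1 / real (Suc n)) *\<^sub>R b) = 0" using R by blast+
        then show ?thesis using False by (simp add: s_def)
      qed
    qed
  qed (simp_all add: s_def)
  moreover have "(LINT x|lborel. s n x) = 0" for n
    unfolding s_def
    using lborel_integral_shift[of h "(1 / real (Suc n)) *\<^sub>R b"]
      lborel_integrable_affine[OF int, of 1 "(1 / real (Suc n)) *\<^sub>R b"] int
    by (simp add: add.commute)
  ultimately show ?thesis by (simp add: LIMSEQ_const_iff)
qed

section \<open>The Fourier transform\<close>

lemma norm_exp_i_minus_1_le: "norm (exp (\<i> * complex_of_real t) - 1) \<le> \<bar>t\<bar>"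
proof -
  have "(norm (cis t - 1))\<^sup>2 = (cos t - 1)\<^sup>2 + (sin t)\<^sup>2" by (simp add: cmod_power2)
  also have "\<dots> = 2 - 2 * cos t" using sin_cos_squared_add[of t] by (simp add: power2_diff)
  also have "\<dots> = (2 * sin (t / 2))\<^sup>2"
    using cos_double_sin[of "t / 2"] by (simp add: power_mult_distrib)
  also have "\<dots> \<le> t\<^sup>2"
    using abs_sin_x_le_abs_x[of "t / 2"] by (intro abs_le_square_iff[THEN iffD1]) (simp add: abs_mult)
  finally show ?thesis by (simp add: cis_conv_exp abs_le_square_iff[symmetric])
qed

lemma norm_integral_le_nn_integral:
  fixes f :: "'a \<Rightarrow> 'b::{banach,second_countable_topology}"
  shows "ennreal (norm (integral\<^sup>L M f)) \<le> (\<integral>\<^sup>+x. norm (f x) \<partial>M)"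
  by (cases "integrable M f") (auto simp: integral_norm_bound_ennreal not_integrable_integral_eq)

abbreviation wave :: "real^'d \<Rightarrow> real^'d \<Rightarrow> complex" where
  "wave \<xi> v \<equiv> exp (\<i> * complex_of_real (\<xi> \<bullet> v))"

lemma wave_measurable [measurable]:
  "f \<in> borel_measurable M \<Longrightarrow> g \<in> borel_measurable M \<Longrightarrow> (\<lambda>x. wave (f x) (g x)) \<in> borel_measurable M"
  by measurable

lemma fourier_lborel:
  assumes [measurable]: "f \<in> borel_measurable borel"
  shows "fourier f \<xi> = (LINT v|lborel. wave (-\<xi>) v * f v)"
  unfolding fourier_def by (subst integral_completion) simp_all

lemma inverse_fourier_lborel:
  fixes h :: "real^'d \<Rightarrow> complex"
  assumes [measurable]: "h \<in> borel_measurable borel"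
  shows "inverse_fourier h v = (LINT \<xi>|lborel. wave \<xi> v * h \<xi>) / complex_of_real ((2 * pi) ^ CARD('d))"
  unfolding inverse_fourier_def by (subst integral_completion) simp_all

lemma integrable_wave_mult:
  "integrable lborel f \<Longrightarrow> integrable lborel (\<lambda>v. wave \<xi> v * f v)"
  by (rule Bochner_Integration.integrable_bound[of _ f])
     (auto simp: norm_mult dest: borel_measurable_integrable)

lemma integrable_wave_mult':
  "integrable lborel f \<Longrightarrow> integrable lborel (\<lambda>\<xi>. wave \<xi> v * f \<xi>)"
  using integrable_wave_mult[of f v] by (simp add: inner_commute)

lemma fourier_measurable [measurable]:
  fixes f :: "real^'d \<Rightarrow> complex"
  assumes [measurable]: "f \<in> borel_measurable borel"
  shows "fourier f \<in> borel_measurable borel"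
proof -
  have "(\<lambda>\<xi>. LINT v|lborel. wave (-\<xi>) v * f v) \<in> borel_measurable borel" by measurable
  also have "(\<lambda>\<xi>. LINT v|lborel. wave (-\<xi>) v * f v) = fourier f"
    by (intro ext) (simp add: fourier_lborel)
  finally show ?thesis .
qed

lemma inverse_fourier_measurable [measurable]:
  fixes f :: "real^'d \<Rightarrow> complex"
  assumes [measurable]: "f \<in> borel_measurable borel"
  shows "inverse_fourier f \<in> borel_measurable borel"
proof -
  have "(\<lambda>v. (LINT \<xi>|lborel. wave \<xi> v * f \<xi>) / complex_of_real ((2 * pi) ^ CARD('d))) \<in> borel_measurable borel"
    by measurable
  also have "(\<lambda>v. (LINT \<xi>|lborel. wave \<xi> v * f \<xi>) / complex_of_real ((2 * pi) ^ CARD('d))) = inverse_fourier f"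
    by (intro ext) (simp add: inverse_fourier_lborel)
  finally show ?thesis .
qed

lemma norm_fourier_le:
  assumes "integrable lborel f"
  shows "norm (fourier f \<xi>) \<le> (LINT v|lborel. norm (f v))"
proof -
  have "norm (LINT v|lborel. wave (-\<xi>) v * f v) \<le> (LINT v|lborel. norm (wave (-\<xi>) v * f v))"
    by (rule integral_norm_bound)
  then show ?thesis
    using assms by (subst fourier_lborel) (simp_all add: norm_mult borel_measurable_integrable)
qed

lemma continuous_fourier:
  assumes f: "integrable lborel f"
  shows "continuous_on UNIV (fourier f)"
proof -
  have "isCont (fourier f) \<xi>" for \<xi>
    unfolding continuous_at_sequentially o_def
  proof (intro allI impI)
    fix X assume X: "X \<longlonglongrightarrow> \<xi>"
    have "(\<lambda>n. LINT v|lborel. wave (- X n) v * f v) \<longlonglongrightarrow> (LINT v|lborel. wave (-\<xi>) v * f v)"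
      by (rule integral_dominated_convergence[where w = "\<lambda>v. norm (f v)"])
         (use f X in \<open>auto simp: norm_mult dest: borel_measurable_integrable intro!: AE_I2 tendsto_intros\<close>)
    then show "(\<lambda>n. fourier f (X n)) \<longlonglongrightarrow> fourier f \<xi>"
      using f by (simp add: fourier_lborel borel_measurable_integrable)
  qed
  then show ?thesis by (simp add: continuous_on_eq_continuous_at)
qed

lemma has_derivative_wave:
  "((\<lambda>v. wave \<xi> v) has_derivative (\<lambda>y. wave \<xi> v * (\<i> * complex_of_real (\<xi> \<bullet> y)))) (at v)"
proof -
  have "((\<lambda>v. \<i> * complex_of_real (\<xi> \<bullet> v)) has_derivative (\<lambda>y. \<i> * complex_of_real (\<xi> \<bullet> y))) (at v)"
    by (auto intro!: derivative_eq_intros)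
  from has_derivative_compose[OF this, of exp "(*) (exp (\<i> * complex_of_real (\<xi> \<bullet> v)))"]
  show ?thesis using DERIV_exp has_field_derivative_def by blast
qed

lemma fourier_deriv:
  assumes \<theta>: "test_function \<theta>" and b: "b \<in> Basis"
  shows "fourier (\<lambda>v. frechet_derivative \<theta> (at v) b) \<xi> = \<i> * complex_of_real (\<xi> \<bullet> b) * fourier \<theta> \<xi>"
proof -
  let ?\<theta>' = "\<lambda>v. frechet_derivative \<theta> (at v) b"
  note [measurable] = test_function_measurable[OF \<theta>] test_function_measurable[OF test_function_deriv[OF \<theta> b]]
  obtain R where R: "R > 0" "\<And>x. R < norm x \<Longrightarrow> \<theta> x = 0"
    using \<theta> by (metis test_function_support)
  obtain B where B: "\<And>x. norm (\<theta> x) \<le> B" using \<theta> by (metis test_function_bounded)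
  obtain B' where B': "\<And>x. norm (?\<theta>' x) \<le> B'" using test_function_deriv[OF \<theta> b] by (metis test_function_bounded)
  define h' where "h' v y = wave (-\<xi>) v * frechet_derivative \<theta> (at v) y
      + wave (-\<xi>) v * (\<i> * complex_of_real (-\<xi> \<bullet> y)) * \<theta> v" for v y
  have "(LINT v|lborel. h' v b) = 0"
  proof (rule integral_directional_derivative_zero)
    show "((\<lambda>v. wave (-\<xi>) v * \<theta> v) has_derivative h' v) (at v)" for v
      unfolding h'_def
      by (rule has_derivative_mult[OF has_derivative_wave test_function_has_derivative[OF \<theta>]])
    show "norm (h' x b) \<le> B' + \<bar>\<xi> \<bullet> b\<bar> * B" for x
    proof -
      have "norm (h' x b) \<le> norm (?\<theta>' x) + \<bar>\<xi> \<bullet> b\<bar> * norm (\<theta> x)"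
        unfolding h'_def by (rule norm_triangle_le) (simp add: norm_mult)
      also have "\<dots> \<le> B' + \<bar>\<xi> \<bullet> b\<bar> * B" by (intro add_mono mult_left_mono B B') simp
      finally show ?thesis .
    qed
    show "(\<lambda>v. h' v b) \<in> borel_measurable borel" unfolding h'_def by measurable
    show "integrable lborel (\<lambda>v. wave (-\<xi>) v * \<theta> v)"
      by (intro integrable_wave_mult test_function_integrable \<theta>)
  qed (use R in auto)
  also have "(LINT v|lborel. h' v b) = (LINT v|lborel. wave (-\<xi>) v * ?\<theta>' v)
      + (LINT v|lborel. (\<i> * complex_of_real (-\<xi> \<bullet> b)) * (wave (-\<xi>) v * \<theta> v))"
    unfolding h'_def
    using Bochner_Integration.integral_add[OF
        integrable_wave_mult[OF test_function_integrable[OF test_function_deriv[OF \<theta> b]]]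
        integrable_mult_right[OF integrable_wave_mult[OF test_function_integrable[OF \<theta>]]],
        of "-\<xi>" "\<i> * complex_of_real (-\<xi> \<bullet> b)" "-\<xi>"]
    by (simp only: mult_ac)
  also have "(LINT v|lborel. (\<i> * complex_of_real (-\<xi> \<bullet> b)) * (wave (-\<xi>) v * \<theta> v))
      = (\<i> * complex_of_real (-\<xi> \<bullet> b)) * (LINT v|lborel. wave (-\<xi>) v * \<theta> v)"
    by (rule integral_mult_right_zero)
  finally show ?thesis by (simp add: fourier_lborel)
qed

lemma one_plus_norm_mult_le:
  assumes "0 \<le> F"
  shows "(1 + norm (\<xi>::'a::euclidean_space)) * F \<le> F + (\<Sum>b\<in>Basis. \<bar>\<xi> \<bullet> b\<bar> * F)"
  using mult_right_mono[OF norm_le_l1[of \<xi>] assms] by (simp add: distrib_right sum_distrib_right)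

text \<open>Integration by parts trades one power of \<open>\<xi>\<close> for one derivative of \<open>\<theta>\<close>, which is again a test function.\<close>

lemma fourier_decay:
  assumes "test_function \<theta>"
  shows "\<exists>C. \<forall>\<xi>. (1 + norm \<xi>) ^ k * norm (fourier \<theta> \<xi>) \<le> C"
  using assms
proof (induction k arbitrary: \<theta>)
  case 0
  then show ?case using norm_fourier_le[OF test_function_integrable] by auto
next
  case (Suc k)
  obtain C0 where C0: "\<And>\<xi>. (1 + norm \<xi>) ^ k * norm (fourier \<theta> \<xi>) \<le> C0"
    using Suc.IH[OF Suc.prems] by blast
  have "\<forall>b\<in>Basis. \<exists>C. \<forall>\<xi>. (1 + norm \<xi>) ^ k * norm (fourier (\<lambda>v. frechet_derivative \<theta> (at v) b) \<xi>) \<le> C"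
    using Suc.IH test_function_deriv[OF Suc.prems] by blast
  then obtain C where C: "\<And>b \<xi>. b \<in> Basis \<Longrightarrow>
      (1 + norm \<xi>) ^ k * norm (fourier (\<lambda>v. frechet_derivative \<theta> (at v) b) \<xi>) \<le> C b"
    by metis
  have "(1 + norm \<xi>) ^ Suc k * norm (fourier \<theta> \<xi>) \<le> C0 + (\<Sum>b\<in>Basis. C b)" for \<xi>
  proof -
    have "(1 + norm \<xi>) ^ Suc k * norm (fourier \<theta> \<xi>)
        = (1 + norm \<xi>) * ((1 + norm \<xi>) ^ k * norm (fourier \<theta> \<xi>))" by simp
    also have "\<dots> \<le> (1 + norm \<xi>) ^ k * norm (fourier \<theta> \<xi>)
        + (\<Sum>b\<in>Basis. \<bar>\<xi> \<bullet> b\<bar> * ((1 + norm \<xi>) ^ k * norm (fourier \<theta> \<xi>)))"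
      by (rule one_plus_norm_mult_le) simp
    also have "\<dots> \<le> C0 + (\<Sum>b\<in>Basis. C b)"
      using C by (intro add_mono C0 sum_mono) (simp add: fourier_deriv[OF Suc.prems] norm_mult mult_ac)
    finally show ?thesis .
  qed
  then show ?case by blast
qed

lemma fourier_integrable:
  fixes \<theta> :: "real^'d \<Rightarrow> complex"
  assumes "test_function \<theta>" shows "integrable lborel (fourier \<theta>)"
proof -
  obtain C where "\<And>\<xi>. (1 + norm \<xi>) ^ (2 * DIM(real^'d)) * norm (fourier \<theta> (\<xi>::real^'d)) \<le> C"
    using fourier_decay[OF assms] by blast
  moreover have "fourier \<theta> \<in> borel_measurable borel"
    using test_function_measurable[OF assms] by measurable
  ultimately show ?thesis using integrable_decay by blast
qed

text \<open>This plays the part of a decay estimate for the gradient of the transform.  Multiplied by \<open>\<i> \<xi>\<^sub>b\<close>, the increment becomes the increment of the transform of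
  \<open>\<partial>\<^sub>b \<theta>\<close> plus \<open>\<i> y\<^sub>b\<close> times the transform at \<open>\<xi> - y\<close>; the second term is already linear in \<open>y\<close> and
  decays by the previous lemma.\<close>

lemma fourier_increment_decay:
  assumes "test_function \<theta>"
  shows "\<exists>C. \<forall>\<xi> y. norm y \<le> 1 \<longrightarrow> (1 + norm \<xi>) ^ k * norm (fourier \<theta> (\<xi> - y) - fourier \<theta> \<xi>) \<le> C * norm y"
  using assms
proof (induction k arbitrary: \<theta>)
  case 0
  obtain R where R: "R > 0" "\<And>x. R < norm x \<Longrightarrow> \<theta> x = 0"
    using 0 by (metis test_function_support)
  note [measurable] = test_function_measurable[OF 0]
  have "norm (fourier \<theta> (\<xi> - y) - fourier \<theta> \<xi>) \<le> (R * (LINT v|lborel. norm (\<theta> v))) * norm y" for \<xi> y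
  proof -
    have "fourier \<theta> (\<xi> - y) - fourier \<theta> \<xi> = (LINT v|lborel. wave (-(\<xi> - y)) v * \<theta> v - wave (-\<xi>) v * \<theta> v)"
      unfolding fourier_lborel[OF test_function_measurable[OF 0]]
      by (rule Bochner_Integration.integral_diff[symmetric]; intro integrable_wave_mult test_function_integrable[OF 0])
    also have "norm \<dots> \<le> (LINT v|lborel. norm y * R * norm (\<theta> v))"
    proof (rule order_trans[OF integral_norm_bound], rule integral_mono)
      show "integrable lborel (\<lambda>v. norm (wave (-(\<xi> - y)) v * \<theta> v - wave (-\<xi>) v * \<theta> v))"
        by (intro integrable_norm Bochner_Integration.integrable_diff integrable_wave_mult test_function_integrable[OF 0])
      show "integrable lborel (\<lambda>v. norm y * R * norm (\<theta> v))"
        by (intro integrable_mult_right integrable_norm test_function_integrable[OF 0])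
      fix v
      show "norm (wave (-(\<xi> - y)) v * \<theta> v - wave (-\<xi>) v * \<theta> v) \<le> norm y * R * norm (\<theta> v)"
      proof (cases "R < norm v")
        case False
        have "wave (-(\<xi> - y)) v = wave (-\<xi>) v * wave y v"
          by (simp add: exp_add[symmetric] algebra_simps inner_diff_left)
        then have "norm (wave (-(\<xi> - y)) v * \<theta> v - wave (-\<xi>) v * \<theta> v) = norm (wave (-\<xi>) v * ((wave y v - 1) * \<theta> v))"
          by (simp add: algebra_simps)
        also have "\<dots> = norm (wave y v - 1) * norm (\<theta> v)" by (simp add: norm_mult)
        also have "norm (wave y v - 1) \<le> \<bar>y \<bullet> v\<bar>"
          by (rule norm_exp_i_minus_1_le)
        also have "\<bar>y \<bullet> v\<bar> \<le> norm y * R"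
          using Cauchy_Schwarz_ineq2[of y v] mult_left_mono[of "norm v" R "norm y"] False by auto
        finally show ?thesis by (simp add: mult_right_mono)
      qed (use R in auto)
    qed
    also have "\<dots> = (R * (LINT v|lborel. norm (\<theta> v))) * norm y" by simp
    finally show ?thesis .
  qed
  then show ?case by auto
next
  case (Suc k)
  obtain C0 where C0: "\<And>\<xi> y. norm y \<le> 1 \<Longrightarrow> (1 + norm \<xi>) ^ k * norm (fourier \<theta> (\<xi> - y) - fourier \<theta> \<xi>) \<le> C0 * norm y"
    using Suc.IH[OF Suc.prems] by blast
  let ?d = "\<lambda>b v. frechet_derivative \<theta> (at v) b"
  have "\<forall>b\<in>Basis. \<exists>C. \<forall>\<xi> y. norm y \<le> 1 \<longrightarrow>
      (1 + norm \<xi>) ^ k * norm (fourier (?d b) (\<xi> - y) - fourier (?d b) \<xi>) \<le> C * norm y"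
    using Suc.IH test_function_deriv[OF Suc.prems] by blast
  then obtain C where C: "\<And>b \<xi> y. b \<in> Basis \<Longrightarrow> norm y \<le> 1 \<Longrightarrow>
      (1 + norm \<xi>) ^ k * norm (fourier (?d b) (\<xi> - y) - fourier (?d b) \<xi>) \<le> C b * norm y"
    by metis
  obtain E where E: "\<And>\<xi>. (1 + norm \<xi>) ^ k * norm (fourier \<theta> \<xi>) \<le> E"
    using fourier_decay[OF Suc.prems] by blast
  have "(1 + norm \<xi>) ^ Suc k * norm (fourier \<theta> (\<xi> - y) - fourier \<theta> \<xi>)
      \<le> (C0 + (\<Sum>b\<in>Basis. C b + 2 ^ k * E)) * norm y" if y: "norm y \<le> 1" for \<xi> y
  proof -
    let ?D = "norm (fourier \<theta> (\<xi> - y) - fourier \<theta> \<xi>)"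
    have shift: "(1 + norm \<xi>) ^ k * norm (fourier \<theta> (\<xi> - y)) \<le> 2 ^ k * E"
    proof -
      have "1 + norm \<xi> \<le> 2 * (1 + norm (\<xi> - y))"
        using norm_triangle_ineq[of "\<xi> - y" y] y norm_ge_zero[of "\<xi> - y"] by (simp, linarith)
      then have "(1 + norm \<xi>) ^ k \<le> 2 ^ k * (1 + norm (\<xi> - y)) ^ k"
        by (metis add_nonneg_nonneg norm_ge_zero power_mono power_mult_distrib zero_le_one)
      then have "(1 + norm \<xi>) ^ k * norm (fourier \<theta> (\<xi> - y)) \<le> 2 ^ k * ((1 + norm (\<xi> - y)) ^ k * norm (fourier \<theta> (\<xi> - y)))"
        by (simp add: mult_right_mono mult.assoc[symmetric])
      also have "\<dots> \<le> 2 ^ k * E" by (intro mult_left_mono E) simp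
      finally show ?thesis .
    qed
    have b: "\<bar>\<xi> \<bullet> b\<bar> * ((1 + norm \<xi>) ^ k * ?D) \<le> (C b + 2 ^ k * E) * norm y" if b: "b \<in> Basis" for b
    proof -
      have "\<bar>\<xi> \<bullet> b\<bar> * ?D = norm (\<i> * complex_of_real (\<xi> \<bullet> b) * (fourier \<theta> (\<xi> - y) - fourier \<theta> \<xi>))"
        by (simp add: norm_mult)
      also have "\<i> * complex_of_real (\<xi> \<bullet> b) * (fourier \<theta> (\<xi> - y) - fourier \<theta> \<xi>)
          = (fourier (?d b) (\<xi> - y) - fourier (?d b) \<xi>) + \<i> * complex_of_real (y \<bullet> b) * fourier \<theta> (\<xi> - y)"
        by (simp add: fourier_deriv[OF Suc.prems b] inner_diff_left algebra_simps)
      also have "norm \<dots> \<le> norm (fourier (?d b) (\<xi> - y) - fourier (?d b) \<xi>) + norm y * norm (fourier \<theta> (\<xi> - y))"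
        by (rule norm_triangle_le) (auto simp: norm_mult intro!: mult_right_mono Basis_le_norm b)
      finally have "(1 + norm \<xi>) ^ k * (\<bar>\<xi> \<bullet> b\<bar> * ?D)
          \<le> (1 + norm \<xi>) ^ k * (norm (fourier (?d b) (\<xi> - y) - fourier (?d b) \<xi>) + norm y * norm (fourier \<theta> (\<xi> - y)))"
        by (rule mult_left_mono) simp
      also have "\<dots> = (1 + norm \<xi>) ^ k * norm (fourier (?d b) (\<xi> - y) - fourier (?d b) \<xi>)
           + norm y * ((1 + norm \<xi>) ^ k * norm (fourier \<theta> (\<xi> - y)))"
        by (simp add: algebra_simps)
      also have "\<dots> \<le> C b * norm y + norm y * (2 ^ k * E)"
        by (intro add_mono C b y mult_left_mono shift) simp
      finally show ?thesis by (simp add: algebra_simps)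
    qed
    have "(1 + norm \<xi>) ^ Suc k * ?D = (1 + norm \<xi>) * ((1 + norm \<xi>) ^ k * ?D)" by simp
    also have "\<dots> \<le> (1 + norm \<xi>) ^ k * ?D + (\<Sum>b\<in>Basis. \<bar>\<xi> \<bullet> b\<bar> * ((1 + norm \<xi>) ^ k * ?D))"
      by (rule one_plus_norm_mult_le) simp
    also have "\<dots> \<le> C0 * norm y + (\<Sum>b\<in>Basis. (C b + 2 ^ k * E) * norm y)"
      by (intro add_mono C0 y sum_mono b)
    also have "\<dots> = (C0 + (\<Sum>b\<in>Basis. C b + 2 ^ k * E)) * norm y"
      by (simp add: algebra_simps sum_distrib_left)
    finally show ?thesis .
  qed
  then show ?case by blast
qed

section \<open>Convolution\<close>

lemma integrable_product_mult:
  fixes f :: "'a::euclidean_space \<Rightarrow> complex" and g :: "'b::euclidean_space \<Rightarrow> complex"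
  assumes f: "integrable lborel f" and g: "integrable lborel g"
  shows "integrable (lborel \<Otimes>\<^sub>M lborel) (\<lambda>(x, y). f x * g y)"
proof -
  note [measurable] = borel_measurable_integrable[OF f] borel_measurable_integrable[OF g]
  have "(\<integral>\<^sup>+z. ennreal (norm (f (fst z) * g (snd z))) \<partial>(lborel \<Otimes>\<^sub>M lborel))
     = (\<integral>\<^sup>+x. \<integral>\<^sup>+y. ennreal (norm (f x)) * ennreal (norm (g y)) \<partial>lborel \<partial>lborel)"
    by (subst lborel.nn_integral_fst[symmetric]) (auto simp: norm_mult ennreal_mult)
  also have "\<dots> = L1norm f * L1norm g"
    by (simp add: nn_integral_cmult nn_integral_multc)
  also have "\<dots> < \<infinity>" using f g by (simp add: integrable_iff_bounded ennreal_mult_less_top)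
  finally show ?thesis unfolding integrable_iff_bounded by (simp add: split_beta)
qed

definition conv :: "('a::euclidean_space \<Rightarrow> complex) \<Rightarrow> ('a \<Rightarrow> complex) \<Rightarrow> 'a \<Rightarrow> complex" where
  "conv a b x = (LINT y|lborel. a (x - y) * b y)"

lemma conv_measurable [measurable]:
  fixes a b :: "'a::euclidean_space \<Rightarrow> complex"
  assumes [measurable]: "a \<in> borel_measurable borel" "b \<in> borel_measurable borel"
  shows "conv a b \<in> borel_measurable borel"
  unfolding conv_def[abs_def] by measurable

lemma conv_commute:
  fixes a b :: "'a::euclidean_space \<Rightarrow> complex"
  assumes [measurable]: "a \<in> borel_measurable borel" "b \<in> borel_measurable borel"
  shows "conv a b = conv b a"
  using lborel_integral_reflect[of "\<lambda>y. a (x - y) * b y" x for x]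
  by (auto simp: conv_def mult.commute fun_eq_iff)

lemma conv_young:
  fixes a b :: "'a::euclidean_space \<Rightarrow> complex"
  assumes [measurable]: "a \<in> borel_measurable borel" "b \<in> borel_measurable borel"
  shows "L1norm (conv a b) \<le> L1norm a * L1norm b"
proof -
  have "L1norm (conv a b) \<le> (\<integral>\<^sup>+x. \<integral>\<^sup>+y. norm (a (x - y) * b y) \<partial>lborel \<partial>lborel)"
    unfolding conv_def by (intro nn_integral_mono norm_integral_le_nn_integral)
  also have "\<dots> = (\<integral>\<^sup>+y. \<integral>\<^sup>+x. norm (a (x - y) * b y) \<partial>lborel \<partial>lborel)"
    by (rule lborel_pair.Fubini') measurable
  also have "\<dots> = (\<integral>\<^sup>+y. L1norm a * norm (b y) \<partial>lborel)"
    by (simp add: norm_mult ennreal_mult nn_integral_multc nn_integral_lborel_shift[of "\<lambda>x. ennreal (norm (a x))"])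
  also have "\<dots> = L1norm a * L1norm b"
    by (rule nn_integral_cmult) measurable
  finally show ?thesis .
qed

lemma fubini_swap:
  fixes F :: "'a::euclidean_space \<Rightarrow> 'b::euclidean_space \<Rightarrow> complex" and f g :: "_ \<Rightarrow> complex"
  assumes "integrable lborel f" "integrable lborel g"
    and [measurable]: "case_prod F \<in> borel_measurable (lborel \<Otimes>\<^sub>M lborel)"
    and "\<And>x y. norm (F x y) \<le> norm (f x) * norm (g y)"
  shows "(LINT y|lborel. LINT x|lborel. F x y) = (LINT x|lborel. LINT y|lborel. F x y)"
proof (rule lborel_pair.Fubini_integral)
  show "integrable (lborel \<Otimes>\<^sub>M lborel) (case_prod F)"
    by (rule Bochner_Integration.integrable_bound[OF integrable_product_mult[of "\<lambda>x. complex_of_real (norm (f x))" "\<lambda>y. complex_of_real (norm (g y))"]])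
       (use assms in \<open>auto intro!: AE_I2 integrable_of_real integrable_norm simp: norm_mult\<close>)
qed

text \<open>By Fubini's theorem, convolution acts on an inverse transform by multiplication of its symbol.\<close>

lemma conv_inverse_fourier:
  fixes a h :: "real^'d \<Rightarrow> complex"
  assumes a: "integrable lborel a" and h: "integrable lborel h"
  shows "conv a (inverse_fourier h) = inverse_fourier (\<lambda>\<xi>. fourier a \<xi> * h \<xi>)"
proof
  fix x
  note [measurable] = borel_measurable_integrable[OF a, simplified] borel_measurable_integrable[OF h, simplified]
  let ?c = "complex_of_real ((2 * pi) ^ CARD('d))"
  have "conv a (inverse_fourier h) x = (LINT y|lborel. (LINT \<xi>|lborel. a (x - y) * (wave \<xi> y * h \<xi>)) / ?c)"
    unfolding conv_def by (simp add: inverse_fourier_lborel)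
  also have "\<dots> = (LINT y|lborel. (LINT \<xi>|lborel. a (x - y) * (wave \<xi> y * h \<xi>))) / ?c" by simp
  also have "(LINT y|lborel. (LINT \<xi>|lborel. a (x - y) * (wave \<xi> y * h \<xi>)))
      = (LINT \<xi>|lborel. (LINT y|lborel. a (x - y) * (wave \<xi> y * h \<xi>)))"
    by (rule fubini_swap[OF h lborel_integrable_reflect[OF a, of x]]) (auto simp: norm_mult)
  also have "\<dots> = (LINT \<xi>|lborel. wave \<xi> x * (fourier a \<xi> * h \<xi>))"
  proof (rule Bochner_Integration.integral_cong[OF refl])
    fix \<xi>
    have "(LINT y|lborel. a (x - y) * (wave \<xi> y * h \<xi>)) = (LINT y|lborel. a y * (wave \<xi> (x - y) * h \<xi>))"
      using lborel_integral_reflect[of "\<lambda>y. a y * (wave \<xi> (x - y) * h \<xi>)" x] by simp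
    also have "\<dots> = (LINT y|lborel. (wave \<xi> x * h \<xi>) * (wave (-\<xi>) y * a y))"
      by (intro Bochner_Integration.integral_cong refl)
         (simp add: inner_diff_right right_diff_distrib exp_diff exp_minus field_simps)
    also have "\<dots> = (wave \<xi> x * h \<xi>) * (LINT y|lborel. wave (-\<xi>) y * a y)"
      by (rule integral_mult_right_zero)
    finally show "(LINT y|lborel. a (x - y) * (wave \<xi> y * h \<xi>)) = wave \<xi> x * (fourier a \<xi> * h \<xi>)"
      by (simp add: fourier_lborel)
  qed
  also have "\<dots> / ?c = inverse_fourier (\<lambda>\<xi>. fourier a \<xi> * h \<xi>) x"
    by (subst inverse_fourier_lborel) measurable
  finally show "conv a (inverse_fourier h) x = inverse_fourier (\<lambda>\<xi>. fourier a \<xi> * h \<xi>) x" .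
qed

lemma integrable_conv:
  assumes a: "integrable lborel a" and b: "integrable lborel b"
  shows "integrable lborel (conv a b)"
proof -
  note [measurable] = borel_measurable_integrable[OF a, simplified] borel_measurable_integrable[OF b, simplified]
  have "L1norm (conv a b) \<le> L1norm a * L1norm b"
    by (rule conv_young) measurable
  also have "\<dots> < \<infinity>" using a b by (simp add: integrable_iff_bounded ennreal_mult_less_top)
  finally show ?thesis unfolding integrable_iff_bounded by simp
qed

lemma fourier_conv:
  fixes a b :: "real^'d \<Rightarrow> complex"
  assumes a: "integrable lborel a" and b: "integrable lborel b"
  shows "fourier (conv a b) \<xi> = fourier a \<xi> * fourier b \<xi>"
proof -
  note [measurable] = borel_measurable_integrable[OF a, simplified] borel_measurable_integrable[OF b, simplified]
  have "fourier (conv a b) \<xi> = (LINT x|lborel. LINT y|lborel. wave (-\<xi>) x * (a (x - y) * b y))"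
    by (simp add: fourier_lborel conv_def)
  also have "\<dots> = (LINT y|lborel. LINT x|lborel. wave (-\<xi>) x * (a (x - y) * b y))"
  proof (rule lborel_pair.Fubini_integral)
    have "(\<integral>\<^sup>+z. ennreal (norm (wave (-\<xi>) (snd z) * (a (snd z - fst z) * b (fst z)))) \<partial>(lborel \<Otimes>\<^sub>M lborel))
       = (\<integral>\<^sup>+y. \<integral>\<^sup>+x. ennreal (norm (a (x - y))) * ennreal (norm (b y)) \<partial>lborel \<partial>lborel)"
      by (subst lborel.nn_integral_fst[symmetric]) (auto simp: norm_mult ennreal_mult)
    also have "\<dots> = L1norm a * L1norm b"
      by (simp add: nn_integral_cmult nn_integral_multc nn_integral_lborel_shift[of "\<lambda>x. ennreal (norm (a x))"])
    also have "\<dots> < \<infinity>" using a b by (simp add: integrable_iff_bounded ennreal_mult_less_top)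
    finally show "integrable (lborel \<Otimes>\<^sub>M lborel) (\<lambda>(y, x). wave (-\<xi>) x * (a (x - y) * b y))"
      unfolding integrable_iff_bounded by (simp add: split_beta)
  qed
  also have "\<dots> = (LINT y|lborel. fourier a \<xi> * (wave (-\<xi>) y * b y))"
  proof (rule Bochner_Integration.integral_cong[OF refl])
    fix y
    have "(LINT x|lborel. wave (-\<xi>) x * (a (x - y) * b y)) = (LINT x|lborel. wave (-\<xi>) (y + x) * (a x * b y))"
      using lborel_integral_shift[of "\<lambda>x. wave (-\<xi>) x * (a (x - y) * b y)" y] by simp
    also have "\<dots> = (LINT x|lborel. (wave (-\<xi>) y * b y) * (wave (-\<xi>) x * a x))"
      by (intro Bochner_Integration.integral_cong refl)
         (simp add: inner_add_right distrib_left exp_add mult_ac exp_diff exp_minus field_simps)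
    also have "\<dots> = (wave (-\<xi>) y * b y) * (LINT x|lborel. wave (-\<xi>) x * a x)"
      by (rule integral_mult_right_zero)
    finally show "(LINT x|lborel. wave (-\<xi>) x * (a (x - y) * b y)) = fourier a \<xi> * (wave (-\<xi>) y * b y)"
      by (simp add: fourier_lborel)
  qed
  also have "\<dots> = fourier a \<xi> * fourier b \<xi>" by (simp add: fourier_lborel)
  finally show ?thesis .
qed

section \<open>Fourier inversion up to a constant\<close>

lemma inverse_fourier_eq_fourier:
  fixes h :: "real^'d \<Rightarrow> complex"
  assumes [measurable]: "h \<in> borel_measurable borel"
  shows "inverse_fourier h v = fourier h (-v) / complex_of_real ((2 * pi) ^ CARD('d))"
  by (simp add: inverse_fourier_lborel fourier_lborel inner_commute)

lemma fourier_mult_formula: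
  fixes a b :: "real^'d \<Rightarrow> complex"
  assumes a: "integrable lborel a" and b: "integrable lborel b"
  shows "(LINT \<xi>|lborel. fourier a \<xi> * b \<xi>) = (LINT \<xi>|lborel. a \<xi> * fourier b \<xi>)"
proof -
  note [measurable] = borel_measurable_integrable[OF a, simplified] borel_measurable_integrable[OF b, simplified]
  have "(LINT \<xi>|lborel. fourier a \<xi> * b \<xi>) = (LINT \<xi>|lborel. LINT v|lborel. wave (-\<xi>) v * a v * b \<xi>)"
    by (simp add: fourier_lborel)
  also have "\<dots> = (LINT v|lborel. LINT \<xi>|lborel. wave (-\<xi>) v * a v * b \<xi>)"
    by (rule fubini_swap[OF a b]) (auto simp: norm_mult)
  also have "\<dots> = (LINT v|lborel. LINT \<xi>|lborel. a v * (wave (-v) \<xi> * b \<xi>))"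
    by (simp add: inner_commute mult_ac)
  also have "\<dots> = (LINT \<xi>|lborel. a \<xi> * fourier b \<xi>)"
    by (simp add: fourier_lborel)
  finally show ?thesis .
qed

text \<open>The factor \<open>q(\<epsilon> \<xi>)\<close>, which tends to \<open>q(0) = 1\<close>, is inserted in the inversion integral; the multiplication
  formula and a dilation turn the result into an average of \<open>\<theta>(x + \<epsilon> y)\<close> against the transform of \<open>q\<close>.
  Since \<open>q\<close> is an arbitrary test function in place of a Gaussian, no transform has to be computed, and the
  constant remains implicit.\<close>

lemma fourier_inversion_constant:
  fixes q \<theta> :: "real^'d \<Rightarrow> complex"
  assumes q: "test_function q" and q0: "q 0 = 1" and \<theta>: "test_function \<theta>"
  shows "inverse_fourier (fourier \<theta>) x =
    (LINT y|lborel. fourier q y) / complex_of_real ((2 * pi) ^ CARD('d)) * \<theta> x"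
proof -
  note [measurable] = test_function_measurable[OF q] test_function_measurable[OF \<theta>]
  obtain B where B: "\<And>x. norm (q x) \<le> B" using q by (metis test_function_bounded)
  obtain B' where B': "\<And>x. norm (\<theta> x) \<le> B'" using \<theta> by (metis test_function_bounded)
  define e where "e n = 1 / real (Suc n)" for n
  have e: "e n > 0" for n by (simp add: e_def)
  have e0: "e \<longlonglongrightarrow> 0" unfolding e_def using LIMSEQ_inverse_real_of_nat by (simp add: inverse_eq_divide)
  have "continuous_on UNIV q" "continuous_on UNIV \<theta>" using q \<theta> test_function_continuous by auto
  then have cont: "isCont q x" "isCont \<theta> x" for x by (auto simp: continuous_on_eq_continuous_at)
  define A where "A n = (LINT \<xi>|lborel. wave \<xi> x * fourier \<theta> \<xi> * q (e n *\<^sub>R \<xi>))" for n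
  have 1: "A \<longlonglongrightarrow> (LINT \<xi>|lborel. wave \<xi> x * fourier \<theta> \<xi> * 1)"
    unfolding A_def
  proof (rule integral_dominated_convergence[where w = "\<lambda>\<xi>. B * norm (fourier \<theta> \<xi>)"])
    show "integrable lborel (\<lambda>\<xi>. B * norm (fourier \<theta> \<xi>))"
      by (intro integrable_mult_right integrable_norm fourier_integrable \<theta>)
    show "AE \<xi> in lborel. (\<lambda>n. wave \<xi> x * fourier \<theta> \<xi> * q (e n *\<^sub>R \<xi>)) \<longlonglongrightarrow> wave \<xi> x * fourier \<theta> \<xi> * 1"
    proof (intro AE_I2 tendsto_mult tendsto_const)
      fix \<xi> :: "real^'d"
      have "(\<lambda>n. e n *\<^sub>R \<xi>) \<longlonglongrightarrow> 0" using tendsto_scaleR[OF e0 tendsto_const[of \<xi>]] by simp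
      from isCont_tendsto_compose[OF cont(1) this] show "(\<lambda>n. q (e n *\<^sub>R \<xi>)) \<longlonglongrightarrow> 1" by (simp add: q0)
    qed
    show "AE \<xi> in lborel. norm (wave \<xi> x * fourier \<theta> \<xi> * q (e n *\<^sub>R \<xi>)) \<le> B * norm (fourier \<theta> \<xi>)" for n
      using B by (auto intro!: AE_I2 simp: norm_mult mult.commute[of B] intro: mult_left_mono)
  qed measurable
  have A: "A n = (LINT y|lborel. \<theta> (x + e n *\<^sub>R y) * fourier q y)" for n
  proof -
    have "A n = (LINT \<xi>|lborel. fourier \<theta> \<xi> * (wave \<xi> x * q (e n *\<^sub>R \<xi>)))"
      unfolding A_def by (simp add: mult_ac)
    also have "\<dots> = (LINT v|lborel. \<theta> v * fourier (\<lambda>\<xi>. wave \<xi> x * q (e n *\<^sub>R \<xi>)) v)"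
      using e[of n] by (intro fourier_mult_formula integrable_wave_mult' test_function_integrable test_function_dilate \<theta> q) simp
    also have "\<dots> = \<bar>e n\<bar> ^ DIM(real^'d) *\<^sub>R (LINT y|lborel. \<theta> (x + e n *\<^sub>R y) * fourier (\<lambda>\<xi>. wave \<xi> x * q (e n *\<^sub>R \<xi>)) (x + e n *\<^sub>R y))"
      using e[of n] by (intro lborel_integral_affine) auto
    also have "\<dots> = (LINT y|lborel. \<theta> (x + e n *\<^sub>R y) * (\<bar>e n\<bar> ^ DIM(real^'d) *\<^sub>R fourier (\<lambda>\<xi>. wave \<xi> x * q (e n *\<^sub>R \<xi>)) (x + e n *\<^sub>R y)))"
      by (simp del: DIM_cart)
    also have "\<dots> = (LINT y|lborel. \<theta> (x + e n *\<^sub>R y) * fourier q y)"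
    proof (intro Bochner_Integration.integral_cong refl arg_cong2[of _ _ _ _ "(*)"])
      fix y
      have "fourier q y = (LINT \<xi>|lborel. wave (-y) \<xi> * q \<xi>)" by (simp add: fourier_lborel)
      also have "\<dots> = \<bar>e n\<bar> ^ DIM(real^'d) *\<^sub>R (LINT \<xi>|lborel. wave (-y) (0 + e n *\<^sub>R \<xi>) * q (0 + e n *\<^sub>R \<xi>))"
        using e[of n] by (intro lborel_integral_affine) auto
      also have "(LINT \<xi>|lborel. wave (-y) (0 + e n *\<^sub>R \<xi>) * q (0 + e n *\<^sub>R \<xi>))
          = fourier (\<lambda>\<xi>. wave \<xi> x * q (e n *\<^sub>R \<xi>)) (x + e n *\<^sub>R y)"
        by (simp add: fourier_lborel mult.assoc[symmetric] exp_add[symmetric])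
           (simp add: algebra_simps inner_commute)
      finally show "\<bar>e n\<bar> ^ DIM(real^'d) *\<^sub>R fourier (\<lambda>\<xi>. wave \<xi> x * q (e n *\<^sub>R \<xi>)) (x + e n *\<^sub>R y) = fourier q y"
        by simp
    qed
    finally show ?thesis .
  qed
  have 2: "A \<longlonglongrightarrow> (LINT y|lborel. \<theta> x * fourier q y)"
    unfolding A
  proof (rule integral_dominated_convergence[where w = "\<lambda>\<xi>. B' * norm (fourier q \<xi>)"])
    show "integrable lborel (\<lambda>\<xi>. B' * norm (fourier q \<xi>))"
      by (intro integrable_mult_right integrable_norm fourier_integrable q)
    show "AE y in lborel. (\<lambda>n. \<theta> (x + e n *\<^sub>R y) * fourier q y) \<longlonglongrightarrow> \<theta> x * fourier q y"
    proof (intro AE_I2 tendsto_mult tendsto_const)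
      fix y :: "real^'d"
      have "(\<lambda>n. x + e n *\<^sub>R y) \<longlonglongrightarrow> x" using tendsto_add[OF tendsto_const[of x] tendsto_scaleR[OF e0 tendsto_const[of y]]] by simp
      from isCont_tendsto_compose[OF cont(2) this] show "(\<lambda>n. \<theta> (x + e n *\<^sub>R y)) \<longlonglongrightarrow> \<theta> x" .
    qed
    show "AE y in lborel. norm (\<theta> (x + e n *\<^sub>R y) * fourier q y) \<le> B' * norm (fourier q y)" for n
      using B' by (auto intro!: AE_I2 simp: norm_mult intro: mult_right_mono)
  qed measurable
  have "(LINT \<xi>|lborel. wave \<xi> x * fourier \<theta> \<xi>) = \<theta> x * (LINT y|lborel. fourier q y)"
    using LIMSEQ_unique[OF 1 2] by simp
  then show ?thesis by (simp add: inverse_fourier_lborel)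
qed

lemma continuous_AE_zero:
  fixes f :: "'a::euclidean_space \<Rightarrow> complex"
  assumes f: "continuous_on UNIV f" and ae: "AE x in lborel. f x = 0"
  shows "f x = 0"
proof -
  have op: "open {x. f x \<noteq> 0}"
    using f by (intro open_Collect_neq) auto
  then have "{x. f x \<noteq> 0} \<in> null_sets lborel"
    using ae by (subst AE_iff_null_sets) auto
  then have "negligible {x. f x \<noteq> 0}"
    by (simp add: negligible_iff_null_sets null_sets_completionI)
  then show ?thesis using open_not_negligible[OF op] by blast
qed

text \<open>If the constant were zero, then the transform of the transform \<open>h\<close> of \<open>q\<close> would vanish, and the
  multiplication formula would give \<open>\<integral> h\<^sup>2 = 0\<close>.  As \<open>q\<close> is real and even, \<open>h\<close> is real, so \<open>h = 0\<close>; this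
  contradicts \<open>h(0) = \<integral> \<psi> > 0\<close>.\<close>

lemma inversion_constant_nonzero:
  fixes \<psi> :: "real^'d \<Rightarrow> real"
  defines "q \<equiv> \<lambda>x. complex_of_real (\<psi> x)"
  assumes q: "test_function q" and q0: "q 0 = 1" and even: "\<And>x. \<psi> (- x) = \<psi> x" and nonneg: "\<And>x. 0 \<le> \<psi> x"
  shows "(LINT y|lborel. fourier q y) \<noteq> 0"
proof
  assume 0: "(LINT y|lborel. fourier q y) = 0"
  note [measurable] = test_function_measurable[OF q]
  have cont: "continuous_on UNIV (fourier q)" by (intro continuous_fourier test_function_integrable q)
  have "fourier (fourier q) x = 0" for x
    using fourier_inversion_constant[OF q q0 q, of "-x"] 0 by (simp add: inverse_fourier_eq_fourier)
  then have *: "(LINT \<xi>|lborel. fourier q \<xi> * fourier q \<xi>) = 0"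
    by (subst fourier_mult_formula) (auto intro!: test_function_integrable fourier_integrable q)
  have real: "cnj (fourier q \<xi>) = fourier q \<xi>" for \<xi>
  proof -
    have "cnj (fourier q \<xi>) = (LINT v|lborel. cnj (wave (-\<xi>) v * q v))"
      by (simp only: fourier_lborel test_function_measurable[OF q] Bochner_Integration.integral_cnj)
    also have "\<dots> = (LINT v|lborel. wave (-\<xi>) (0 - v) * q (0 - v))"
      by (simp add: exp_cnj q_def even)
    also have "\<dots> = fourier q \<xi>"
      by (subst lborel_integral_reflect) (auto simp: fourier_lborel)
    finally show ?thesis .
  qed
  have sq: "fourier q \<xi> * fourier q \<xi> = complex_of_real ((norm (fourier q \<xi>))\<^sup>2)" for \<xi>
    by (metis real complex_norm_square)
  have "(LINT \<xi>|lborel. (norm (fourier q \<xi>))\<^sup>2) = 0"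
    using * unfolding sq by (simp del: of_real_power)
  moreover have "integrable lborel (\<lambda>\<xi>. (norm (fourier q \<xi>))\<^sup>2)"
  proof (rule Bochner_Integration.integrable_bound)
    show "integrable lborel (\<lambda>\<xi>. (LINT v|lborel. norm (q v)) *\<^sub>R fourier q \<xi>)"
      by (intro integrable_scaleR_right fourier_integrable q)
    show "AE \<xi> in lborel. norm ((norm (fourier q \<xi>))\<^sup>2) \<le> norm ((LINT v|lborel. norm (q v)) *\<^sub>R fourier q \<xi>)"
      using norm_fourier_le[OF test_function_integrable[OF q]]
      by (intro AE_I2) (simp add: power2_eq_square mult_right_mono)
  qed measurable
  ultimately have "AE \<xi> in lborel. (norm (fourier q \<xi>))\<^sup>2 = 0"
    by (subst (asm) integral_nonneg_eq_0_iff_AE) auto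
  then have ae: "AE \<xi> in lborel. fourier q \<xi> = 0" by simp
  have "fourier q 0 = 0" by (rule continuous_AE_zero[OF cont ae])
  then have "(LINT v|lborel. complex_of_real (\<psi> v)) = 0"
    using fourier_lborel[OF test_function_measurable[OF q], of 0] by (simp add: q_def)
  then have "(LINT v|lborel. \<psi> v) = 0" by simp
  moreover have int: "integrable lborel \<psi>"
    using test_function_integrable[OF q] unfolding q_def by (simp add: complex_of_real_integrable_eq)
  ultimately have "AE v in lborel. \<psi> v = 0"
    using nonneg by (subst (asm) integral_nonneg_eq_0_iff_AE) auto
  then have ae: "AE v in lborel. q v = 0" by (simp add: q_def)
  have "q 0 = 0" by (rule continuous_AE_zero[OF test_function_continuous[OF q] ae])
  with q0 show False by simp
qed

section \<open>Dilated kernels and almost orthogonality\<close>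

text \<open>The dilation that preserves the \<open>L\<^sup>1\<close> norm; it concentrates \<open>K\<close> at the scale \<open>1 / r\<close>.\<close>

definition dil :: "real \<Rightarrow> ('a::euclidean_space \<Rightarrow> complex) \<Rightarrow> 'a \<Rightarrow> complex" where
  "dil r K x = complex_of_real (r ^ DIM('a)) * K (r *\<^sub>R x)"

text \<open>A first moment and a Lipschitz modulus of continuity in \<open>L\<^sup>1\<close>: the only two properties of the kernels
  that enter the almost orthogonality estimate.\<close>

definition regular_kernel :: "real \<Rightarrow> ('a::euclidean_space \<Rightarrow> complex) \<Rightarrow> bool" where
  "regular_kernel C B \<longleftrightarrow> 0 \<le> C \<and> integrable lborel B \<and>
     (\<forall>y. (\<integral>\<^sup>+x. norm (B (x - y) - B x) \<partial>lborel) \<le> ennreal (C * norm y)) \<and>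
     (\<integral>\<^sup>+x. norm x * norm (B x) \<partial>lborel) \<le> ennreal C"

lemma dil_measurable [measurable]:
  fixes K :: "'a::euclidean_space \<Rightarrow> complex"
  assumes [measurable]: "K \<in> borel_measurable borel"
  shows "dil r K \<in> borel_measurable borel"
  unfolding dil_def[abs_def] by measurable

lemma dil_integrable: "integrable lborel K \<Longrightarrow> r \<noteq> 0 \<Longrightarrow> integrable lborel (dil r K)"
  unfolding dil_def[abs_def] using lborel_integrable_affine[of K r 0] by (intro integrable_mult_right) simp

lemma dil_integral:
  fixes K :: "'a::euclidean_space \<Rightarrow> complex"
  assumes "K \<in> borel_measurable borel" "r > 0"
  shows "(LINT x|lborel. dil r K x) = (LINT x|lborel. K x)"
  using lborel_integral_affine[of K r 0] assms by (simp add: dil_def scaleR_conv_of_real)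

lemma dil_dil: "dil r (dil s K) = dil (r * s) K"
  by (simp add: dil_def fun_eq_iff power_mult_distrib mult_ac)

lemma dil_diff: "dil r (\<lambda>x. A x - B x) = (\<lambda>x. dil r A x - dil r B x)"
  by (simp add: dil_def fun_eq_iff algebra_simps)

lemma test_function_dil: "test_function K \<Longrightarrow> r \<noteq> 0 \<Longrightarrow> test_function (dil r K)"
  unfolding dil_def[abs_def]
  by (intro test_function_linear_outer[OF test_function_dilate] bounded_linear_mult_right)

lemma fourier_dil:
  fixes K :: "real^'d \<Rightarrow> complex"
  assumes [measurable]: "K \<in> borel_measurable borel" and r: "r > 0"
  shows "fourier (dil r K) \<xi> = fourier K ((1 / r) *\<^sub>R \<xi>)"
proof -
  have "fourier K ((1 / r) *\<^sub>R \<xi>) = (LINT v|lborel. wave (- (1 / r) *\<^sub>R \<xi>) v * K v)"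
    by (simp add: fourier_lborel)
  also have "\<dots> = \<bar>r\<bar> ^ DIM(real^'d) *\<^sub>R (LINT v|lborel. wave (- (1 / r) *\<^sub>R \<xi>) (0 + r *\<^sub>R v) * K (0 + r *\<^sub>R v))"
    using r by (intro lborel_integral_affine) auto
  also have "\<dots> = (LINT v|lborel. complex_of_real (r ^ DIM(real^'d)) * (wave (- \<xi>) v * K (r *\<^sub>R v)))"
    using r by (simp del: DIM_cart add: scaleR_conv_of_real[where 'a=complex])
  also have "\<dots> = fourier (dil r K) \<xi>"
    by (simp add: fourier_lborel dil_def mult_ac)
  finally show ?thesis by simp
qed

lemma regular_kernel_mono: "regular_kernel C B \<Longrightarrow> C \<le> C' \<Longrightarrow> regular_kernel C' B"
  unfolding regular_kernel_def
  by (meson ennreal_leI mult_right_mono norm_ge_zero order_trans)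

lemma nn_integral_dil_moment:
  fixes A :: "'a::euclidean_space \<Rightarrow> complex"
  assumes A: "regular_kernel C A" and s: "s > 0"
  shows "(\<integral>\<^sup>+x. norm x * norm (dil s A x) \<partial>lborel) \<le> ennreal (C / s)"
proof -
  have C: "C \<ge> 0" and iA: "integrable lborel A" using A by (auto simp: regular_kernel_def)
  note [measurable] = borel_measurable_integrable[OF iA, simplified]
  have "(\<integral>\<^sup>+x. norm x * norm (A x) \<partial>lborel) = ennreal s * (\<integral>\<^sup>+x. norm x * norm (dil s A x) \<partial>lborel)"
  proof -
    have "(\<integral>\<^sup>+x. norm x * norm (A x) \<partial>lborel)
        = ennreal (\<bar>s\<bar> ^ DIM('a)) * (\<integral>\<^sup>+x. norm (0 + s *\<^sub>R x) * norm (A (0 + s *\<^sub>R x)) \<partial>lborel)"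
      using s by (intro nn_integral_lborel_affine) auto
    also have "\<dots> = (\<integral>\<^sup>+x. ennreal s * (norm x * norm (dil s A x)) \<partial>lborel)"
      using s by (subst nn_integral_cmult[symmetric])
        (auto simp: dil_def norm_mult norm_power ennreal_mult[symmetric] mult_ac intro!: nn_integral_cong)
    finally show ?thesis by (simp add: nn_integral_cmult)
  qed
  then have "ennreal s * (\<integral>\<^sup>+x. norm x * norm (dil s A x) \<partial>lborel) \<le> ennreal s * ennreal (C / s)"
    using A s C by (simp add: regular_kernel_def flip: ennreal_mult)
  then show ?thesis using s by (simp add: ennreal_mult_le_mult_iff)
qed

text \<open>As \<open>A\<close> has mean zero, \<open>B(x - y)\<close> may be replaced by \<open>B(x - y) - B(x)\<close> in the convolution.  The kernel at
  scale \<open>1 / s\<close> lives at distances \<open>y\<close> of order \<open>1 / s\<close>, over which the kernel at scale \<open>1 / r\<close> changes in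
  \<open>L\<^sup>1\<close> by a quantity of order \<open>r / s\<close>.\<close>

lemma conv_dil_almost_orthogonal:
  fixes A B :: "'a::euclidean_space \<Rightarrow> complex"
  assumes A: "regular_kernel C A" and B: "regular_kernel C B" and A0: "(LINT x|lborel. A x) = 0"
    and r: "r > 0" and s: "s > 0"
  shows "L1norm (conv (dil r B) (dil s A)) \<le> ennreal (C\<^sup>2 * (r / s))"
proof -
  have C: "C \<ge> 0" using A by (simp add: regular_kernel_def)
  have iA: "integrable lborel A" and iB: "integrable lborel B" using A B by (auto simp: regular_kernel_def)
  note [measurable] = borel_measurable_integrable[OF iA, simplified] borel_measurable_integrable[OF iB, simplified]
  have lip: "(\<integral>\<^sup>+x. norm (dil r B (x - y) - dil r B x) \<partial>lborel) \<le> ennreal (C * r * norm y)" for y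
  proof -
    have "(\<integral>\<^sup>+x. norm (B (x - r *\<^sub>R y) - B x) \<partial>lborel) = (\<integral>\<^sup>+x. norm (dil r B (x - y) - dil r B x) \<partial>lborel)"
      using r
      by (subst nn_integral_lborel_affine[of _ r 0])
         (simp_all add: dil_def norm_mult norm_power ennreal_mult nn_integral_cmult scaleR_right_diff_distrib
            flip: right_diff_distrib)
    moreover have "(\<integral>\<^sup>+x. norm (B (x - r *\<^sub>R y) - B x) \<partial>lborel) \<le> ennreal (C * norm (r *\<^sub>R y))"
      using B unfolding regular_kernel_def by blast
    ultimately show ?thesis using r by (simp add: mult_ac)
  qed
  note mom = nn_integral_dil_moment[OF A s]
  have int: "integrable lborel (dil s A)" using s iA by (simp add: dil_integrable)
  have zero: "(LINT x|lborel. dil s A x) = 0" using A0 s by (simp add: dil_integral)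
  have "ennreal (norm (conv (dil r B) (dil s A) x))
      \<le> (\<integral>\<^sup>+y. norm ((dil r B (x - y) - dil r B x) * dil s A y) \<partial>lborel)" for x
  proof (cases "integrable lborel (\<lambda>y. dil r B (x - y) * dil s A y)")
    case True
    have "conv (dil r B) (dil s A) x
        = (LINT y|lborel. dil r B (x - y) * dil s A y) - (LINT y|lborel. dil r B x * dil s A y)"
      unfolding conv_def using zero by simp
    also have "\<dots> = (LINT y|lborel. dil r B (x - y) * dil s A y - dil r B x * dil s A y)"
      using True int by (intro Bochner_Integration.integral_diff[symmetric]) auto
    also have "\<dots> = (LINT y|lborel. (dil r B (x - y) - dil r B x) * dil s A y)"
      by (simp add: algebra_simps)
    finally show ?thesis by (simp only: norm_integral_le_nn_integral)
  next
    case False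
    then show ?thesis by (simp add: conv_def not_integrable_integral_eq)
  qed
  then have "L1norm (conv (dil r B) (dil s A))
      \<le> (\<integral>\<^sup>+x. \<integral>\<^sup>+y. norm ((dil r B (x - y) - dil r B x) * dil s A y) \<partial>lborel \<partial>lborel)"
    by (intro nn_integral_mono)
  also have "\<dots> = (\<integral>\<^sup>+y. \<integral>\<^sup>+x. norm ((dil r B (x - y) - dil r B x) * dil s A y) \<partial>lborel \<partial>lborel)"
    by (rule lborel_pair.Fubini') measurable
  also have "\<dots> = (\<integral>\<^sup>+y. (\<integral>\<^sup>+x. norm (dil r B (x - y) - dil r B x) \<partial>lborel) * norm (dil s A y) \<partial>lborel)"
    by (simp add: norm_mult ennreal_mult nn_integral_multc)
  also have "\<dots> \<le> (\<integral>\<^sup>+y. ennreal (C * r * norm y) * norm (dil s A y) \<partial>lborel)"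
    by (intro nn_integral_mono mult_right_mono lip) simp
  also have "\<dots> = (\<integral>\<^sup>+y. ennreal (C * r) * (norm y * norm (dil s A y)) \<partial>lborel)"
    using C r by (intro nn_integral_cong) (simp add: ennreal_mult[symmetric] mult_ac)
  also have "\<dots> = ennreal (C * r) * (\<integral>\<^sup>+y. norm y * norm (dil s A y) \<partial>lborel)"
    by (intro nn_integral_cmult) measurable
  also have "\<dots> \<le> ennreal (C * r) * ennreal (C / s)"
    by (intro mult_left_mono mom) simp
  also have "\<dots> = ennreal (C\<^sup>2 * (r / s))"
    using C r s by (simp add: ennreal_mult[symmetric] power2_eq_square)
  finally show ?thesis .
qed

text \<open>Only small translations need a proof: for \<open>\<bar>y\<bar> > 1\<close> the triangle inequality gives a bound that is
  linear in \<open>y\<close>.\<close>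

lemma regular_kernelI:
  fixes B :: "'a::euclidean_space \<Rightarrow> complex"
  assumes B: "integrable lborel B" and M: "integrable lborel (\<lambda>x. norm x * norm (B x))"
    and L: "\<And>y. norm y \<le> 1 \<Longrightarrow> (\<integral>\<^sup>+x. norm (B (x - y) - B x) \<partial>lborel) \<le> ennreal (L * norm y)"
  shows "\<exists>C. regular_kernel C B"
proof -
  note [measurable] = borel_measurable_integrable[OF B, simplified]
  let ?I = "LINT x|lborel. norm (B x)" and ?M = "LINT x|lborel. norm x * norm (B x)"
  define C where "C = \<bar>L\<bar> + 2 * ?I + ?M"
  have I: "?I \<ge> 0" "?M \<ge> 0" by (simp_all)
  have "(\<integral>\<^sup>+x. norm (B (x - y) - B x) \<partial>lborel) \<le> ennreal (C * norm y)" for y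
  proof (cases "norm y \<le> 1")
    case True
    have "L \<le> C" using I abs_ge_self[of L] unfolding C_def by linarith
    then have "L * norm y \<le> C * norm y" by (intro mult_right_mono) auto
    then show ?thesis using L[OF True] by (meson ennreal_leI order_trans)
  next
    case False
    have "(\<integral>\<^sup>+x. norm (B (x - y) - B x) \<partial>lborel) \<le> (\<integral>\<^sup>+x. ennreal (norm (B (x - y))) + ennreal (norm (B x)) \<partial>lborel)"
      by (intro nn_integral_mono) (simp add: norm_triangle_ineq4 flip: ennreal_plus)
    also have "\<dots> = (\<integral>\<^sup>+x. ennreal (norm (B (x - y))) \<partial>lborel) + L1norm B"
      by (rule nn_integral_add) measurable
    also have "\<dots> = ennreal (2 * ?I)"
      using nn_integral_lborel_shift[of "\<lambda>x. ennreal (norm (B x))" y] nn_integral_eq_integral[OF integrable_norm[OF B]] I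
      by (simp flip: ennreal_plus)
    also have "2 * ?I \<le> C * norm y"
      using False I mult_mono[of "2 * ?I" C 1 "norm y"] by (simp add: C_def)
    finally show ?thesis by (simp add: ennreal_leI)
  qed
  moreover have "(\<integral>\<^sup>+x. norm x * norm (B x) \<partial>lborel) \<le> ennreal C"
    using nn_integral_eq_integral[OF M] I by (auto simp: C_def intro: ennreal_leI)
  moreover have "C \<ge> 0" using I by (simp add: C_def)
  ultimately show ?thesis using B unfolding regular_kernel_def by blast
qed

lemma test_function_derivative_bound:
  assumes "test_function f"
  obtains B where "B \<ge> 0" "\<And>x y. norm (frechet_derivative f (at x) y) \<le> B * norm y"
proof -
  have "\<forall>b\<in>Basis. \<exists>B. \<forall>x. norm (frechet_derivative f (at x) b) \<le> B"
    using test_function_bounded[OF test_function_deriv[OF assms]] by metis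
  then obtain B where B: "\<And>b x. b \<in> Basis \<Longrightarrow> norm (frechet_derivative f (at x) b) \<le> B b" by metis
  have "norm (frechet_derivative f (at x) y) \<le> (\<Sum>b\<in>Basis. B b) * norm y" for x y
  proof -
    have "norm (frechet_derivative f (at x) y) = norm (\<Sum>b\<in>Basis. (y \<bullet> b) *\<^sub>R frechet_derivative f (at x) b)"
      using test_function_has_derivative[OF assms] by (subst frechet_derivative_Basis_expand) (auto simp: differentiable_def)
    also have "\<dots> \<le> (\<Sum>b\<in>Basis. norm y * B b)"
      by (intro sum_norm_le) (auto intro!: mult_mono Basis_le_norm B)
    also have "\<dots> = (\<Sum>b\<in>Basis. B b) * norm y"
      unfolding sum_distrib_right by (intro sum.cong refl mult.commute)
    finally show ?thesis .
  qed
  moreover have "0 \<le> (\<Sum>b\<in>Basis. B b)" using B by (intro sum_nonneg) (meson norm_ge_zero order_trans)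
  ultimately show ?thesis using that by blast
qed

lemma test_function_lipschitz:
  assumes f: "test_function f"
  obtains B where "B \<ge> 0" "\<And>x y. norm (f (x - y) - f x) \<le> B * norm y"
proof -
  obtain B where B: "B \<ge> 0" "\<And>x y. norm (frechet_derivative f (at x) y) \<le> B * norm y"
    using test_function_derivative_bound[OF f] by blast
  have "norm (f (x - y) - f x) \<le> B * norm y" for x y
    using norm_increment_le[OF test_function_has_derivative[OF f], of "-y" "B * norm y" x 1] B(2)[of _ "-y"] by simp
  with B(1) show ?thesis using that by blast
qed

lemma regular_kernel_test_function:
  fixes f :: "'a::euclidean_space \<Rightarrow> complex"
  assumes f: "test_function f" shows "\<exists>C. regular_kernel C f"
proof -
  obtain B where B: "B \<ge> 0" "\<And>x y. norm (f (x - y) - f x) \<le> B * norm y"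
    using test_function_lipschitz[OF f] by blast
  obtain R where R: "R > 0" "\<And>x. R < norm x \<Longrightarrow> f x = 0"
    using f by (metis test_function_support)
  note [measurable] = test_function_measurable[OF f]
  let ?V = "measure lborel (cball (0::'a) (R + 1))"
  show ?thesis
  proof (rule regular_kernelI)
    show "integrable lborel f" by (rule test_function_integrable[OF f])
    show "integrable lborel (\<lambda>x. norm x * norm (f x))"
    proof (rule Bochner_Integration.integrable_bound)
      show "integrable lborel (\<lambda>x. R * norm (f x))"
        by (intro integrable_mult_right integrable_norm test_function_integrable f)
      show "AE x in lborel. norm (norm x * norm (f x)) \<le> norm (R * norm (f x))"
      proof (rule AE_I2)
        fix x show "norm (norm x * norm (f x)) \<le> norm (R * norm (f x))"
          using R by (cases "norm x \<le> R") (auto simp: abs_mult intro: mult_right_mono)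
      qed
    qed measurable
    fix y :: 'a assume y: "norm y \<le> 1"
    have "(\<integral>\<^sup>+x. norm (f (x - y) - f x) \<partial>lborel) \<le> (\<integral>\<^sup>+(x::'a). ennreal (B * norm y) * indicator (cball 0 (R + 1)) x \<partial>lborel)"
    proof (rule nn_integral_mono)
      fix x :: 'a
      show "ennreal (norm (f (x - y) - f x)) \<le> ennreal (B * norm y) * indicator (cball 0 (R + 1)) x"
      proof (cases "norm x \<le> R + 1")
        case False
        then have "R < norm x" "R < norm (x - y)" using y norm_triangle_ineq2[of x y] by auto
        then show ?thesis using R by simp
      qed (use B in \<open>auto intro: ennreal_leI\<close>)
    qed
    also have "\<dots> = ennreal (B * norm y) * ennreal ?V"
      using emeasure_lborel_cball_finite[of "0::'a" "R + 1"]
      by (simp add: nn_integral_cmult_indicator emeasure_eq_ennreal_measure less_top)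
    also have "\<dots> = ennreal ((B * ?V) * norm y)"
      using B by (simp add: ennreal_mult[symmetric] mult_ac)
    finally show "(\<integral>\<^sup>+x. norm (f (x - y) - f x) \<partial>lborel) \<le> ennreal ((B * ?V) * norm y)" .
  qed
qed

lemma inverse_fourier_reflect:
  fixes \<theta> :: "real^'d \<Rightarrow> complex"
  assumes "test_function \<theta>"
  shows "inverse_fourier \<theta> x = fourier \<theta> (-x) / complex_of_real ((2 * pi) ^ CARD('d))"
  using test_function_measurable[OF assms] by (rule inverse_fourier_eq_fourier)

lemma integrable_inverse_fourier:
  fixes \<theta> :: "real^'d \<Rightarrow> complex"
  assumes \<theta>: "test_function \<theta>"
  shows "integrable lborel (inverse_fourier \<theta>)"
  unfolding inverse_fourier_reflect[OF \<theta>, abs_def]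
  using lborel_integrable_reflect[OF fourier_integrable[OF \<theta>], of 0]
  by (intro Bochner_Integration.integrable_divide_zero) simp

lemma regular_kernel_inverse_fourier:
  fixes \<theta> :: "real^'d \<Rightarrow> complex"
  assumes \<theta>: "test_function \<theta>" shows "\<exists>C. regular_kernel C (inverse_fourier \<theta>)"
proof -
  let ?D = "2 * DIM(real^'d)" and ?w = "\<lambda>x::real^'d. 1 / (1 + norm x) ^ (2 * DIM(real^'d))"
  let ?c = "(2 * pi) ^ CARD('d)"
  have c1: "?c \<ge> 1" using pi_ge_two by (intro one_le_power) simp
  note [measurable] = test_function_measurable[OF \<theta>]
  obtain C where C: "\<And>\<xi> y. norm y \<le> 1 \<Longrightarrow> (1 + norm \<xi>) ^ ?D * norm (fourier \<theta> (\<xi> - y) - fourier \<theta> \<xi>) \<le> C * norm y"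
    using fourier_increment_decay[OF \<theta>] by blast
  obtain E where E: "\<And>\<xi>. (1 + norm \<xi>) ^ Suc ?D * norm (fourier \<theta> \<xi>) \<le> E"
    using fourier_decay[OF \<theta>] by blast
  have pos: "(1 + norm (\<xi>::real^'d)) ^ ?D > 0" for \<xi> by (simp add: add_pos_nonneg)
  have le: "norm (z / complex_of_real ?c) \<le> norm z" for z
  proof -
    have "norm (complex_of_real ?c) = ?c" by (simp only: norm_of_real) simp
    then have "norm (z / complex_of_real ?c) = norm z / ?c" by (simp only: norm_divide)
    also have "\<dots> \<le> norm z / 1" using c1 by (intro divide_left_mono) auto
    finally show ?thesis by simp
  qed
  have meas: "inverse_fourier \<theta> \<in> borel_measurable borel" by measurable
  show ?thesis
  proof (rule regular_kernelI)
    show "integrable lborel (inverse_fourier \<theta>)" by (rule integrable_inverse_fourier[OF \<theta>])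
    show "integrable lborel (\<lambda>x. norm x * norm (inverse_fourier \<theta> x))"
    proof (rule integrable_decay)
      fix x :: "real^'d"
      have "(1 + norm x) ^ ?D * norm (norm x * norm (inverse_fourier \<theta> x))
          \<le> (1 + norm x) ^ ?D * ((1 + norm x) * norm (fourier \<theta> (-x)))"
        unfolding norm_mult real_norm_def abs_mult abs_norm_cancel inverse_fourier_reflect[OF \<theta>]
        by (intro mult_left_mono mult_mono le) auto
      also have "\<dots> \<le> E" using E[of "-x"] by (simp add: mult_ac)
      finally show "(1 + norm x) ^ ?D * norm (norm x * norm (inverse_fourier \<theta> x)) \<le> E" .
    qed measurable
    fix y :: "real^'d" assume y: "norm y \<le> 1"
    have "(\<integral>\<^sup>+x. norm (inverse_fourier \<theta> (x - y) - inverse_fourier \<theta> x) \<partial>lborel)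
        \<le> (\<integral>\<^sup>+x. ennreal (\<bar>C\<bar> * norm y) * ennreal (?w x) \<partial>lborel)"
    proof (rule nn_integral_mono)
      fix x
      have "norm (inverse_fourier \<theta> (x - y) - inverse_fourier \<theta> x) \<le> norm (fourier \<theta> (-x - (-y)) - fourier \<theta> (-x))"
        using le[of "fourier \<theta> (-x - (-y)) - fourier \<theta> (-x)"]
        by (simp add: inverse_fourier_reflect[OF \<theta>] diff_divide_distrib)
      also have "\<dots> \<le> (\<bar>C\<bar> * norm y) * ?w x"
      proof -
        have "(1 + norm x) ^ ?D * norm (fourier \<theta> (-x - (-y)) - fourier \<theta> (-x)) \<le> C * norm y"
          using C[of "-y" "-x"] y by simp
        also have "\<dots> \<le> \<bar>C\<bar> * norm y" by (intro mult_right_mono) auto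
        finally show ?thesis using pos[of x] by (simp add: field_simps)
      qed
      finally show "ennreal (norm (inverse_fourier \<theta> (x - y) - inverse_fourier \<theta> x)) \<le> ennreal (\<bar>C\<bar> * norm y) * ennreal (?w x)"
        by (simp flip: ennreal_mult del: times_divide_eq_right add: ennreal_leI)
    qed
    also have "\<dots> = ennreal (\<bar>C\<bar> * norm y) * ennreal (LINT x|lborel. ?w x)"
      by (subst nn_integral_cmult) (auto simp: nn_integral_eq_integral integrable_weight)
    also have "\<dots> = ennreal ((\<bar>C\<bar> * (LINT x|lborel. ?w x)) * norm y)"
      by (subst ennreal_mult[symmetric]) (auto simp: mult_ac intro!: integral_nonneg_AE AE_I2)
    finally show "(\<integral>\<^sup>+x. norm (inverse_fourier \<theta> (x - y) - inverse_fourier \<theta> x) \<partial>lborel)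
        \<le> ennreal ((\<bar>C\<bar> * (LINT x|lborel. ?w x)) * norm y)" .
  qed
qed

section \<open>The Besov norm controls the oscillation norm\<close>

text \<open>That \<open>\<psi> = 1\<close> near the origin follows from the resolution of the identity: none of the dilated annuli
  meets the ball of radius \<open>1/2\<close>.\<close>

lemma littlewood_paley_facts:
  fixes \<psi> \<phi> :: "real^'d \<Rightarrow> real"
  assumes "littlewood_paley \<psi> \<phi>"
  shows "test_function (\<lambda>x. complex_of_real (\<psi> x))" "test_function (\<lambda>x. complex_of_real (\<phi> x))"
    and "0 \<le> \<psi> x" "0 \<le> \<phi> x" "\<psi> (- x) = \<psi> x"
    and "norm x < 1 / 2 \<Longrightarrow> \<psi> x = 1" "1 < norm x \<Longrightarrow> \<psi> x = 0"
    and "\<phi> x \<noteq> 0 \<Longrightarrow> 1 / 2 \<le> norm x \<and> norm x \<le> 2"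
    and "(\<lambda>k. \<phi> ((1 / 2) ^ k *\<^sub>R x)) sums (1 - \<psi> x)"
proof -
  note lp = assms[unfolded littlewood_paley_def]
  from lp have sup: "topological_support \<psi> \<subseteq> {\<xi>. norm \<xi> \<le> 1}"
      "topological_support \<phi> \<subseteq> {\<xi>. 1 / 2 \<le> norm \<xi> \<and> norm \<xi> \<le> 2}"
    by - (elim conjE, assumption)+
  show "test_function (\<lambda>x. complex_of_real (\<psi> x))" "test_function (\<lambda>x. complex_of_real (\<phi> x))"
    by (intro test_function_linear_outer[OF _ bounded_linear_of_real]; use lp in blast)+
  show "0 \<le> \<psi> x" "0 \<le> \<phi> x" using lp by blast+
  from lp have "\<forall>\<xi> \<eta>. norm \<xi> = norm \<eta> \<longrightarrow> \<psi> \<xi> = \<psi> \<eta>" by (elim conjE)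
  from this[rule_format, of "- x" x] show "\<psi> (- x) = \<psi> x" by simp
  show sm: "(\<lambda>k. \<phi> ((1 / 2) ^ k *\<^sub>R x)) sums (1 - \<psi> x)" using lp by blast
  have \<phi>0: "1 / 2 \<le> norm x \<and> norm x \<le> 2" if "\<phi> x \<noteq> 0" for x
  proof -
    have "x \<in> topological_support \<phi>"
      unfolding topological_support_def by (rule subsetD[OF closure_subset]) (simp add: that)
    with sup(2) have "x \<in> {\<xi>. 1 / 2 \<le> norm \<xi> \<and> norm \<xi> \<le> 2}" by (rule subsetD)
    then show ?thesis by simp
  qed
  then show "\<phi> x \<noteq> 0 \<Longrightarrow> 1 / 2 \<le> norm x \<and> norm x \<le> 2" .
  show "\<psi> x = 0" if "1 < norm x"
  proof (rule ccontr)
    assume "\<psi> x \<noteq> 0"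
    then have "x \<in> topological_support \<psi>"
      unfolding topological_support_def by (intro subsetD[OF closure_subset]) simp
    with sup(1) have "x \<in> {\<xi>. norm \<xi> \<le> 1}" by (rule subsetD)
    then show False using that by simp
  qed
  show "\<psi> x = 1" if "norm x < 1 / 2"
  proof -
    have "\<phi> ((1 / 2) ^ k *\<^sub>R x) = 0" for k
    proof (rule ccontr)
      assume "\<phi> ((1 / 2) ^ k *\<^sub>R x) \<noteq> 0"
      then have "1 / 2 \<le> (1 / 2) ^ k * norm x" using \<phi>0[of "(1 / 2) ^ k *\<^sub>R x"] by simp
      also have "\<dots> \<le> 1 * norm x" by (intro mult_right_mono power_le_one) auto
      finally show False using that by simp
    qed
    then have "(\<lambda>k::nat. 0) sums (1 - \<psi> x)" using sm by simp
    then show ?thesis using sums_unique2[OF sums_zero] by fastforce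
  qed
qed

lemma ennreal_norm_sums_le:
  fixes f :: "nat \<Rightarrow> 'a::real_normed_vector"
  assumes "f sums l"
  shows "ennreal (norm l) \<le> (\<Sum>k. ennreal (norm (f k)))"
proof (rule LIMSEQ_le_const2)
  show "(\<lambda>n. ennreal (norm (\<Sum>k<n. f k))) \<longlonglongrightarrow> ennreal (norm l)"
    using assms unfolding sums_def by (intro tendsto_ennrealI tendsto_norm)
  have "ennreal (norm (\<Sum>k<n. f k)) \<le> (\<Sum>k. ennreal (norm (f k)))" for n
  proof -
    have "ennreal (norm (\<Sum>k<n. f k)) \<le> ennreal (\<Sum>k<n. norm (f k))"
      by (intro ennreal_leI norm_sum)
    also have "\<dots> = (\<Sum>k<n. ennreal (norm (f k)))" by (simp add: sum_ennreal)
    also have "\<dots> \<le> (\<Sum>k. ennreal (norm (f k)))" by (intro sum_le_suminf) auto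
    finally show ?thesis .
  qed
  then show "\<exists>N. \<forall>n\<ge>N. ennreal (norm (\<Sum>k<n. f k)) \<le> (\<Sum>k. ennreal (norm (f k)))" by blast
qed

lemma ennreal_suminf_swap:
  fixes f :: "nat \<Rightarrow> nat \<Rightarrow> ennreal"
  shows "(\<Sum>m. \<Sum>k. f m k) = (\<Sum>k. \<Sum>m. f m k)"
  using nn_integral_suminf[of "\<lambda>k m. f m k" "count_space UNIV"]
  by (simp add: nn_integral_count_space_nat)

lemma half_power_sum: "(\<Sum>m<k. (1 / 2 :: real) ^ (k - m)) = 1 - (1 / 2) ^ k"
proof (induction k)
  case (Suc k)
  have "(\<Sum>m<k. (1 / 2 :: real) ^ (Suc k - m)) = (\<Sum>m<k. (1 / 2) * (1 / 2) ^ (k - m))"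
    by (intro sum.cong refl) (simp add: Suc_diff_le)
  also have "\<dots> = (1 / 2) * (1 - (1 / 2) ^ k)" by (simp only: sum_distrib_left[symmetric] Suc)
  finally show ?case by simp
qed simp

lemma suminf_half_dist: "(\<Sum>m. ennreal ((1 / 2) ^ (if m < k then k - m else m - k))) \<le> 3"
proof -
  let ?f = "\<lambda>m. ennreal ((1 / 2) ^ (if m < k then k - m else m - k))"
  have "(\<Sum>m. ?f m) = (\<Sum>m. ?f (m + k)) + (\<Sum>m<k. ?f m)"
    by (rule suminf_offset) simp
  also have "(\<Sum>m. ?f (m + k)) = ennreal 2"
    by (subst suminf_ennreal2) (use geometric_sums[of "1 / 2 :: real"] in \<open>auto simp: sums_iff\<close>)
  also have "(\<Sum>m<k. ?f m) = ennreal (\<Sum>m<k. (1 / 2) ^ (k - m))"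
    by (subst sum_ennreal[symmetric]) auto
  finally have "(\<Sum>m. ?f m) = ennreal 2 + ennreal (1 - (1 / 2) ^ k)" by (simp only: half_power_sum)
  also have "\<dots> = ennreal (2 + (1 - (1 / 2) ^ k))"
    by (rule ennreal_plus[symmetric]) (simp_all add: power_le_one)
  also have "\<dots> \<le> ennreal 3" by (intro ennreal_leI) simp
  finally show ?thesis by simp
qed

text \<open>A Besov norm of type \<open>B\<^sup>0\<^sub>1\<^sub>,\<^sub>1\<close> in which the dyadic blocks are the differences of consecutive dilations of
  a bump \<open>G\<close> in physical space.\<close>

definition osc_norm :: "('a::euclidean_space \<Rightarrow> complex) \<Rightarrow> ('a \<Rightarrow> complex) \<Rightarrow> ennreal" where
  "osc_norm G u = L1norm (conv G u)
     + (\<Sum>m. \<integral>\<^sup>+x. norm (conv (dil (2 ^ m) (\<lambda>x. dil 2 G x - G x)) u x) \<partial>lborel)"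

text \<open>Let \<open>d\<^sub>k\<close> be the dyadic blocks of \<open>u\<close>.  Each one is reproduced by a kernel \<open>T\<^sub>k\<close> of scale \<open>2\<^sup>-\<^sup>k\<close>, namely
  the inverse transform of a function that equals \<open>1\<close> on the support of the symbol of the block.  Hence
  \<open>N\<^sub>m * u\<close> is a sum over \<open>k\<close> of \<open>(N\<^sub>m * T\<^sub>k) * d\<^sub>k\<close>, up to constants, and the norms of \<open>N\<^sub>m * T\<^sub>k\<close> are
  bounded by \<open>2\<^bsup>-\<bar>m - k\<bar>\<^esup>\<close>, which can be summed over \<open>m\<close>.\<close>

lemma osc_norm_le_besov_norm:
  fixes \<psi> \<phi> :: "real^'d \<Rightarrow> real"
  assumes lp: "littlewood_paley \<psi> \<phi>"
  shows "\<exists>C>0. \<forall>u. u \<in> borel_measurable borel \<longrightarrow>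
     osc_norm (\<lambda>x. complex_of_real (\<psi> x)) u \<le> ennreal C * besov_norm \<psi> \<phi> u"
proof -
  note lpf = littlewood_paley_facts[OF lp]
  define q where "q = (\<lambda>x. complex_of_real (\<psi> x))"
  define p where "p = (\<lambda>x. complex_of_real (\<phi> x))"
  have q: "test_function q" and p: "test_function p" using lpf(1,2) by (simp_all add: q_def p_def)
  note [measurable] = test_function_measurable[OF q] test_function_measurable[OF p]
  have q0: "q 0 = 1" using lpf(6)[of 0] by (simp add: q_def)
  define c where "c = (LINT y|lborel. fourier q y) / complex_of_real ((2 * pi) ^ CARD('d))"
  have c: "c \<noteq> 0"
    using inversion_constant_nonzero[of \<psi>] lpf(1,3,5) q0 unfolding c_def q_def by simp
  have inv: "inverse_fourier (fourier \<theta>) x = c * \<theta> x" if "test_function \<theta>" for \<theta> and x :: "real^'d"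
    unfolding c_def by (rule fourier_inversion_constant[OF q q0 that])
  have inv': "fourier (inverse_fourier \<theta>) \<xi> = c * \<theta> \<xi>" if \<theta>: "test_function \<theta>" for \<theta> and \<xi> :: "real^'d"
  proof -
    have [measurable]: "\<theta> \<in> borel_measurable borel" by (rule test_function_measurable[OF \<theta>])
    have "fourier (inverse_fourier \<theta>) \<xi>
        = (LINT v|lborel. wave (-\<xi>) v * fourier \<theta> (-v) / complex_of_real ((2 * pi) ^ CARD('d)))"
      by (simp add: fourier_lborel[of "inverse_fourier \<theta>"] inverse_fourier_reflect[OF \<theta>])
    also have "\<dots> = (LINT v|lborel. wave (-\<xi>) (0 - v) * fourier \<theta> (-(0 - v)) / complex_of_real ((2 * pi) ^ CARD('d)))"
      by (rule lborel_integral_reflect[symmetric]) measurable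
    also have "\<dots> = inverse_fourier (fourier \<theta>) \<xi>"
      by (simp add: inverse_fourier_lborel inner_commute)
    finally show ?thesis using inv[OF \<theta>] by simp
  qed
  define s where "s k = (case k of 0 \<Rightarrow> \<psi> | Suc k \<Rightarrow> \<lambda>\<xi>. \<phi> ((1 / 2) ^ k *\<^sub>R \<xi>))" for k
  have s_nonneg: "0 \<le> s k \<xi>" for k \<xi> using lpf(3,4) by (simp add: s_def split: nat.split)
  have s_sums: "(\<lambda>k. s k \<xi>) sums 1" for \<xi>
    using sums_Suc[of "\<lambda>k. s k \<xi>"] lpf(9)[of \<xi>] by (fastforce simp: s_def)
  have s_test: "test_function (\<lambda>\<xi>. complex_of_real (s k \<xi>))" for k
    using lpf(1) test_function_dilate[OF lpf(2)] by (cases k) (auto simp: s_def)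
  \<comment> \<open>\<open>\<theta>0\<close> and \<open>\<theta>1\<close> equal \<open>1\<close> on the supports of \<open>\<psi>\<close> and \<open>\<phi>\<close>; moreover \<open>\<theta>1\<close> vanishes at the origin, so
    that the kernels of the blocks of positive frequency have mean zero.\<close>
  define \<theta>0 where "\<theta>0 = (\<lambda>\<xi>. q ((1 / 4) *\<^sub>R \<xi>))"
  define \<theta>1 where "\<theta>1 = (\<lambda>\<xi>. q ((1 / 8) *\<^sub>R \<xi>) - q (4 *\<^sub>R \<xi>))"
  have \<theta>: "test_function \<theta>0" "test_function \<theta>1"
    unfolding \<theta>0_def \<theta>1_def by (intro test_function_diff test_function_dilate q; simp)+
  define T0 where "T0 = inverse_fourier \<theta>0"
  define T1 where "T1 = inverse_fourier \<theta>1"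
  define T where "T k = (case k of 0 \<Rightarrow> T0 | Suc k \<Rightarrow> dil (2 ^ k) T1)" for k
  have T01: "integrable lborel T0" "integrable lborel T1"
    unfolding T0_def T1_def by (intro integrable_inverse_fourier \<theta>)+
  have T_int: "integrable lborel (T k)" for k
    using T01 by (auto simp: T_def dil_integrable split: nat.split)
  have reproduce: "fourier (T k) \<xi> * complex_of_real (s k \<xi>) = c * complex_of_real (s k \<xi>)" for k \<xi>
  proof (cases k)
    case 0
    have "\<theta>0 \<xi> * q \<xi> = q \<xi>"
    proof (cases "1 < norm \<xi>")
      case False
      then show ?thesis using lpf(6)[of "(1 / 4) *\<^sub>R \<xi>"] by (simp add: \<theta>0_def q_def)
    qed (use lpf(7) in \<open>auto simp: q_def\<close>)
    then show ?thesis using 0 inv'[OF \<theta>(1), of \<xi>] by (auto simp: T_def T0_def s_def q_def)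
  next
    case (Suc j)
    define \<eta> where "\<eta> = (1 / 2) ^ j *\<^sub>R \<xi>"
    have "\<theta>1 \<eta> * p \<eta> = p \<eta>"
    proof (cases "p \<eta> = 0")
      case False
      then have "1 / 2 \<le> norm \<eta>" "norm \<eta> \<le> 2" using lpf(8)[of \<eta>] by (auto simp: p_def)
      then have "\<psi> ((1 / 8) *\<^sub>R \<eta>) = 1" "\<psi> (4 *\<^sub>R \<eta>) = 0"
        using lpf(6)[of "(1 / 8) *\<^sub>R \<eta>"] lpf(7)[of "4 *\<^sub>R \<eta>"] by auto
      then show ?thesis by (simp add: \<theta>1_def q_def)
    qed simp
    moreover have "fourier (T k) \<xi> = c * \<theta>1 \<eta>"
      using Suc T01 fourier_dil[of T1 "2 ^ j" \<xi>] inv'[OF \<theta>(2), of \<eta>]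
      by (simp add: T_def T1_def power_one_over borel_measurable_integrable \<eta>_def)
    ultimately show ?thesis using Suc by (auto simp: s_def p_def \<eta>_def)
  qed
  define N where "N = (\<lambda>x. dil 2 q x - q x)"
  have N: "test_function N" unfolding N_def by (intro test_function_diff test_function_dil q) simp
  have N0: "(LINT x|lborel. N x) = 0"
    unfolding N_def using test_function_integrable[OF q] by (simp add: dil_integrable dil_integral)
  have T10: "(LINT x|lborel. T1 x) = 0"
  proof -
    have "(LINT x|lborel. T1 x) = fourier T1 0"
      using T01(2) by (simp add: fourier_lborel borel_measurable_integrable)
    also have "\<dots> = 0" unfolding T1_def inv'[OF \<theta>(2)] by (simp add: \<theta>1_def)
    finally show ?thesis .
  qed
  obtain K1 where K1: "regular_kernel K1 N" using regular_kernel_test_function[OF N] by (elim exE)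
  obtain K2 where K2: "regular_kernel K2 T0"
    using regular_kernel_inverse_fourier[OF \<theta>(1)] unfolding T0_def by (elim exE)
  obtain K3 where K3: "regular_kernel K3 T1"
    using regular_kernel_inverse_fourier[OF \<theta>(2)] unfolding T1_def by (elim exE)
  define K where "K = max K1 (max K2 K3)"
  have K: "regular_kernel K N" "regular_kernel K T0" "regular_kernel K T1"
    by (rule regular_kernel_mono[OF K1] regular_kernel_mono[OF K2] regular_kernel_mono[OF K3]; simp add: K_def)+
  define w where "w m k = (case k of 0 \<Rightarrow> (1 / 2) ^ m | Suc k \<Rightarrow> (1 / 2 :: real) ^ (if m < k then k - m else m - k))" for m k :: nat
  have w_sum: "(\<Sum>m. ennreal (w m k)) \<le> 3" for k
  proof (cases k)
    case 0
    then show ?thesis using suminf_half_dist[of 0] by (simp add: w_def)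
  next
    case (Suc j)
    then show ?thesis using suminf_half_dist[of j] by (simp only: w_def nat.case)
  qed
  have NT: "L1norm (conv (dil (2 ^ m) N) (T k)) \<le> ennreal (K\<^sup>2 * w m k)" for m k
  proof -
    have mN: "dil r N \<in> borel_measurable borel" for r
      using test_function_measurable[OF N] by measurable
    have mT: "dil r T0 \<in> borel_measurable borel" "dil r T1 \<in> borel_measurable borel" for r
      using T01 by (auto intro!: dil_measurable simp: borel_measurable_integrable dest: borel_measurable_integrable)
    show ?thesis
    proof (cases k)
      case 0
      have "T k = dil 1 T0" using 0 by (simp add: T_def dil_def fun_eq_iff)
      moreover have "L1norm (conv (dil 1 T0) (dil (2 ^ m) N)) \<le> ennreal (K\<^sup>2 * (1 / 2 ^ m))"
        by (rule conv_dil_almost_orthogonal[OF K(1,2) N0]) auto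
      ultimately show ?thesis using 0 conv_commute[OF mN mT(1)] by (simp add: w_def power_one_over)
    next
      case (Suc j)
      show ?thesis
      \<comment> \<open>The finer of the two kernels has to be the cancelling one.\<close>
      proof (cases "m < j")
        case True
        have "L1norm (conv (dil (2 ^ m) N) (dil (2 ^ j) T1)) \<le> ennreal (K\<^sup>2 * (2 ^ m / 2 ^ j))"
          by (rule conv_dil_almost_orthogonal[OF K(3,1) T10]) auto
        then show ?thesis using Suc True by (simp add: w_def T_def power_diff power_one_over)
      next
        case False
        have "L1norm (conv (dil (2 ^ j) T1) (dil (2 ^ m) N)) \<le> ennreal (K\<^sup>2 * (2 ^ j / 2 ^ m))"
          by (rule conv_dil_almost_orthogonal[OF K(1,3) N0]) auto
        then show ?thesis using Suc False conv_commute[OF mN mT(2)]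
          by (simp add: w_def T_def power_diff power_one_over)
      qed
    qed
  qed
  define a where "a = 1 / norm c"
  have a: "a > 0" using c by (simp add: a_def)
  let ?I = "LINT x|lborel. norm (q x)"
  define C where "C = a * ?I + 3 * (a\<^sup>2 * K\<^sup>2) + 1"
  have I: "?I \<ge> 0" by simp
  have C: "C > 0" using a unfolding C_def by (intro add_nonneg_pos add_nonneg_nonneg mult_nonneg_nonneg) auto
  have "osc_norm q u \<le> ennreal C * besov_norm \<psi> \<phi> u" if u[measurable]: "u \<in> borel_measurable borel" for u
  proof (cases "integrable lborel u")
    case False
    then have "besov_norm \<psi> \<phi> u = \<infinity>" by (simp add: besov_norm_def integrable_completion)
    then show ?thesis using C by (simp add: ennreal_mult_top)
  next
    case True
    define d where "d k = inverse_fourier (\<lambda>\<xi>. complex_of_real (s k \<xi>) * fourier u \<xi>)" for k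
    define D where "D k = L1norm (d k)" for k
    have ms [measurable]: "(\<lambda>\<xi>. complex_of_real (s k \<xi>)) \<in> borel_measurable borel" for k
      by (rule test_function_measurable[OF s_test])
    have md [measurable]: "d k \<in> borel_measurable borel" for k unfolding d_def by measurable
    have bes: "besov_norm \<psi> \<phi> u = (\<Sum>k. D k)"
    proof -
      have "(\<Sum>k. D k) = (\<Sum>k. D (k + 1)) + (\<Sum>k<1. D k)" by (rule suminf_offset) simp
      then show ?thesis using True
        by (simp add: besov_norm_def integrable_completion nn_integral_completion D_def d_def s_def
            fourier_multiplier_def[abs_def] add.commute)
    qed
    obtain U where U: "\<And>\<xi>. norm (fourier u \<xi>) \<le> U" using norm_fourier_le[OF True] by blast
    have int_s: "integrable lborel (\<lambda>\<xi>. complex_of_real (s k \<xi>) * fourier u \<xi>)" for k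
    proof (rule Bochner_Integration.integrable_bound)
      show "integrable lborel (\<lambda>\<xi>. U *\<^sub>R complex_of_real (s k \<xi>))"
        by (intro integrable_scaleR_right test_function_integrable s_test)
      show "AE \<xi> in lborel. norm (complex_of_real (s k \<xi>) * fourier u \<xi>) \<le> norm (U *\<^sub>R complex_of_real (s k \<xi>))"
      proof (rule AE_I2)
        fix \<xi>
        have "norm (fourier u \<xi>) \<le> \<bar>U\<bar>" using U[of \<xi>] by linarith
        from mult_right_mono[OF this, of "norm (complex_of_real (s k \<xi>))"]
        show "norm (complex_of_real (s k \<xi>) * fourier u \<xi>) \<le> norm (U *\<^sub>R complex_of_real (s k \<xi>))"
          by (simp add: norm_mult mult.commute)
      qed
    qed measurable
    have convH: "conv H (d k) x = inverse_fourier (\<lambda>\<xi>. fourier H \<xi> * (complex_of_real (s k \<xi>) * fourier u \<xi>)) x"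
      if "integrable lborel H" for H k x
      unfolding d_def conv_inverse_fourier[OF that int_s] ..
    have conv_sums: "(\<lambda>k. conv H (d k) x) sums (c * conv H u x)" if H: "test_function H" for H x
    proof -
      have iH: "integrable lborel H" and iFH: "integrable lborel (fourier H)"
        using H by (simp_all add: test_function_integrable fourier_integrable)
      note [measurable] = test_function_measurable[OF H]
      let ?c = "complex_of_real ((2 * pi) ^ CARD('d))"
      let ?g = "\<lambda>k \<xi>. wave \<xi> x * (fourier H \<xi> * (complex_of_real (s k \<xi>) * fourier u \<xi>))"
      have int_g: "integrable lborel (?g k)" for k
      proof (rule integrable_wave_mult', rule Bochner_Integration.integrable_bound)
        let ?B = "LINT v|lborel. norm (H v)"
        show "integrable lborel (\<lambda>\<xi>. ?B *\<^sub>R (complex_of_real (s k \<xi>) * fourier u \<xi>))"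
          by (intro integrable_scaleR_right int_s)
        show "AE \<xi> in lborel. norm (fourier H \<xi> * (complex_of_real (s k \<xi>) * fourier u \<xi>))
            \<le> norm (?B *\<^sub>R (complex_of_real (s k \<xi>) * fourier u \<xi>))"
          using norm_fourier_le[OF iH] by (intro AE_I2) (simp add: norm_mult mult_right_mono)
      qed measurable
      have lim: "(\<lambda>n. LINT \<xi>|lborel. (\<Sum>k<n. ?g k \<xi>)) \<longlonglongrightarrow> (LINT \<xi>|lborel. wave \<xi> x * (fourier H \<xi> * (1 * fourier u \<xi>)))"
      proof (rule integral_dominated_convergence[where w = "\<lambda>\<xi>. U * norm (fourier H \<xi>)"])
        show "integrable lborel (\<lambda>\<xi>. U * norm (fourier H \<xi>))" by (intro integrable_mult_right integrable_norm iFH)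
        have eq: "(\<Sum>k<n. ?g k \<xi>) = wave \<xi> x * (fourier H \<xi> * (complex_of_real (\<Sum>k<n. s k \<xi>) * fourier u \<xi>))" for n \<xi>
          by (simp add: sum_distrib_left sum_distrib_right)
        show "AE \<xi> in lborel. (\<lambda>n. \<Sum>k<n. ?g k \<xi>) \<longlonglongrightarrow> wave \<xi> x * (fourier H \<xi> * (1 * fourier u \<xi>))"
        proof (rule AE_I2)
          fix \<xi>
          have "(\<lambda>n. complex_of_real (\<Sum>k<n. s k \<xi>)) \<longlonglongrightarrow> complex_of_real 1"
            using s_sums[of \<xi>] unfolding sums_def by (rule tendsto_of_real)
          then show "(\<lambda>n. \<Sum>k<n. ?g k \<xi>) \<longlonglongrightarrow> wave \<xi> x * (fourier H \<xi> * (1 * fourier u \<xi>))"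
            unfolding eq by (intro tendsto_mult tendsto_const) simp
        qed
        show "AE \<xi> in lborel. norm (\<Sum>k<n. ?g k \<xi>) \<le> U * norm (fourier H \<xi>)" for n
        proof (rule AE_I2)
          fix \<xi>
          have "(\<Sum>k<n. s k \<xi>) \<le> 1"
            using sum_le_suminf[OF sums_summable[OF s_sums], of "{..<n}" \<xi>] s_nonneg sums_unique[OF s_sums[of \<xi>]] by simp
          moreover have "0 \<le> (\<Sum>k<n. s k \<xi>)" by (intro sum_nonneg s_nonneg)
          ultimately have "norm (complex_of_real (\<Sum>k<n. s k \<xi>)) * norm (fourier u \<xi>) \<le> 1 * U"
            using U[of \<xi>] by (intro mult_mono) (auto simp del: of_real_sum)
          then have "norm (fourier H \<xi>) * (norm (complex_of_real (\<Sum>k<n. s k \<xi>)) * norm (fourier u \<xi>)) \<le> norm (fourier H \<xi>) * (1 * U)"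
            by (rule mult_left_mono) simp
          then show "norm (\<Sum>k<n. ?g k \<xi>) \<le> U * norm (fourier H \<xi>)"
            unfolding eq norm_mult by (simp add: mult.commute)
        qed
      qed measurable
      have "(LINT \<xi>|lborel. (\<Sum>k<n. ?g k \<xi>)) = (\<Sum>k<n. LINT \<xi>|lborel. ?g k \<xi>)" for n
        by (rule Bochner_Integration.integral_sum) (rule int_g)
      with lim have "(\<lambda>k. LINT \<xi>|lborel. ?g k \<xi>) sums (LINT \<xi>|lborel. wave \<xi> x * (fourier H \<xi> * (1 * fourier u \<xi>)))"
        unfolding sums_def by simp
      then have "(\<lambda>k. (LINT \<xi>|lborel. ?g k \<xi>) / ?c) sums ((LINT \<xi>|lborel. wave \<xi> x * (fourier H \<xi> * (1 * fourier u \<xi>))) / ?c)"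
        by (rule sums_divide)
      then have "(\<lambda>k. conv H (d k) x) sums inverse_fourier (\<lambda>\<xi>. fourier H \<xi> * fourier u \<xi>) x"
        unfolding convH[OF iH] by (simp add: inverse_fourier_lborel)
      moreover have "inverse_fourier (\<lambda>\<xi>. fourier H \<xi> * fourier u \<xi>) = conv u (inverse_fourier (fourier H))"
        unfolding conv_inverse_fourier[OF True iFH] by (simp add: mult.commute)
      moreover have "conv u (inverse_fourier (fourier H)) x = c * conv H u x"
        unfolding conv_commute[OF test_function_measurable[OF H] u] conv_def inv[OF H]
        by (simp add: mult.left_commute)
      ultimately show ?thesis by simp
    qed
    have conv_le: "L1norm (conv H u) \<le> ennreal a * (\<Sum>k. L1norm (conv H (d k)))"
      if H: "test_function H" for H
    proof -
      note [measurable] = test_function_measurable[OF H]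
      have "ennreal (norm (conv H u x)) \<le> ennreal a * (\<Sum>k. ennreal (norm (conv H (d k) x)))" for x
      proof -
        have "ennreal (norm (conv H u x)) = ennreal a * ennreal (norm (c * conv H u x))"
          using c by (simp add: a_def norm_mult flip: ennreal_mult)
        also have "\<dots> \<le> ennreal a * (\<Sum>k. ennreal (norm (conv H (d k) x)))"
          by (intro mult_left_mono ennreal_norm_sums_le conv_sums H) simp
        finally show ?thesis .
      qed
      then have "L1norm (conv H u) \<le> (\<integral>\<^sup>+x. ennreal a * (\<Sum>k. ennreal (norm (conv H (d k) x))) \<partial>lborel)"
        by (intro nn_integral_mono)
      also have "\<dots> = ennreal a * (\<Sum>k. L1norm (conv H (d k)))"
        by (simp add: nn_integral_cmult nn_integral_suminf)
      finally show ?thesis .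
    qed
    have conv_reproduce: "L1norm (conv H (d k))
        \<le> ennreal a * (L1norm (conv H (T k)) * D k)" if H: "test_function H" for H k
    proof -
      have iH: "integrable lborel H" by (rule test_function_integrable[OF H])
      note [measurable] = test_function_measurable[OF H] borel_measurable_integrable[OF T_int, simplified]
      have iHT: "integrable lborel (conv H (T k))" by (intro integrable_conv iH T_int)
      have "conv (conv H (T k)) (d k) x = c * conv H (d k) x" for x
      proof -
        have "conv (conv H (T k)) (d k) x
            = inverse_fourier (\<lambda>\<xi>. fourier H \<xi> * (fourier (T k) \<xi> * complex_of_real (s k \<xi>)) * fourier u \<xi>) x"
          unfolding convH[OF iHT] by (simp add: fourier_conv[OF iH T_int] mult_ac)
        also have "\<dots> = inverse_fourier (\<lambda>\<xi>. c * (fourier H \<xi> * (complex_of_real (s k \<xi>) * fourier u \<xi>))) x"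
          unfolding reproduce by (simp add: mult_ac)
        also have "\<dots> = c * inverse_fourier (\<lambda>\<xi>. fourier H \<xi> * (complex_of_real (s k \<xi>) * fourier u \<xi>)) x"
        proof -
          have "inverse_fourier (\<lambda>\<xi>. c * g \<xi>) x = c * inverse_fourier g x" if "g \<in> borel_measurable borel" for g
            using that by (simp add: inverse_fourier_lborel mult.left_commute[of _ c])
          then show ?thesis by simp
        qed
        finally show ?thesis unfolding convH[OF iH] .
      qed
      then have "ennreal (norm (conv H (d k) x)) = ennreal a * ennreal (norm (conv (conv H (T k)) (d k) x))" for x
        using c by (simp add: a_def norm_mult flip: ennreal_mult)
      then have "L1norm (conv H (d k)) = ennreal a * L1norm (conv (conv H (T k)) (d k))"
        by (simp add: nn_integral_cmult)
      also have "\<dots> \<le> ennreal a * (L1norm (conv H (T k)) * D k)"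
        unfolding D_def by (intro mult_left_mono conv_young) auto
      finally show ?thesis .
    qed
    have "L1norm (conv q u) \<le> ennreal a * (\<Sum>k. ennreal ?I * D k)"
    proof (rule order_trans[OF conv_le[OF q]], intro mult_left_mono suminf_le)
      fix k
      show "L1norm (conv q (d k)) \<le> ennreal ?I * D k"
        using conv_young[of q "d k"] nn_integral_eq_integral[OF integrable_norm[OF test_function_integrable[OF q]]]
        by (simp add: D_def)
    qed auto
    also have "\<dots> = ennreal (a * ?I) * besov_norm \<psi> \<phi> u"
      using a by (simp add: bes ennreal_mult mult.assoc)
    finally have 1: "L1norm (conv q u) \<le> ennreal (a * ?I) * besov_norm \<psi> \<phi> u" .
    have "(\<Sum>m. L1norm (conv (dil (2 ^ m) N) u))
        \<le> (\<Sum>m. \<Sum>k. ennreal (a\<^sup>2 * K\<^sup>2) * (ennreal (w m k) * D k))"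
    proof (intro suminf_le)
      fix m
      have Nm: "test_function (dil (2 ^ m) N)" by (intro test_function_dil N) simp
      have "L1norm (conv (dil (2 ^ m) N) u)
         \<le> ennreal a * (\<Sum>k. L1norm (conv (dil (2 ^ m) N) (d k)))"
        by (rule conv_le[OF Nm])
      also have "\<dots> \<le> ennreal a * (\<Sum>k. ennreal a * (ennreal (K\<^sup>2 * w m k) * D k))"
        by (intro mult_left_mono suminf_le order_trans[OF conv_reproduce[OF Nm]] mult_right_mono NT) auto
      also have "\<dots> = (\<Sum>k. ennreal (a\<^sup>2 * K\<^sup>2) * (ennreal (w m k) * D k))"
      proof -
        have "ennreal a * (ennreal a * (ennreal (K\<^sup>2 * w m k) * D k)) = ennreal (a\<^sup>2 * K\<^sup>2) * (ennreal (w m k) * D k)" for k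
        proof -
          have w0: "0 \<le> w m k" by (simp add: w_def split: nat.split)
          then have "ennreal a * (ennreal a * (ennreal (K\<^sup>2 * w m k) * D k)) = ennreal (a * (a * (K\<^sup>2 * w m k))) * D k"
            using a by (simp add: ennreal_mult mult.assoc)
          also have "a * (a * (K\<^sup>2 * w m k)) = (a\<^sup>2 * K\<^sup>2) * w m k" by (simp add: power2_eq_square)
          also have "ennreal \<dots> * D k = ennreal (a\<^sup>2 * K\<^sup>2) * (ennreal (w m k) * D k)"
            using w0 by (subst ennreal_mult) (auto simp: mult.assoc)
          finally show ?thesis .
        qed
        then show ?thesis by (simp flip: ennreal_suminf_cmult)
      qed
      finally show "L1norm (conv (dil (2 ^ m) N) u)
         \<le> (\<Sum>k. ennreal (a\<^sup>2 * K\<^sup>2) * (ennreal (w m k) * D k))" .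
    qed auto
    also have "\<dots> = ennreal (a\<^sup>2 * K\<^sup>2) * (\<Sum>k. (\<Sum>m. ennreal (w m k)) * D k)"
      by (subst ennreal_suminf_swap) simp
    also have "\<dots> \<le> ennreal (a\<^sup>2 * K\<^sup>2) * (\<Sum>k. 3 * D k)"
      by (intro mult_left_mono suminf_le mult_right_mono w_sum) auto
    also have "\<dots> = ennreal (3 * (a\<^sup>2 * K\<^sup>2)) * besov_norm \<psi> \<phi> u"
      by (simp add: bes ennreal_mult mult_ac)
    finally have "osc_norm q u \<le> ennreal (a * ?I) * besov_norm \<psi> \<phi> u + ennreal (3 * (a\<^sup>2 * K\<^sup>2)) * besov_norm \<psi> \<phi> u"
      unfolding osc_norm_def N_def[symmetric] by (intro add_mono 1)
    also have "\<dots> = ennreal (a * ?I + 3 * (a\<^sup>2 * K\<^sup>2)) * besov_norm \<psi> \<phi> u"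
      using a by (simp add: ennreal_plus distrib_right)
    also have "\<dots> \<le> ennreal C * besov_norm \<psi> \<phi> u"
      unfolding C_def by (intro mult_right_mono ennreal_leI) auto
    finally show ?thesis .
  qed
  then show ?thesis using C unfolding q_def by blast
qed

section \<open>Integrable maximal functions\<close>

text \<open>The sum over the levels below \<open>t\<close> is geometric, so the largest of them dominates it.\<close>

lemma sum_dyadic_levels_le:
  fixes t :: ennreal and c :: real
  assumes "c \<ge> 0"
  shows "(\<Sum>i<n. ennreal (c * 2 ^ i) * indicator {x. ennreal (c * 2 ^ i) < x} t) \<le> 2 * t"
proof (induction n)
  case (Suc n)
  show ?case
  proof (cases "ennreal (c * 2 ^ n) < t")
    case True
    have "(\<Sum>i<Suc n. ennreal (c * 2 ^ i) * indicator {x. ennreal (c * 2 ^ i) < x} t) \<le> (\<Sum>i<Suc n. ennreal (c * 2 ^ i))"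
      by (intro sum_mono) (simp add: indicator_def)
    also have "\<dots> = ennreal (\<Sum>i<Suc n. c * 2 ^ i)" using assms by (intro sum_ennreal) auto
    also have "(\<Sum>i<Suc n. c * 2 ^ i) = c * (2 ^ Suc n - 1)"
      by (simp only: sum_distrib_left[symmetric]) (induction n; simp add: algebra_simps)
    also have "ennreal (c * (2 ^ Suc n - 1)) \<le> ennreal (2 * (c * 2 ^ n))"
      using assms by (intro ennreal_leI) (simp add: algebra_simps)
    also have "\<dots> = 2 * ennreal (c * 2 ^ n)" using assms by (simp add: ennreal_mult)
    also have "\<dots> \<le> 2 * t" using True by (intro mult_left_mono) auto
    finally show ?thesis .
  qed (use Suc in simp)
qed simp

lemma emeasure_UN_le_countable:
  assumes "countable C" "\<And>i. i \<in> C \<Longrightarrow> X i \<in> sets M"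
  shows "emeasure M (\<Union>i\<in>C. X i) \<le> (\<integral>\<^sup>+i. emeasure M (X i) \<partial>count_space C)"
proof -
  have "emeasure M (\<Union>i\<in>C. X i) = (\<integral>\<^sup>+x. indicator (\<Union>i\<in>C. X i) x \<partial>M)"
    using assms by (intro nn_integral_indicator[symmetric] sets.countable_UN'') auto
  also have "\<dots> \<le> (\<integral>\<^sup>+x. \<integral>\<^sup>+i. indicator (X i) x \<partial>count_space C \<partial>M)"
  proof (rule nn_integral_mono)
    fix x
    show "indicator (\<Union>i\<in>C. X i) x \<le> (\<integral>\<^sup>+i. indicator (X i) x \<partial>count_space C)"
    proof (cases "x \<in> (\<Union>i\<in>C. X i)")
      case True
      then obtain i where i: "i \<in> C" "x \<in> X i" by blast
      then have "indicator (\<Union>i\<in>C. X i) x = (indicator (X i) x :: ennreal)" by (auto simp: indicator_def)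
      also have "\<dots> \<le> (\<integral>\<^sup>+i. indicator (X i) x \<partial>count_space C)" using i(1) by (rule nn_integral_ge_point)
      finally show ?thesis .
    qed simp
  qed
  also have "\<dots> = (\<integral>\<^sup>+i. \<integral>\<^sup>+x. indicator (X i) x \<partial>M \<partial>count_space C)"
    using assms by (intro nn_integral_count_space_nn_integral) auto
  also have "\<dots> = (\<integral>\<^sup>+i. emeasure M (X i) \<partial>count_space C)"
    using assms by (intro nn_integral_cong) (simp add: nn_integral_indicator)
  finally show ?thesis .
qed

text \<open>A reverse weak-type inequality.  For \<open>x\<close> in the level set \<open>W\<close> take the largest dyadic ball around \<open>x\<close>
  with average above the level.  The eight times larger ball has an average below the level, so the mass
  of the five times larger ball is at most the level times the volume of the small ball, up to a constant.
  On the small ball the maximal function is still above \<open>2\<^sup>-\<^sup>D\<close> times the level, since each of its points is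
  the centre of a ball of twice the radius that contains it.  Vitali's lemma selects disjoint small balls
  whose five times enlargements cover \<open>W\<close>.  The lower bound on the level forces the selected balls to be
  small enough for the enlargement by eight to be among the balls considered.\<close>

lemma level_set_mass_le:
  fixes u :: "'a::euclidean_space \<Rightarrow> real" and U :: "'a \<Rightarrow> ennreal" and a l :: real
  defines "\<mu> \<equiv> density lborel (\<lambda>x. ennreal (u x))"
  defines "W \<equiv> {x. \<exists>m::nat. ennreal l < ennreal (2 ^ (m * DIM('a))) * emeasure \<mu> (ball x ((1 / 2) ^ Suc m))}"
  assumes [measurable]: "u \<in> borel_measurable borel" "U \<in> borel_measurable borel"
    and a: "a > 0" "(\<integral>\<^sup>+x. ennreal (u x) \<partial>lborel) \<le> ennreal a"
    and lam: "4 ^ DIM('a) * a \<le> l"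
    and U: "\<And>m x. ennreal (2 ^ (m * DIM('a))) * emeasure \<mu> (ball x ((1 / 2) ^ Suc m)) \<le> U x"
  shows "emeasure \<mu> W \<le> ennreal (16 ^ DIM('a) / unit_ball_vol DIM('a)) *
      (ennreal l * emeasure lborel {x. ennreal l < ennreal (2 ^ DIM('a)) * U x})"
proof -
  let ?D = "DIM('a)" and ?\<omega> = "unit_ball_vol (real DIM('a))"
  have omega: "?\<omega> > 0" by (rule unit_ball_vol_pos) simp
  let ?big = "\<lambda>m x. ennreal l < ennreal (2 ^ (m * ?D)) * emeasure \<mu> (ball x ((1 / 2) ^ Suc m))"
  have lam0: "l > 0" using lam a(1) by (smt (verit) mult_pos_pos zero_less_power)
  have [simp]: "sets \<mu> = sets borel" by (simp add: \<mu>_def)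
  have \<mu>_le: "emeasure \<mu> A \<le> ennreal a" if "A \<in> sets borel" for A
  proof -
    have "emeasure \<mu> A \<le> emeasure \<mu> UNIV" using that by (intro emeasure_mono) auto
    also have "\<dots> \<le> ennreal a" using a(2) by (simp add: \<mu>_def emeasure_density)
    finally show ?thesis .
  qed
  \<comment> \<open>The first scale, hence the largest ball, at which the average exceeds the level.\<close>
  define m where "m x = (LEAST m. ?big m x)" for x
  have m: "?big (m x) x" if "x \<in> W" for x using that unfolding m_def W_def by (auto intro: LeastI)
  have m_less: "\<not> ?big k x" if "k < m x" for k x using that unfolding m_def by (rule not_less_Least)
  have m3: "3 \<le> m x" if "x \<in> W" for x
  proof (rule ccontr)
    assume "\<not> 3 \<le> m x"
    then have "m x * ?D \<le> 2 * ?D" by (intro mult_right_mono) auto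
    then have "(2::real) ^ (m x * ?D) \<le> 4 ^ ?D"
      using power_increasing[of "m x * ?D" "2 * ?D" "2::real"] by (simp add: power_mult)
    then have "2 ^ (m x * ?D) * a \<le> l" using a(1) lam by (meson mult_right_mono less_imp_le order_trans)
    moreover have "ennreal (2 ^ (m x * ?D)) * emeasure \<mu> (ball x ((1 / 2) ^ Suc (m x))) \<le> ennreal (2 ^ (m x * ?D)) * ennreal a"
      by (intro mult_left_mono \<mu>_le) auto
    ultimately have "ennreal (2 ^ (m x * ?D)) * emeasure \<mu> (ball x ((1 / 2) ^ Suc (m x))) \<le> ennreal l"
      using a(1) by (simp flip: ennreal_mult) (meson ennreal_leI order_trans)
    then show False using m[OF that] by simp
  qed
  define r where "r x = (1 / 2 :: real) ^ Suc (m x)" for x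
  have r: "0 < r x" "r x \<le> 1" for x unfolding r_def by (simp, intro power_le_one) auto
  obtain C where C: "countable C" "C \<subseteq> W" "pairwise (\<lambda>i j. disjnt (ball i (r i)) (ball j (r j))) C"
      "W \<subseteq> (\<Union>i\<in>C. ball i (5 * r i))"
  proof (rule Vitali_covering_lemma_balls[where S=W and K=W and a="\<lambda>x. x" and r=r and B=1])
    show "W \<subseteq> (\<Union>i\<in>W. ball i (r i))" using r(1) by auto
    show "0 < r i \<and> r i \<le> 1" for i using r[of i] by simp
  qed
  have ball_le: "emeasure \<mu> (ball x (5 * r x)) \<le> ennreal (16 ^ ?D / ?\<omega> * l) * emeasure lborel (ball x (r x))"
    if x: "x \<in> W" for x
  proof -
    define k where "k = m x - 3"
    have mk: "m x = k + 3" using m3[OF x] by (simp add: k_def)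
    have 5: "5 * r x \<le> (1 / 2) ^ Suc k" by (simp add: r_def mk power_add power_one_over divide_simps)
    have "\<not> ?big k x" using m_less[of k x] mk by simp
    then have "ennreal (2 ^ (k * ?D)) * emeasure \<mu> (ball x ((1 / 2) ^ Suc k)) \<le> ennreal l" by simp
    then have "ennreal (1 / 2 ^ (k * ?D)) * (ennreal (2 ^ (k * ?D)) * emeasure \<mu> (ball x ((1 / 2) ^ Suc k)))
        \<le> ennreal (1 / 2 ^ (k * ?D)) * ennreal l" by (rule mult_left_mono) simp
    then have "emeasure \<mu> (ball x ((1 / 2) ^ Suc k)) \<le> ennreal (1 / 2 ^ (k * ?D) * l)"
      using lam0 by (simp add: ennreal_mult[symmetric] mult.assoc[symmetric])
    moreover have "emeasure \<mu> (ball x (5 * r x)) \<le> emeasure \<mu> (ball x ((1 / 2) ^ Suc k))"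
      using 5 by (intro emeasure_mono) auto
    moreover have "ennreal (16 ^ ?D / ?\<omega> * l) * emeasure lborel (ball x (r x)) = ennreal (1 / 2 ^ (k * ?D) * l)"
    proof -
      have "(16::real) ^ ?D * r x ^ ?D = 1 / 2 ^ (k * ?D)"
      proof -
        have "(16::real) * r x = (1 / 2) ^ k" by (simp add: r_def mk power_add power_one_over)
        then have "((16::real) * r x) ^ ?D = 1 / 2 ^ (k * ?D)" by (simp add: power_mult power_one_over)
        then show ?thesis by (simp only: power_mult_distrib)
      qed
      then have "16 ^ ?D / ?\<omega> * l * (?\<omega> * r x ^ ?D) = 1 / 2 ^ (k * ?D) * l"
        using less_imp_neq[OF omega] by (simp add: field_simps)
      then show ?thesis using r(1)[of x] lam0 omega less_imp_neq[OF omega]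
        by (simp add: emeasure_ball ennreal_mult[symmetric])
    qed
    ultimately show ?thesis by simp
  qed
  have ball_sub: "ball x (r x) \<subseteq> {y. ennreal l < ennreal (2 ^ ?D) * U y}" if x: "x \<in> W" for x
  proof
    fix y assume y: "y \<in> ball x (r x)"
    define k where "k = m x - 1"
    have mk: "m x = Suc k" using m3[OF x] by (simp add: k_def)
    have rk: "(1 / 2) ^ Suc k = 2 * r x" by (simp add: r_def mk)
    have "ball x (r x) \<subseteq> ball y (2 * r x)"
    proof
      fix z assume "z \<in> ball x (r x)"
      then show "z \<in> ball y (2 * r x)" using y dist_triangle[of y z x] by (simp add: dist_commute)
    qed
    then have sub: "emeasure \<mu> (ball x (r x)) \<le> emeasure \<mu> (ball y ((1 / 2) ^ Suc k))"
      unfolding rk by (intro emeasure_mono) auto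
    have "ennreal l < ennreal (2 ^ (m x * ?D)) * emeasure \<mu> (ball x (r x))"
      using m[OF x] by (simp add: r_def)
    also have "\<dots> \<le> ennreal (2 ^ (m x * ?D)) * emeasure \<mu> (ball y ((1 / 2) ^ Suc k))"
      by (intro mult_left_mono sub) simp
    also have "\<dots> = ennreal (2 ^ ?D) * (ennreal (2 ^ (k * ?D)) * emeasure \<mu> (ball y ((1 / 2) ^ Suc k)))"
      by (simp add: mk power_add ennreal_mult mult.assoc)
    also have "\<dots> \<le> ennreal (2 ^ ?D) * U y" by (intro mult_left_mono U) simp
    finally show "y \<in> {y. ennreal l < ennreal (2 ^ ?D) * U y}" by simp
  qed
  have "emeasure \<mu> W \<le> emeasure \<mu> (\<Union>x\<in>C. ball x (5 * r x))"
    using C by (intro emeasure_mono) auto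
  also have "\<dots> \<le> (\<integral>\<^sup>+x. emeasure \<mu> (ball x (5 * r x)) \<partial>count_space C)"
    by (rule emeasure_UN_le_countable[OF C(1)]) simp
  also have "\<dots> \<le> (\<integral>\<^sup>+x. ennreal (16 ^ ?D / ?\<omega> * l) * emeasure lborel (ball x (r x)) \<partial>count_space C)"
    using C(2) by (intro nn_integral_mono ball_le) auto
  also have "\<dots> = ennreal (16 ^ ?D / ?\<omega> * l) * (\<integral>\<^sup>+x. emeasure lborel (ball x (r x)) \<partial>count_space C)"
    by (rule nn_integral_cmult) simp
  also have "(\<integral>\<^sup>+x. emeasure lborel (ball x (r x)) \<partial>count_space C) = emeasure lborel (\<Union>x\<in>C. ball x (r x))"
    using C by (intro emeasure_UN_countable[symmetric]) (auto simp: disjoint_family_on_def pairwise_def disjnt_def)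
  also have "ennreal (16 ^ ?D / ?\<omega> * l) * \<dots> \<le> ennreal (16 ^ ?D / ?\<omega> * l) * emeasure lborel {x. ennreal l < ennreal (2 ^ ?D) * U x}"
    using C(2) ball_sub by (intro mult_left_mono emeasure_mono) auto
  also have "\<dots> = ennreal (16 ^ ?D / ?\<omega>) * (ennreal l * emeasure lborel {x. ennreal l < ennreal (2 ^ ?D) * U x})"
    using lam0 omega less_imp_neq[OF omega] by (subst ennreal_mult) (auto simp: mult.assoc)
  finally show ?thesis .
qed

text \<open>Lebesgue differentiation along cubes with corner \<open>x\<close>; a cube of side \<open>h\<close> fits into a dyadic ball of
  radius comparable with \<open>h\<close>.\<close>

lemma AE_le_of_ball_averages:
  fixes u :: "'a::euclidean_space \<Rightarrow> real" and l :: real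
  assumes u: "integrable lborel u" "\<And>x. 0 \<le> u x" and lam: "0 \<le> l"
  shows "AE x in lborel. (\<forall>m::nat. ennreal (2 ^ (m * DIM('a))) * emeasure (density lborel (\<lambda>x. ennreal (u x))) (ball x ((1 / 2) ^ Suc m)) \<le> ennreal l)
      \<longrightarrow> u x \<le> (4 * DIM('a)) ^ DIM('a) * l"
proof -
  let ?D = "DIM('a)" and ?\<mu> = "density lborel (\<lambda>x. ennreal (u x))"
  note [measurable] = borel_measurable_integrable[OF u(1), simplified]
  have si: "set_integrable lborel (cbox a b) u" for a b :: 'a
    unfolding set_integrable_def using u(1) by (rule integrable_mult_indicator[rotated]) simp
  have int: "u integrable_on cbox a b" for a b
    using set_borel_integral_eq_integral(1)[OF si] .
  then obtain N where N: "negligible N" "\<And>x e. \<lbrakk>x \<notin> N; 0 < e\<rbrakk> \<Longrightarrow>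
        \<exists>d>0. \<forall>h. 0 < h \<and> h < d \<longrightarrow> norm (integral (cbox x (x + h *\<^sub>R One)) u /\<^sub>R h ^ DIM('a) - u x) < e"
    using integrable_ccontinuous_explicit[of u, OF int] by blast
  have "u x \<le> (4 * ?D) ^ ?D * l"
    if x: "x \<notin> N" and avg: "\<forall>m::nat. ennreal (2 ^ (m * ?D)) * emeasure ?\<mu> (ball x ((1 / 2) ^ Suc m)) \<le> ennreal l" for x
  proof (rule field_le_epsilon)
    fix e :: real assume "e > 0"
    then obtain d where d: "d > 0" "\<And>h. 0 < h \<Longrightarrow> h < d \<Longrightarrow> norm (integral (cbox x (x + h *\<^sub>R One)) u /\<^sub>R h ^ ?D - u x) < e"
      using N(2)[OF x \<open>e > 0\<close>] by blast
    obtain m where m: "(1 / 2) ^ m < d" using real_arch_pow_inv[of d "1/2"] d(1) by auto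
    define h where "h = (1 / 2) ^ Suc m / (2 * real ?D)"
    have h: "h > 0" by (simp add: h_def)
    have "0 < real ?D" "1 \<le> real ?D" using DIM_positive[where 'a='a] by (simp_all add: Suc_leI)
    then have "1 \<le> 2 * real ?D" "0 < 2 * real ?D" by linarith+
    then have "h \<le> (1 / 2) ^ Suc m / 1" unfolding h_def by (intro divide_left_mono) (assumption | simp)+
    also have "\<dots> < d" using m d(1) by simp
    finally have hd: "h < d" .
    have sub: "cbox x (x + h *\<^sub>R One) \<subseteq> ball x ((1 / 2) ^ Suc m)"
    proof
      fix y assume y: "y \<in> cbox x (x + h *\<^sub>R One)"
      have "norm (y - x) \<le> (\<Sum>b\<in>Basis. \<bar>(y - x) \<bullet> b\<bar>)" by (rule norm_le_l1)
      also have "\<dots> \<le> (\<Sum>b\<in>(Basis::'a set). h)"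
        using y by (intro sum_mono) (auto simp: mem_box inner_diff_left inner_add_left)
      also have "\<dots> < (1 / 2) ^ Suc m" by (simp add: h_def)
      finally show "y \<in> ball x ((1 / 2) ^ Suc m)" by (simp add: dist_norm norm_minus_commute)
    qed
    have "ennreal (integral (cbox x (x + h *\<^sub>R One)) u) = (\<integral>\<^sup>+y\<in>cbox x (x + h *\<^sub>R One). ennreal (u y) \<partial>lborel)"
    proof -
      have "integral (cbox x (x + h *\<^sub>R One)) u = (LINT y|lborel. indicator (cbox x (x + h *\<^sub>R One)) y *\<^sub>R u y)"
        using set_borel_integral_eq_integral(2)[OF si] by (simp add: set_lebesgue_integral_def)
      then have "ennreal (integral (cbox x (x + h *\<^sub>R One)) u) = (\<integral>\<^sup>+y. ennreal (indicator (cbox x (x + h *\<^sub>R One)) y *\<^sub>R u y) \<partial>lborel)"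
        using u(2) by (simp only:) (intro nn_integral_eq_integral[symmetric] si[unfolded set_integrable_def], simp)
      also have "\<dots> = (\<integral>\<^sup>+y\<in>cbox x (x + h *\<^sub>R One). ennreal (u y) \<partial>lborel)"
        by (intro nn_integral_cong) (auto simp: indicator_def)
      finally show ?thesis .
    qed
    also have "\<dots> = emeasure ?\<mu> (cbox x (x + h *\<^sub>R One))" by (simp add: emeasure_density)
    also have "\<dots> \<le> emeasure ?\<mu> (ball x ((1 / 2) ^ Suc m))" using sub by (intro emeasure_mono) auto
    finally have "ennreal (2 ^ (m * ?D)) * ennreal (integral (cbox x (x + h *\<^sub>R One)) u) \<le> ennreal l"
      using avg by (meson mult_left_mono order_trans zero_le)
    then have i: "2 ^ (m * ?D) * integral (cbox x (x + h *\<^sub>R One)) u \<le> l"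
      using lam by (simp flip: ennreal_mult' add: ennreal_le_iff)
    have "h * (4 * real ?D) = (1 / 2) ^ m" by (simp add: h_def)
    then have "h ^ ?D * (4 * real ?D) ^ ?D = 1 / 2 ^ (m * ?D)"
      by (metis power_mult power_mult_distrib power_one_over)
    then have "integral (cbox x (x + h *\<^sub>R One)) u /\<^sub>R h ^ ?D = (4 * real ?D) ^ ?D * (2 ^ (m * ?D) * integral (cbox x (x + h *\<^sub>R One)) u)"
      using h by (simp add: field_simps)
    also have "\<dots> \<le> (4 * real ?D) ^ ?D * l" using i by (intro mult_left_mono) auto
    finally show "u x \<le> (4 * ?D) ^ ?D * l + e" using d(2)[OF h hd] by simp
  qed
  moreover have "AE x in lborel. x \<notin> N"
    using N(1) AE_not_in[of N lebesgue] by (simp add: negligible_iff_null_sets AE_completion_iff)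
  ultimately show ?thesis by (auto elim: eventually_mono)
qed

text \<open>An \<open>L log L\<close> estimate in disguise.  The masses of the level sets at heights proportional to \<open>2\<^sup>i a\<close> for
  \<open>i < n\<close> are all at least the mass of the level set \<open>W\<close> at the height for \<open>i = n\<close>, while their sum is
  bounded by the integral of \<open>U\<close>; so \<open>W\<close> carries a mass of order \<open>a / n\<close>.  Outside \<open>W\<close> the function \<open>u\<close> is
  bounded by a multiple of \<open>2\<^sup>n a\<close>.\<close>

lemma maximal_equi_integrable:
  shows "\<exists>K>0. \<forall>(u::'a::euclidean_space \<Rightarrow> real) U (a::real) (n::nat) E.
     integrable lborel u \<longrightarrow> (\<forall>x. 0 \<le> u x) \<longrightarrow> U \<in> borel_measurable borel \<longrightarrow> a > 0 \<longrightarrow>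
     (\<integral>\<^sup>+x. ennreal (u x) \<partial>lborel) \<le> ennreal a \<longrightarrow> (\<integral>\<^sup>+x. U x \<partial>lborel) \<le> ennreal a \<longrightarrow>
     (\<forall>m x. ennreal (2 ^ (m * DIM('a))) * emeasure (density lborel (\<lambda>x. ennreal (u x))) (ball x ((1 / 2) ^ Suc m)) \<le> U x) \<longrightarrow>
     n > 0 \<longrightarrow> E \<in> sets borel \<longrightarrow>
     (\<integral>\<^sup>+x\<in>E. ennreal (u x) \<partial>lborel) \<le> ennreal (K / n * a) + ennreal (K * 2 ^ n * a) * emeasure lborel E"
proof -
  let ?D = "DIM('a)" and ?\<omega> = "unit_ball_vol (real DIM('a))"
  define K1 where "K1 = (16::real) ^ ?D / ?\<omega>"
  have K1: "K1 > 0" by (simp add: K1_def unit_ball_vol_pos)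
  define K where "K = max (K1 * (2 * 2 ^ ?D)) ((4 * real ?D) ^ ?D * 4 ^ ?D)"
  have K: "K > 0" "K1 * (2 * 2 ^ ?D) \<le> K" "(4 * real ?D) ^ ?D * 4 ^ ?D \<le> K" using K1 by (auto simp: K_def less_max_iff_disj)
  have "(\<integral>\<^sup>+x\<in>E. ennreal (u x) \<partial>lborel) \<le> ennreal (K / n * a) + ennreal (K * 2 ^ n * a) * emeasure lborel E"
    if u: "integrable lborel u" "\<forall>x. 0 \<le> u x" and U [measurable]: "U \<in> borel_measurable borel" and a: "a > 0"
      and ua: "(\<integral>\<^sup>+x. ennreal (u x) \<partial>lborel) \<le> ennreal a" and Ua: "(\<integral>\<^sup>+x. U x \<partial>lborel) \<le> ennreal a"
      and M: "\<forall>m x. ennreal (2 ^ (m * ?D)) * emeasure (density lborel (\<lambda>x. ennreal (u x))) (ball x ((1 / 2) ^ Suc m)) \<le> U x"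
      and n: "n > 0" and E [measurable]: "E \<in> sets borel"
    for u :: "'a \<Rightarrow> real" and U and a :: real and n :: nat and E
  proof -
    note um [measurable] = borel_measurable_integrable[OF u(1), simplified]
    let ?\<mu> = "density lborel (\<lambda>x. ennreal (u x))"
    define \<Lambda> where "\<Lambda> i = (4 ^ ?D * a) * 2 ^ i" for i :: nat
    define W where "W l = {x. \<exists>m::nat. ennreal l < ennreal (2 ^ (m * ?D)) * emeasure ?\<mu> (ball x ((1 / 2) ^ Suc m))}" for l
    have ball_meas: "(\<lambda>x. emeasure ?\<mu> (ball x r)) \<in> borel_measurable borel" for r
    proof -
      have "(\<lambda>x. \<integral>\<^sup>+y. ennreal (u y) * indicator {z::'a\<times>'a. dist (fst z) (snd z) < r} (x, y) \<partial>lborel) \<in> borel_measurable borel"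
        by measurable
      moreover have "emeasure ?\<mu> (ball x r) = (\<integral>\<^sup>+y. ennreal (u y) * indicator {z::'a\<times>'a. dist (fst z) (snd z) < r} (x, y) \<partial>lborel)" for x
        by (subst emeasure_density) (auto intro!: nn_integral_cong simp: indicator_def)
      ultimately show ?thesis by simp
    qed
    have Wm [measurable]: "W l \<in> sets borel" for l
    proof -
      have "W l = (\<Union>m. {x\<in>space borel. ennreal l < ennreal (2 ^ (m * ?D)) * emeasure ?\<mu> (ball x ((1 / 2) ^ Suc m))})"
        by (auto simp: W_def)
      also have "\<dots> \<in> sets borel"
        by (intro sets.countable_UN'' borel_measurable_less borel_measurable_const borel_measurable_times_ennreal ball_meas) auto
      finally show ?thesis .
    qed
    have "\<Lambda> i \<ge> 4 ^ ?D * a" for i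
      unfolding \<Lambda>_def using a mult_left_mono[of 1 "2 ^ i" "4 ^ ?D * a"] by simp
    then have lev: "emeasure ?\<mu> (W (\<Lambda> i)) \<le> ennreal K1 * (ennreal (\<Lambda> i) * emeasure lborel {x. ennreal (\<Lambda> i) < ennreal (2 ^ ?D) * U x})" for i
      unfolding W_def K1_def by (intro level_set_mass_le[OF um U a ua]) (use M in auto)
    have mono: "emeasure ?\<mu> (W (\<Lambda> n)) \<le> emeasure ?\<mu> (W (\<Lambda> i))" if "i < n" for i
    proof (rule emeasure_mono)
      have "\<Lambda> i \<le> \<Lambda> n" unfolding \<Lambda>_def using a that by (intro mult_left_mono power_increasing) auto
      then show "W (\<Lambda> n) \<subseteq> W (\<Lambda> i)" unfolding W_def using ennreal_leI order_le_less_trans by blast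
    qed simp
    have "ennreal n * emeasure ?\<mu> (W (\<Lambda> n)) = (\<Sum>i<n. emeasure ?\<mu> (W (\<Lambda> n)))"
      by (simp add: ennreal_of_nat_eq_real_of_nat)
    also have "\<dots> \<le> (\<Sum>i<n. ennreal K1 * (ennreal (\<Lambda> i) * emeasure lborel {x. ennreal (\<Lambda> i) < ennreal (2 ^ ?D) * U x}))"
      by (intro sum_mono order_trans[OF mono lev]) auto
    also have "\<dots> = ennreal K1 * (\<integral>\<^sup>+x. (\<Sum>i<n. ennreal (\<Lambda> i) * indicator {y. ennreal (\<Lambda> i) < y} (ennreal (2 ^ ?D) * U x)) \<partial>lborel)"
    proof -
      have "ennreal (\<Lambda> i) * emeasure lborel {x. ennreal (\<Lambda> i) < ennreal (2 ^ ?D) * U x}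
          = (\<integral>\<^sup>+x. ennreal (\<Lambda> i) * indicator {y. ennreal (\<Lambda> i) < y} (ennreal (2 ^ ?D) * U x) \<partial>lborel)" for i
      proof -
        have "(\<integral>\<^sup>+x. ennreal (\<Lambda> i) * indicator {y. ennreal (\<Lambda> i) < y} (ennreal (2 ^ ?D) * U x) \<partial>lborel)
            = (\<integral>\<^sup>+x. ennreal (\<Lambda> i) * indicator {x. ennreal (\<Lambda> i) < ennreal (2 ^ ?D) * U x} x \<partial>lborel)"
          by (intro nn_integral_cong) (auto simp: indicator_def)
        then show ?thesis by (simp add: nn_integral_cmult_indicator)
      qed
      then show ?thesis
        by (subst nn_integral_sum) (auto simp: sum_distrib_left)
    qed
    also have "\<dots> \<le> ennreal K1 * (\<integral>\<^sup>+x. 2 * (ennreal (2 ^ ?D) * U x) \<partial>lborel)"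
      unfolding \<Lambda>_def using a by (intro mult_left_mono nn_integral_mono sum_dyadic_levels_le) auto
    also have "\<dots> = ennreal (K1 * (2 * 2 ^ ?D)) * (\<integral>\<^sup>+x. U x \<partial>lborel)"
      using K1 by (simp add: nn_integral_cmult ennreal_mult mult.assoc)
    also have "\<dots> \<le> ennreal K * ennreal a"
      using K by (intro mult_mono Ua ennreal_leI) auto
    finally have nW: "ennreal n * emeasure ?\<mu> (W (\<Lambda> n)) \<le> ennreal (K * a)"
      using K a by (simp add: ennreal_mult)
    have "ennreal (1 / n) * (ennreal n * emeasure ?\<mu> (W (\<Lambda> n))) \<le> ennreal (1 / n) * ennreal (K * a)"
      using nW by (rule mult_left_mono) simp
    then have W: "emeasure ?\<mu> (W (\<Lambda> n)) \<le> ennreal (K / n * a)"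
      using n K a by (simp add: ennreal_mult[symmetric] mult.assoc[symmetric])
    have "AE x in lborel. x \<notin> W (\<Lambda> n) \<longrightarrow> u x \<le> (4 * ?D) ^ ?D * \<Lambda> n"
      using AE_le_of_ball_averages[where u=u and l="\<Lambda> n", OF u(1)] u(2) a unfolding W_def \<Lambda>_def
      by (auto simp: not_less elim!: eventually_mono)
    then have "AE x in lborel. ennreal (u x) * indicator E x
        \<le> ennreal (u x) * indicator (W (\<Lambda> n)) x + ennreal (K * 2 ^ n * a) * indicator E x"
    proof (eventually_elim)
      case (elim x)
      have "(4 * ?D) ^ ?D * \<Lambda> n \<le> K * 2 ^ n * a"
        using K(3) a by (simp add: \<Lambda>_def mult_ac)
      then show ?case using elim by (auto simp: indicator_def ennreal_leI)
    qed
    then have "(\<integral>\<^sup>+x\<in>E. ennreal (u x) \<partial>lborel)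
        \<le> (\<integral>\<^sup>+x. ennreal (u x) * indicator (W (\<Lambda> n)) x + ennreal (K * 2 ^ n * a) * indicator E x \<partial>lborel)"
      by (rule nn_integral_mono_AE)
    also have "\<dots> = emeasure ?\<mu> (W (\<Lambda> n)) + ennreal (K * 2 ^ n * a) * emeasure lborel E"
      by (subst nn_integral_add) (auto simp: emeasure_density nn_integral_cmult_indicator)
    also have "\<dots> \<le> ennreal (K / n * a) + ennreal (K * 2 ^ n * a) * emeasure lborel E"
      by (intro add_right_mono W)
    finally show ?thesis .
  qed
  then show ?thesis using K(1) by blast
qed

section \<open>Nonnegative functions of bounded oscillation norm\<close>

lemma integrable_conv_integrand:
  fixes a b :: "'a::euclidean_space \<Rightarrow> complex"
  assumes a: "test_function a" and b: "integrable lborel b"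
  shows "integrable lborel (\<lambda>y. a (x - y) * b y)"
proof -
  note [measurable] = test_function_measurable[OF a] borel_measurable_integrable[OF b, simplified]
  obtain B where B: "\<And>x. norm (a x) \<le> B" using a by (metis test_function_bounded)
  show ?thesis
  proof (rule Bochner_Integration.integrable_bound)
    show "integrable lborel (\<lambda>y. B *\<^sub>R b y)" by (intro integrable_scaleR_right b)
    show "AE y in lborel. norm (a (x - y) * b y) \<le> norm (B *\<^sub>R b y)"
    proof (rule AE_I2)
      fix y
      have "norm (a (x - y)) \<le> \<bar>B\<bar>" using B[of "x - y"] by linarith
      then show "norm (a (x - y) * b y) \<le> norm (B *\<^sub>R b y)" by (simp add: norm_mult mult_right_mono)
    qed
  qed measurable
qed

lemma conv_dyadic_telescope:
  fixes G u :: "'a::euclidean_space \<Rightarrow> complex"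
  assumes G: "test_function G" and u: "integrable lborel u"
  shows "conv (dil (2 ^ m) G) u x = conv G u x + (\<Sum>l<m. conv (dil (2 ^ l) (\<lambda>x. dil 2 G x - G x)) u x)"
proof (induction m)
  case 0
  then show ?case by (simp add: dil_def conv_def)
next
  case (Suc m)
  have "conv (dil (2 ^ m) (\<lambda>x. dil 2 G x - G x)) u x = conv (dil (2 ^ Suc m) G) u x - conv (dil (2 ^ m) G) u x"
    unfolding dil_diff dil_dil conv_def left_diff_distrib
    by (subst Bochner_Integration.integral_diff)
       (auto intro!: integrable_conv_integrand test_function_dil G u simp: mult.commute[of "2 ^ m" 2])
  with Suc show ?case by simp
qed

text \<open>Positivity enters here.  As \<open>\<psi> \<ge> 0\<close> equals \<open>1\<close> on the ball of radius \<open>1/2\<close>, the mass of \<open>u \<ge> 0\<close> near \<open>x\<close>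
  at scale \<open>2\<^sup>-\<^sup>m\<close> is at most the convolution of \<open>u\<close> with the dilated bump, and this telescopes into the
  terms of \<open>osc_norm\<close>, whose sum is the majorant \<open>U\<close> of all averages.  For the same reason the total mass
  of \<open>u\<close> is a multiple of the first term.\<close>

lemma osc_norm_equi_integrable:
  fixes \<psi> :: "'a::euclidean_space \<Rightarrow> real"
  defines "q \<equiv> \<lambda>x. complex_of_real (\<psi> x)"
  assumes q: "test_function q" and nonneg: "\<And>x. 0 \<le> \<psi> x" and one: "\<And>x. norm x < 1 / 2 \<Longrightarrow> \<psi> x = 1"
  shows "\<exists>K>0. \<forall>u. integrable lborel u \<longrightarrow> (\<forall>x. 0 \<le> u x) \<longrightarrow>
    (\<integral>\<^sup>+x. ennreal (u x) \<partial>lborel) \<le> ennreal K * osc_norm q (\<lambda>x. complex_of_real (u x)) \<and>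
    (\<forall>n E. n > 0 \<longrightarrow> E \<in> sets borel \<longrightarrow> (\<integral>\<^sup>+x\<in>E. ennreal (u x) \<partial>lborel)
       \<le> (ennreal (K / real n) + ennreal (K * 2 ^ n) * emeasure lborel E) * osc_norm q (\<lambda>x. complex_of_real (u x)))"
proof -
  note [measurable] = test_function_measurable[OF q]
  have psi_meas [measurable]: "\<psi> \<in> borel_measurable borel"
  proof -
    have "(\<lambda>x. Re (q x)) \<in> borel_measurable borel" by measurable
    then show ?thesis by (simp add: q_def)
  qed
  obtain K0 where K0: "K0 > 0" and M: "\<And>(u::'a\<Rightarrow>real) U (a::real) (n::nat) E.
     integrable lborel u \<Longrightarrow> (\<forall>x. 0 \<le> u x) \<Longrightarrow> U \<in> borel_measurable borel \<Longrightarrow> a > 0 \<Longrightarrow>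
     (\<integral>\<^sup>+x. ennreal (u x) \<partial>lborel) \<le> ennreal a \<Longrightarrow> (\<integral>\<^sup>+x. U x \<partial>lborel) \<le> ennreal a \<Longrightarrow>
     (\<forall>m x. ennreal (2 ^ (m * DIM('a))) * emeasure (density lborel (\<lambda>x. ennreal (u x))) (ball x ((1 / 2) ^ Suc m)) \<le> U x) \<Longrightarrow>
     n > 0 \<Longrightarrow> E \<in> sets borel \<Longrightarrow>
     (\<integral>\<^sup>+x\<in>E. ennreal (u x) \<partial>lborel) \<le> ennreal (K0 / n * a) + ennreal (K0 * 2 ^ n * a) * emeasure lborel E"
    using maximal_equi_integrable[where 'a='a] by blast
  define I where "I = (LINT x|lborel. \<psi> x)"
  have int_psi: "integrable lborel \<psi>"
    using test_function_integrable[OF q] by (simp add: q_def complex_of_real_integrable_eq)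
  have I: "I > 0"
  proof -
    have "emeasure lborel (ball (0::'a) (1 / 2)) \<le> (\<integral>\<^sup>+x. ennreal (\<psi> x) \<partial>lborel)"
    proof -
      have "(\<integral>\<^sup>+x. indicator (ball (0::'a) (1 / 2)) x \<partial>lborel) \<le> (\<integral>\<^sup>+x. ennreal (\<psi> x) \<partial>lborel)"
        using one by (intro nn_integral_mono) (auto simp: indicator_def)
      then show ?thesis by simp
    qed
    also have "\<dots> = ennreal I" unfolding I_def using int_psi nonneg by (simp add: nn_integral_eq_integral)
    finally have "emeasure lborel (ball (0::'a) (1 / 2)) \<le> ennreal I" .
    moreover have "emeasure lborel (ball (0::'a) (1 / 2)) > 0"
      using unit_ball_vol_pos[of "real DIM('a)"] by (simp add: emeasure_ball)
    ultimately show ?thesis by (metis ennreal_less_zero_iff order_less_le_trans)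
  qed
  define B where "B = max 1 (1 / I)"
  have B: "B \<ge> 1" "1 / I \<le> B" "B > 0" by (auto simp: B_def)
  have conv_nn: "ennreal (norm (conv (\<lambda>x. complex_of_real (P x)) (\<lambda>x. complex_of_real (u x)) x)) = (\<integral>\<^sup>+y. ennreal (P (x - y) * u y) \<partial>lborel)"
    if P: "test_function (\<lambda>x. complex_of_real (P x))" "\<And>x. 0 \<le> P x" and u: "integrable lborel u" "\<And>x. 0 \<le> u x"
    for P u :: "'a \<Rightarrow> real" and x
  proof -
    have "integrable lborel (\<lambda>y. complex_of_real (P (x - y) * u y))"
      using integrable_conv_integrand[OF P(1), of "\<lambda>y. complex_of_real (u y)" x] u(1) by (simp add: integrable_of_real)
    then have i: "integrable lborel (\<lambda>y. P (x - y) * u y)" by (simp only: complex_of_real_integrable_eq)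
    have "conv (\<lambda>x. complex_of_real (P x)) (\<lambda>x. complex_of_real (u x)) x = complex_of_real (LINT y|lborel. P (x - y) * u y)"
      unfolding conv_def by (simp only: of_real_mult[symmetric] integral_complex_of_real)
    moreover have "0 \<le> (LINT y|lborel. P (x - y) * u y)" using P u by (intro integral_nonneg_AE AE_I2) auto
    ultimately show ?thesis using i P u by (simp add: nn_integral_eq_integral del: of_real_mult)
  qed
  define K where "K = B * (K0 + 1)"
  have K: "K > 0" unfolding K_def using B K0 by (intro mult_pos_pos) auto
  have BK: "B \<le> K" "K0 * B \<le> K" using B K0 by (auto simp: K_def algebra_simps)
  have "(\<integral>\<^sup>+x. ennreal (u x) \<partial>lborel) \<le> ennreal K * osc_norm q (\<lambda>x. complex_of_real (u x)) \<and>
    (\<forall>n E. n > 0 \<longrightarrow> E \<in> sets borel \<longrightarrow> (\<integral>\<^sup>+x\<in>E. ennreal (u x) \<partial>lborel)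
       \<le> (ennreal (K / real n) + ennreal (K * 2 ^ n) * emeasure lborel E) * osc_norm q (\<lambda>x. complex_of_real (u x)))"
    if u: "integrable lborel u" "\<forall>x. 0 \<le> u x" for u
  proof -
    note [measurable] = borel_measurable_integrable[OF u(1), simplified]
    define c where "c = (\<lambda>x. complex_of_real (u x))"
    have ci: "integrable lborel c" using u(1) by (simp add: c_def integrable_of_real)
    note [measurable] = borel_measurable_integrable[OF ci, simplified]
    define N where "N = (\<lambda>x. dil 2 q x - q x)"
    define U where "U x = ennreal (norm (conv q c x)) + (\<Sum>m. ennreal (norm (conv (dil (2 ^ m) N) c x)))" for x
    have [measurable]: "N \<in> borel_measurable borel" unfolding N_def by measurable
    have U_meas [measurable]: "U \<in> borel_measurable borel" unfolding U_def[abs_def] by measurable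
    have UO: "(\<integral>\<^sup>+x. U x \<partial>lborel) = osc_norm q c"
      unfolding U_def osc_norm_def N_def[symmetric] by (simp add: nn_integral_add nn_integral_suminf)
    have mass: "(\<integral>\<^sup>+x. ennreal (u x) \<partial>lborel) \<le> ennreal B * osc_norm q c"
    proof -
      have "L1norm (conv q c) = (\<integral>\<^sup>+x. \<integral>\<^sup>+y. ennreal (\<psi> (x - y) * u y) \<partial>lborel \<partial>lborel)"
        unfolding q_def c_def using q u nonneg by (subst conv_nn) (auto simp: q_def)
      also have "\<dots> = (\<integral>\<^sup>+y. \<integral>\<^sup>+x. ennreal (\<psi> (x - y) * u y) \<partial>lborel \<partial>lborel)"
        by (rule lborel_pair.Fubini') measurable
      also have "\<dots> = (\<integral>\<^sup>+y. ennreal I * ennreal (u y) \<partial>lborel)"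
      proof (rule nn_integral_cong)
        fix y
        have "(\<integral>\<^sup>+x. ennreal (\<psi> (x - y) * u y) \<partial>lborel) = (\<integral>\<^sup>+x. ennreal (\<psi> (x - y)) \<partial>lborel) * ennreal (u y)"
          using u nonneg by (simp add: ennreal_mult nn_integral_multc)
        also have "(\<integral>\<^sup>+x. ennreal (\<psi> (x - y)) \<partial>lborel) = ennreal I"
          using nn_integral_lborel_shift[of "\<lambda>x. ennreal (\<psi> x)" y] int_psi nonneg by (simp add: nn_integral_eq_integral I_def)
        finally show "(\<integral>\<^sup>+x. ennreal (\<psi> (x - y) * u y) \<partial>lborel) = ennreal I * ennreal (u y)" .
      qed
      also have "\<dots> = ennreal I * (\<integral>\<^sup>+y. ennreal (u y) \<partial>lborel)" by (rule nn_integral_cmult) measurable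
      finally have "ennreal I * (\<integral>\<^sup>+y. ennreal (u y) \<partial>lborel) \<le> osc_norm q c"
        by (simp add: osc_norm_def)
      then have "ennreal (1 / I) * (ennreal I * (\<integral>\<^sup>+y. ennreal (u y) \<partial>lborel)) \<le> ennreal (1 / I) * osc_norm q c"
        by (rule mult_left_mono) simp
      also have "\<dots> \<le> ennreal B * osc_norm q c" using B by (intro mult_right_mono ennreal_leI) auto
      finally show ?thesis using I by (simp add: mult.assoc[symmetric] ennreal_mult[symmetric])
    qed
    have [measurable]: "ball x r \<in> sets borel" for x :: 'a and r by simp
    have avg: "ennreal (2 ^ (m * DIM('a))) * emeasure (density lborel (\<lambda>x. ennreal (u x))) (ball x ((1 / 2) ^ Suc m)) \<le> U x" for m x
    proof -
      define P where "P z = 2 ^ (m * DIM('a)) * \<psi> (2 ^ m *\<^sub>R z)" for z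
      have Pq: "(\<lambda>x. complex_of_real (P x)) = dil (2 ^ m) q"
        by (simp add: P_def dil_def q_def fun_eq_iff power_mult)
      have P: "test_function (\<lambda>x. complex_of_real (P x))" "0 \<le> P x" for x
        unfolding Pq using nonneg by (auto intro: test_function_dil q simp: P_def)
      have "ennreal (2 ^ (m * DIM('a))) * emeasure (density lborel (\<lambda>x. ennreal (u x))) (ball x ((1 / 2) ^ Suc m))
          = (\<integral>\<^sup>+y. ennreal (2 ^ (m * DIM('a))) * (ennreal (u y) * indicator (ball x ((1 / 2) ^ Suc m)) y) \<partial>lborel)"
        by (subst nn_integral_cmult) (auto simp: emeasure_density)
      also have "\<dots> \<le> (\<integral>\<^sup>+y. ennreal (P (x - y) * u y) \<partial>lborel)"
      proof (rule nn_integral_mono)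
        fix y
        show "ennreal (2 ^ (m * DIM('a))) * (ennreal (u y) * indicator (ball x ((1 / 2) ^ Suc m)) y) \<le> ennreal (P (x - y) * u y)"
        proof (cases "y \<in> ball x ((1 / 2) ^ Suc m)")
          case True
          then have "norm (x - y) < (1 / 2) ^ Suc m" by (simp add: dist_norm)
          then have "norm (2 ^ m *\<^sub>R (x - y)) < 1 / 2" unfolding norm_scaleR by (simp add: power_one_over field_simps)
          then have "P (x - y) = 2 ^ (m * DIM('a))" unfolding P_def using one by simp
          then show ?thesis using True u by (simp add: ennreal_mult)
        qed simp
      qed
      also have "\<dots> = ennreal (norm (conv (dil (2 ^ m) q) c x))"
        unfolding Pq[symmetric] c_def using u P by (subst conv_nn) auto
      also have "\<dots> \<le> ennreal (norm (conv q c x) + (\<Sum>l<m. norm (conv (dil (2 ^ l) N) c x)))"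
        unfolding conv_dyadic_telescope[OF q ci] N_def[symmetric]
        by (intro ennreal_leI norm_triangle_le add_left_mono norm_sum)
      also have "\<dots> = ennreal (norm (conv q c x)) + (\<Sum>l<m. ennreal (norm (conv (dil (2 ^ l) N) c x)))"
        by (subst ennreal_plus) (auto simp: sum_nonneg sum_ennreal)
      also have "\<dots> \<le> U x" unfolding U_def by (intro add_left_mono sum_le_suminf) auto
      finally show ?thesis .
    qed
    have main: "(\<integral>\<^sup>+x\<in>E. ennreal (u x) \<partial>lborel)
       \<le> (ennreal (K / real n) + ennreal (K * 2 ^ n) * emeasure lborel E) * osc_norm q c"
      if n: "n > 0" and E [measurable]: "E \<in> sets borel" for n :: nat and E
    proof (cases "osc_norm q c = \<infinity>")
      case True
      have "ennreal (K / real n) > 0" using n K by (simp add: ennreal_zero_less_divide)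
      then have "ennreal (K / real n) + ennreal (K * 2 ^ n) * emeasure lborel E \<noteq> 0" using n K by simp
      then have "(ennreal (K / real n) + ennreal (K * 2 ^ n) * emeasure lborel E) * osc_norm q c = \<infinity>"
        unfolding True by (simp only: ennreal_mult_eq_top_iff infinity_ennreal_def) simp
      then show ?thesis by simp
    next
      case False
      then obtain A where A: "A \<ge> 0" "osc_norm q c = ennreal A" by (cases "osc_norm q c") auto
      show ?thesis
      proof (cases "A = 0")
        case True
        have "(\<integral>\<^sup>+x\<in>E. ennreal (u x) \<partial>lborel) \<le> (\<integral>\<^sup>+x. ennreal (u x) \<partial>lborel)"
          by (intro nn_integral_mono) (auto simp: indicator_def)
        also have "\<dots> \<le> 0" using mass A True by simp
        finally show ?thesis by simp
      next
        case False
        then have BA: "B * A > 0" using A B by simp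
        have "(\<integral>\<^sup>+x\<in>E. ennreal (u x) \<partial>lborel) \<le> ennreal (K0 / n * (B * A)) + ennreal (K0 * 2 ^ n * (B * A)) * emeasure lborel E"
        proof (rule M[OF u U_meas BA _ _ _ n E])
          show "(\<integral>\<^sup>+x. ennreal (u x) \<partial>lborel) \<le> ennreal (B * A)" using mass A B by (simp add: ennreal_mult)
          have "(\<integral>\<^sup>+x. U x \<partial>lborel) = ennreal A" using UO A by simp
          also have "\<dots> \<le> ennreal (B * A)" using A B mult_right_mono[of 1 B A] by (intro ennreal_leI) simp
          finally show "(\<integral>\<^sup>+x. U x \<partial>lborel) \<le> ennreal (B * A)" .
        qed (use avg in blast)
        also have "\<dots> \<le> ennreal (K / n * A) + ennreal (K * 2 ^ n * A) * emeasure lborel E"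
        proof (intro add_mono mult_right_mono ennreal_leI)
          have KA: "K0 * B * A \<le> K * A" using BK A by (intro mult_right_mono) auto
          show "K0 / n * (B * A) \<le> K / n * A" using KA n by (simp add: field_simps)
          show "K0 * 2 ^ n * (B * A) \<le> K * 2 ^ n * A"
            using mult_right_mono[OF KA, of "2 ^ n"] by (simp add: mult_ac)
        qed simp
        also have "\<dots> = (ennreal (K / real n) + ennreal (K * 2 ^ n) * emeasure lborel E) * osc_norm q c"
        proof -
          have "ennreal (K / n * A) = ennreal (K / n) * ennreal A" "ennreal (K * 2 ^ n * A) = ennreal (K * 2 ^ n) * ennreal A"
            by (rule ennreal_mult; use A K n in simp)+
          then show ?thesis unfolding A(2) by (simp only: distrib_right distrib_left mult_ac)
        qed
        finally show ?thesis .
      qed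
    qed
    have "(\<integral>\<^sup>+x. ennreal (u x) \<partial>lborel) \<le> ennreal K * osc_norm q c"
      using mass by (rule order_trans) (intro mult_right_mono ennreal_leI BK, simp)
    with main show ?thesis unfolding c_def by blast
  qed
  then show ?thesis using K unfolding q_def by blast
qed

section \<open>Decay of the Fourier transform of sheared products\<close>

lemma shear_fourier_measurable [measurable]:
  fixes P Q :: "real^'d \<Rightarrow> complex"
  assumes [measurable]: "P \<in> borel_measurable borel" "Q \<in> borel_measurable borel"
    and [measurable]: "a \<in> borel_measurable M" "b \<in> borel_measurable M" "c \<in> borel_measurable M"
  shows "(\<lambda>x. fourier (\<lambda>w. P (a x - b x *\<^sub>R w) * Q w) (c x)) \<in> borel_measurable M"
proof -
  have "(\<lambda>x. LINT w|lborel. wave (- c x) w * (P (a x - b x *\<^sub>R w) * Q w)) \<in> borel_measurable M"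
    by measurable
  also have "(\<lambda>x. LINT w|lborel. wave (- c x) w * (P (a x - b x *\<^sub>R w) * Q w)) = (\<lambda>x. fourier (\<lambda>w. P (a x - b x *\<^sub>R w) * Q w) (c x))"
    by (intro ext fourier_lborel[symmetric]) measurable
  finally show ?thesis .
qed

lemma fourier_shear_deriv:
  fixes P Q :: "real^'d \<Rightarrow> complex"
  assumes P: "test_function P" and Q: "test_function Q" and b: "b \<in> Basis"
  shows "\<i> * complex_of_real (\<xi> \<bullet> b) * fourier (\<lambda>w. P (z - \<tau> *\<^sub>R w) * Q w) \<xi>
    = fourier (\<lambda>w. P (z - \<tau> *\<^sub>R w) * frechet_derivative Q (at w) b) \<xi>
      - complex_of_real \<tau> * fourier (\<lambda>w. frechet_derivative P (at (z - \<tau> *\<^sub>R w)) b * Q w) \<xi>"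
proof -
  let ?P' = "\<lambda>x. frechet_derivative P (at x) b" and ?Q' = "\<lambda>x. frechet_derivative Q (at x) b"
  have P': "test_function ?P'" and Q': "test_function ?Q'" using P Q b by (auto intro: test_function_deriv)
  note t1 = test_function_shear_section[OF P Q, of z \<tau>] and t2 = test_function_shear_section[OF P Q', of z \<tau>]
    and t3 = test_function_shear_section[OF P' Q, of z \<tau>]
  note [measurable] = test_function_measurable[OF P] test_function_measurable[OF Q]
    test_function_measurable[OF P'] test_function_measurable[OF Q']
  have d: "frechet_derivative (\<lambda>w. P (z - \<tau> *\<^sub>R w) * Q w) (at w) b
      = P (z - \<tau> *\<^sub>R w) * ?Q' w - complex_of_real \<tau> * (?P' (z - \<tau> *\<^sub>R w) * Q w)" for w
  proof -
    have "((\<lambda>w. z - \<tau> *\<^sub>R w) has_derivative (\<lambda>h. - (\<tau> *\<^sub>R h))) (at w)" by (auto intro!: derivative_eq_intros)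
    from has_derivative_compose[OF this test_function_has_derivative[OF P]]
    have "((\<lambda>w. P (z - \<tau> *\<^sub>R w)) has_derivative (\<lambda>h. frechet_derivative P (at (z - \<tau> *\<^sub>R w)) (- (\<tau> *\<^sub>R h)))) (at w)" .
    from has_derivative_mult[OF this test_function_has_derivative[OF Q]]
    have "frechet_derivative (\<lambda>w. P (z - \<tau> *\<^sub>R w) * Q w) (at w) =
      (\<lambda>h. P (z - \<tau> *\<^sub>R w) * frechet_derivative Q (at w) h + frechet_derivative P (at (z - \<tau> *\<^sub>R w)) (- (\<tau> *\<^sub>R h)) * Q w)"
      by (rule frechet_derivative_at[symmetric])
    moreover have "linear (frechet_derivative P (at (z - \<tau> *\<^sub>R w)))"
      using test_function_has_derivative[OF P] has_derivative_linear by blast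
    ultimately show ?thesis by (simp add: linear_neg linear_scale scaleR_conv_of_real[where 'a=complex] mult.assoc)
  qed
  have "\<i> * complex_of_real (\<xi> \<bullet> b) * fourier (\<lambda>w. P (z - \<tau> *\<^sub>R w) * Q w) \<xi>
      = fourier (\<lambda>w. P (z - \<tau> *\<^sub>R w) * ?Q' w - complex_of_real \<tau> * (?P' (z - \<tau> *\<^sub>R w) * Q w)) \<xi>"
    using fourier_deriv[OF t1 b, of \<xi>] unfolding d by simp
  also have "\<dots> = (LINT w|lborel. wave (-\<xi>) w * (P (z - \<tau> *\<^sub>R w) * ?Q' w) - complex_of_real \<tau> * (wave (-\<xi>) w * (?P' (z - \<tau> *\<^sub>R w) * Q w)))"
    by (subst fourier_lborel, measurable) (simp add: algebra_simps)
  also have "\<dots> = fourier (\<lambda>w. P (z - \<tau> *\<^sub>R w) * ?Q' w) \<xi> - complex_of_real \<tau> * fourier (\<lambda>w. ?P' (z - \<tau> *\<^sub>R w) * Q w) \<xi>"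
    by (subst Bochner_Integration.integral_diff[OF integrable_wave_mult[OF test_function_integrable[OF t2]]
          integrable_mult_right[OF integrable_wave_mult[OF test_function_integrable[OF t3]]]])
       (simp add: fourier_lborel)
  finally show ?thesis .
qed

text \<open>The induction of \<open>fourier_decay\<close>, made uniform in the shear: a derivative that hits the sheared factor
  costs \<open>\<tau> \<le> T\<close>.  The norm is integrated in \<open>z\<close>, so that translations of \<open>P\<close> cost nothing.\<close>

lemma fourier_shear_decay:
  fixes P Q :: "real^'d \<Rightarrow> complex"
  assumes "test_function P" "test_function Q"
  shows "\<exists>C\<ge>0. \<forall>T \<tau> \<xi>. 1 \<le> T \<longrightarrow> 0 \<le> \<tau> \<longrightarrow> \<tau> \<le> T \<longrightarrow>
    ennreal ((1 + norm \<xi>) ^ k) * (\<integral>\<^sup>+z. norm (fourier (\<lambda>w. P (z - \<tau> *\<^sub>R w) * Q w) \<xi>) \<partial>lborel) \<le> ennreal (C * T ^ k)"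
  using assms
proof (induction k arbitrary: P Q)
  case 0
  note [measurable] = test_function_measurable[OF 0(1)] test_function_measurable[OF 0(2)]
  let ?C = "(LINT x|lborel. norm (P x)) * (LINT x|lborel. norm (Q x))"
  have "(\<integral>\<^sup>+z. norm (fourier (\<lambda>w. P (z - \<tau> *\<^sub>R w) * Q w) \<xi>) \<partial>lborel) \<le> ennreal ?C" for \<tau> \<xi>
  proof -
    have "(\<integral>\<^sup>+z. norm (fourier (\<lambda>w. P (z - \<tau> *\<^sub>R w) * Q w) \<xi>) \<partial>lborel)
        \<le> (\<integral>\<^sup>+z. \<integral>\<^sup>+w. norm (wave (-\<xi>) w * (P (z - \<tau> *\<^sub>R w) * Q w)) \<partial>lborel \<partial>lborel)"
      by (intro nn_integral_mono) (subst fourier_lborel, measurable, rule norm_integral_le_nn_integral)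
    also have "\<dots> = (\<integral>\<^sup>+w. \<integral>\<^sup>+z. norm (wave (-\<xi>) w * (P (z - \<tau> *\<^sub>R w) * Q w)) \<partial>lborel \<partial>lborel)"
      by (rule lborel_pair.Fubini') measurable
    also have "\<dots> = (\<integral>\<^sup>+w. L1norm P * norm (Q w) \<partial>lborel)"
      by (simp add: norm_mult ennreal_mult nn_integral_multc nn_integral_lborel_shift[of "\<lambda>x. ennreal (norm (P x))"])
    also have "\<dots> = L1norm P * L1norm Q"
      by (rule nn_integral_cmult) measurable
    also have "\<dots> = ennreal ?C"
      using nn_integral_eq_integral[OF integrable_norm[OF test_function_integrable[OF 0(1)]]]
        nn_integral_eq_integral[OF integrable_norm[OF test_function_integrable[OF 0(2)]]]
      by (simp add: ennreal_mult)
    finally show ?thesis .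
  qed
  moreover have "?C \<ge> 0" by simp
  ultimately show ?case by (intro exI[of _ ?C]) auto
next
  case (Suc k)
  note P = Suc.prems(1) and Q = Suc.prems(2)
  let ?J = "\<lambda>P Q \<tau> \<xi>. (\<integral>\<^sup>+z. norm (fourier (\<lambda>w. P (z - \<tau> *\<^sub>R w) * Q w) \<xi>) \<partial>lborel)"
  let ?D = "\<lambda>P b x. frechet_derivative P (at x) b"
  obtain C0 where C0: "C0 \<ge> 0" "\<And>T \<tau> \<xi>. 1 \<le> T \<Longrightarrow> 0 \<le> \<tau> \<Longrightarrow> \<tau> \<le> T \<Longrightarrow> ennreal ((1 + norm \<xi>) ^ k) * ?J P Q \<tau> \<xi> \<le> ennreal (C0 * T ^ k)"
    using Suc.IH[OF P Q] by blast
  have "\<forall>b\<in>Basis. \<exists>C\<ge>0. \<forall>T \<tau> \<xi>. 1 \<le> T \<longrightarrow> 0 \<le> \<tau> \<longrightarrow> \<tau> \<le> T \<longrightarrow> ennreal ((1 + norm \<xi>) ^ k) * ?J P (?D Q b) \<tau> \<xi> \<le> ennreal (C * T ^ k)"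
    using Suc.IH[OF P test_function_deriv[OF Q]] by blast
  from bchoice[OF this] obtain C1 where C1': "\<forall>b\<in>Basis. C1 b \<ge> 0 \<and> (\<forall>T \<tau> \<xi>. 1 \<le> T \<longrightarrow> 0 \<le> \<tau> \<longrightarrow> \<tau> \<le> T \<longrightarrow>
      ennreal ((1 + norm \<xi>) ^ k) * ?J P (?D Q b) \<tau> \<xi> \<le> ennreal (C1 b * T ^ k))"
    by (elim exE)
  have C1: "C1 b \<ge> 0" "1 \<le> T \<Longrightarrow> 0 \<le> \<tau> \<Longrightarrow> \<tau> \<le> T \<Longrightarrow> ennreal ((1 + norm \<xi>) ^ k) * ?J P (?D Q b) \<tau> \<xi> \<le> ennreal (C1 b * T ^ k)"
    if "b \<in> Basis" for b T \<tau> \<xi>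
    using conjunct1[OF bspec[OF C1' that]] conjunct2[OF bspec[OF C1' that], rule_format, of T \<tau> \<xi>] by simp_all
  have "\<forall>b\<in>Basis. \<exists>C\<ge>0. \<forall>T \<tau> \<xi>. 1 \<le> T \<longrightarrow> 0 \<le> \<tau> \<longrightarrow> \<tau> \<le> T \<longrightarrow> ennreal ((1 + norm \<xi>) ^ k) * ?J (?D P b) Q \<tau> \<xi> \<le> ennreal (C * T ^ k)"
    using Suc.IH[OF test_function_deriv[OF P] Q] by blast
  from bchoice[OF this] obtain C2 where C2': "\<forall>b\<in>Basis. C2 b \<ge> 0 \<and> (\<forall>T \<tau> \<xi>. 1 \<le> T \<longrightarrow> 0 \<le> \<tau> \<longrightarrow> \<tau> \<le> T \<longrightarrow>
      ennreal ((1 + norm \<xi>) ^ k) * ?J (?D P b) Q \<tau> \<xi> \<le> ennreal (C2 b * T ^ k))"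
    by (elim exE)
  have C2: "C2 b \<ge> 0" "1 \<le> T \<Longrightarrow> 0 \<le> \<tau> \<Longrightarrow> \<tau> \<le> T \<Longrightarrow> ennreal ((1 + norm \<xi>) ^ k) * ?J (?D P b) Q \<tau> \<xi> \<le> ennreal (C2 b * T ^ k)"
    if "b \<in> Basis" for b T \<tau> \<xi>
    using conjunct1[OF bspec[OF C2' that]] conjunct2[OF bspec[OF C2' that], rule_format, of T \<tau> \<xi>] by simp_all
  let ?C = "C0 + (\<Sum>b\<in>Basis. C1 b + C2 b)"
  have Cpos: "0 \<le> (\<Sum>b\<in>Basis. C1 b + C2 b)" using C1(1) C2(1) by (intro sum_nonneg) simp
  have "ennreal ((1 + norm \<xi>) ^ Suc k) * ?J P Q \<tau> \<xi> \<le> ennreal (?C * T ^ Suc k)"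
    if T: "1 \<le> T" and \<tau>: "0 \<le> \<tau>" "\<tau> \<le> T" for T \<tau> \<xi>
  proof -
    let ?w = "ennreal ((1 + norm \<xi>) ^ k)"
    note [measurable] = test_function_measurable[OF P] test_function_measurable[OF Q]
      test_function_measurable[OF test_function_deriv[OF P]] test_function_measurable[OF test_function_deriv[OF Q]]
    have TT: "T ^ k \<le> T ^ Suc k" using T by (intro power_increasing) auto
    have b: "?w * (ennreal \<bar>\<xi> \<bullet> b\<bar> * ?J P Q \<tau> \<xi>) \<le> ennreal ((C1 b + C2 b) * T ^ Suc k)" if b: "b \<in> Basis" for b
    proof -
      have "ennreal \<bar>\<xi> \<bullet> b\<bar> * ?J P Q \<tau> \<xi> = (\<integral>\<^sup>+z. ennreal \<bar>\<xi> \<bullet> b\<bar> * norm (fourier (\<lambda>w. P (z - \<tau> *\<^sub>R w) * Q w) \<xi>) \<partial>lborel)"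
        by (intro nn_integral_cmult[symmetric]) measurable
      also have "\<dots> \<le> (\<integral>\<^sup>+z. norm (fourier (\<lambda>w. P (z - \<tau> *\<^sub>R w) * ?D Q b w) \<xi>)
           + ennreal \<tau> * norm (fourier (\<lambda>w. ?D P b (z - \<tau> *\<^sub>R w) * Q w) \<xi>) \<partial>lborel)"
      proof (rule nn_integral_mono)
        fix z
        have "\<bar>\<xi> \<bullet> b\<bar> * norm (fourier (\<lambda>w. P (z - \<tau> *\<^sub>R w) * Q w) \<xi>)
            = norm (\<i> * complex_of_real (\<xi> \<bullet> b) * fourier (\<lambda>w. P (z - \<tau> *\<^sub>R w) * Q w) \<xi>)" by (simp add: norm_mult)
        also have "\<dots> \<le> norm (fourier (\<lambda>w. P (z - \<tau> *\<^sub>R w) * ?D Q b w) \<xi>) + \<tau> * norm (fourier (\<lambda>w. ?D P b (z - \<tau> *\<^sub>R w) * Q w) \<xi>)"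
          unfolding fourier_shear_deriv[OF P Q b] using \<tau>(1) by (intro order_trans[OF norm_triangle_ineq4]) (simp add: norm_mult)
        finally show "ennreal \<bar>\<xi> \<bullet> b\<bar> * norm (fourier (\<lambda>w. P (z - \<tau> *\<^sub>R w) * Q w) \<xi>)
            \<le> norm (fourier (\<lambda>w. P (z - \<tau> *\<^sub>R w) * ?D Q b w) \<xi>) + ennreal \<tau> * norm (fourier (\<lambda>w. ?D P b (z - \<tau> *\<^sub>R w) * Q w) \<xi>)"
          using \<tau>(1) by (simp add: ennreal_leI flip: ennreal_mult ennreal_plus)
      qed
      also have "\<dots> = ?J P (?D Q b) \<tau> \<xi> + ennreal \<tau> * ?J (?D P b) Q \<tau> \<xi>"
        using b by (subst nn_integral_add) (auto simp: nn_integral_cmult)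
      finally have "?w * (ennreal \<bar>\<xi> \<bullet> b\<bar> * ?J P Q \<tau> \<xi>) \<le> ?w * (?J P (?D Q b) \<tau> \<xi> + ennreal \<tau> * ?J (?D P b) Q \<tau> \<xi>)"
        by (rule mult_left_mono) simp
      also have "\<dots> = ?w * ?J P (?D Q b) \<tau> \<xi> + ennreal \<tau> * (?w * ?J (?D P b) Q \<tau> \<xi>)"
        by (simp add: distrib_left mult_ac)
      also have "\<dots> \<le> ennreal (C1 b * T ^ Suc k) + ennreal T * ennreal (C2 b * T ^ k)"
        using C1(1)[OF b] TT by (intro add_mono mult_mono order_trans[OF C1(2)[OF b T \<tau>]] C2(2)[OF b T \<tau>] ennreal_leI \<tau>(2) mult_left_mono) auto
      also have "\<dots> = ennreal ((C1 b + C2 b) * T ^ Suc k)"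
        using C1(1)[OF b] C2(1)[OF b] T by (simp add: ennreal_plus[symmetric] ennreal_mult[symmetric] algebra_simps del: ennreal_plus)
      finally show ?thesis .
    qed
    have "ennreal ((1 + norm \<xi>) ^ Suc k) * ?J P Q \<tau> \<xi> = ?w * (ennreal (1 + norm \<xi>) * ?J P Q \<tau> \<xi>)"
      by (simp add: ennreal_mult mult_ac)
    also have "\<dots> \<le> ?w * ((ennreal 1 + (\<Sum>b\<in>Basis. ennreal \<bar>\<xi> \<bullet> b\<bar>)) * ?J P Q \<tau> \<xi>)"
    proof (intro mult_left_mono mult_right_mono)
      have "ennreal (1 + norm \<xi>) \<le> ennreal (1 + (\<Sum>b\<in>Basis. \<bar>\<xi> \<bullet> b\<bar>))"
        using norm_le_l1[of \<xi>] by (intro ennreal_leI) simp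
      then show "ennreal (1 + norm \<xi>) \<le> ennreal 1 + (\<Sum>b\<in>Basis. ennreal \<bar>\<xi> \<bullet> b\<bar>)"
        by (simp only: sum_ennreal abs_ge_zero ennreal_plus sum_nonneg zero_le_one)
    qed auto
    also have "\<dots> = ?w * ?J P Q \<tau> \<xi> + (\<Sum>b\<in>Basis. ?w * (ennreal \<bar>\<xi> \<bullet> b\<bar> * ?J P Q \<tau> \<xi>))"
      by (simp only: distrib_left distrib_right sum_distrib_left sum_distrib_right ennreal_1 mult_1)
    also have "\<dots> \<le> ennreal (C0 * T ^ Suc k) + (\<Sum>b\<in>Basis. ennreal ((C1 b + C2 b) * T ^ Suc k))"
      using TT C0(1) by (intro add_mono sum_mono b order_trans[OF C0(2)[OF T \<tau>]] ennreal_leI mult_left_mono) auto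
    also have "\<dots> = ennreal (?C * T ^ Suc k)"
    proof -
      have "(\<Sum>b\<in>Basis. ennreal ((C1 b + C2 b) * T ^ Suc k)) = ennreal ((\<Sum>b\<in>Basis. C1 b + C2 b) * T ^ Suc k)"
        unfolding sum_distrib_right using C1(1) C2(1) T by (intro sum_ennreal) auto
      then show ?thesis using C0(1) Cpos T
        by (subst distrib_right) (simp add: ennreal_plus)
    qed
    finally show ?thesis .
  qed
  then show ?case using C0(1) Cpos by (intro exI[of _ ?C]) auto
qed

lemma fst_borel_measurable [measurable]:
  "fst \<in> borel_measurable (borel :: ('a::second_countable_topology \<times> 'b::second_countable_topology) measure)"
  by (intro borel_measurable_continuous_onI continuous_intros)

lemma snd_borel_measurable [measurable]:
  "snd \<in> borel_measurable (borel :: ('a::second_countable_topology \<times> 'b::second_countable_topology) measure)"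
  by (intro borel_measurable_continuous_onI continuous_intros)

section \<open>The integrated transport equation\<close>

definition bessel_weight :: "real \<Rightarrow> real^'d \<Rightarrow> real" where
  "bessel_weight \<gamma> \<xi> = (1 + (norm \<xi>)\<^sup>2) powr (\<gamma> / 2)"

lemma bessel_weight_measurable [measurable]: "bessel_weight \<gamma> \<in> borel_measurable borel"
  unfolding bessel_weight_def[abs_def] by measurable

lemma bessel_weight_le: "bessel_weight \<gamma> \<xi> \<le> (1 + norm \<xi>) ^ nat \<lceil>\<bar>\<gamma>\<bar>\<rceil>"
proof -
  have "bessel_weight \<gamma> \<xi> \<le> (1 + (norm \<xi>)\<^sup>2) powr (\<bar>\<gamma>\<bar> / 2)"
    unfolding bessel_weight_def by (intro powr_mono) auto
  also have "\<dots> \<le> ((1 + norm \<xi>)\<^sup>2) powr (\<bar>\<gamma>\<bar> / 2)"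
    by (intro powr_mono2) (auto simp: power2_sum)
  also have "\<dots> = (1 + norm \<xi>) powr \<bar>\<gamma>\<bar>"
  proof -
    have p: "0 \<le> 1 + norm \<xi>" by simp
    show ?thesis unfolding powr_numeral[OF p, symmetric] powr_powr by simp
  qed
  also have "\<dots> \<le> (1 + norm \<xi>) powr real (nat \<lceil>\<bar>\<gamma>\<bar>\<rceil>)"
    by (intro powr_mono) auto
  also have "\<dots> = (1 + norm \<xi>) ^ nat \<lceil>\<bar>\<gamma>\<bar>\<rceil>"
    by (rule powr_realpow) (simp add: add_pos_nonneg)
  finally show ?thesis .
qed

text \<open>The right-hand side does not depend on \<open>v\<close>.  A bound in the supremum norm is what is needed, because
  \<open>g\<close> is merely integrable.\<close>

lemma norm_bessel_le:
  fixes h :: "real^'d \<Rightarrow> complex"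
  assumes [measurable]: "h \<in> borel_measurable borel"
  shows "ennreal (norm (bessel \<gamma> h v)) \<le> (\<integral>\<^sup>+\<xi>. ennreal (bessel_weight \<gamma> \<xi>) * norm (fourier h \<xi>) \<partial>lborel)"
proof -
  let ?c = "(2 * pi) ^ CARD('d)"
  have c1: "?c \<ge> 1" using pi_ge_two by (intro one_le_power) simp
  let ?I = "LINT \<xi>|lborel. wave \<xi> v * (complex_of_real (bessel_weight \<gamma> \<xi>) * fourier h \<xi>)"
  have "bessel \<gamma> h v = ?I / complex_of_real ?c"
    unfolding bessel_def fourier_multiplier_def bessel_weight_def[symmetric] by (subst inverse_fourier_lborel) measurable
  then have "norm (bessel \<gamma> h v) = norm ?I / ?c" by (simp only: norm_divide norm_of_real) simp
  also have "\<dots> \<le> norm ?I / 1" using c1 by (intro divide_left_mono) auto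
  finally have "ennreal (norm (bessel \<gamma> h v)) \<le> ennreal (norm ?I)" by (simp add: ennreal_leI)
  also have "\<dots> \<le> (\<integral>\<^sup>+\<xi>. norm (wave \<xi> v * (complex_of_real (bessel_weight \<gamma> \<xi>) * fourier h \<xi>)) \<partial>lborel)"
    by (rule norm_integral_le_nn_integral)
  also have "\<dots> = (\<integral>\<^sup>+\<xi>. ennreal (bessel_weight \<gamma> \<xi>) * norm (fourier h \<xi>) \<partial>lborel)"
    by (intro nn_integral_cong) (simp add: norm_mult ennreal_mult bessel_weight_def)
  finally show ?thesis .
qed

definition shear_weight :: "real \<Rightarrow> (real^'d \<Rightarrow> complex) \<Rightarrow> (real^'d \<Rightarrow> complex) \<Rightarrow> real \<Rightarrow> real^'d \<Rightarrow> ennreal" where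
  "shear_weight \<gamma> P Q s z = (\<integral>\<^sup>+\<xi>. ennreal (bessel_weight \<gamma> \<xi>) * norm (fourier (\<lambda>w. P (z - s *\<^sub>R w) * Q w) \<xi>) \<partial>lborel)"

lemma shear_weight_measurable [measurable]:
  fixes P Q :: "real^'d \<Rightarrow> complex"
  assumes [measurable]: "P \<in> borel_measurable borel" "Q \<in> borel_measurable borel"
    "a \<in> borel_measurable M" "b \<in> borel_measurable M"
  shows "(\<lambda>x. shear_weight \<gamma> P Q (a x) (b x)) \<in> borel_measurable M"
  unfolding shear_weight_def by measurable

text \<open>The derivative of \<open>\<theta> y s\<close> in \<open>s\<close> is its derivative in the direction \<open>(v, 0)\<close>, so the weak equation
  tested with \<open>\<theta> y s\<close> computes the derivative of \<open>\<integral> f \<theta>\<close> along the free flow, and integration over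
  \<open>s \<in> [0, t]\<close> compares the flow at times \<open>0\<close> and \<open>t\<close>.\<close>

lemma transport_integrated:
  fixes P Q :: "real^'d \<Rightarrow> complex" and f :: "(real^'d) \<times> (real^'d) \<Rightarrow> real"
  assumes P: "test_function P" and Q: "test_function Q" and t: "0 \<le> t"
    and f: "integrable lborel f" and g: "g \<in> borel_measurable borel"
    and tr: "transport_equation \<gamma> f g"
  defines "\<theta> \<equiv> \<lambda>y s z. P (y - fst z - s *\<^sub>R snd z) * Q (snd z)"
  shows "ennreal (norm (LINT z|lborel. f z *\<^sub>R (\<theta> y t z - \<theta> y 0 z)))
    \<le> (\<integral>\<^sup>+s\<in>{0..t}. (\<integral>\<^sup>+z. norm (g z) * shear_weight \<gamma> P Q s (y - fst z) \<partial>lborel) \<partial>lborel)"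
proof -
  note [measurable] = borel_measurable_integrable[OF f, simplified] g
    test_function_measurable[OF P] test_function_measurable[OF Q]
  define P' where "P' b x = frechet_derivative P (at x) b" for b x
  have P'_test: "test_function (P' b)" if "b \<in> Basis" for b
    using test_function_deriv[OF P that] unfolding P'_def .
  have P'_meas: "P' b \<in> borel_measurable borel" if "b \<in> Basis" for b
    using test_function_measurable[OF P'_test[OF that]] .
  have P'_exp: "frechet_derivative P (at x) v = (\<Sum>b\<in>Basis. (v \<bullet> b) *\<^sub>R P' b x)" for x v
    unfolding P'_def using test_function_has_derivative[OF P] by (intro frechet_derivative_Basis_expand) (auto simp: differentiable_def)
  define D where "D s z = - (\<Sum>b\<in>Basis. (snd z \<bullet> b) *\<^sub>R P' b (y - fst z - s *\<^sub>R snd z)) * Q (snd z)" for s :: real and z :: "(real^'d) \<times> (real^'d)"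
  have D_alt: "D s z = - frechet_derivative P (at (y - fst z - s *\<^sub>R snd z)) (snd z) * Q (snd z)" for s z
    unfolding D_def P'_exp ..
  have D_meas [measurable]: "(\<lambda>x. D (a x) (b x)) \<in> borel_measurable M"
    if [measurable]: "a \<in> borel_measurable M" "b \<in> borel_measurable M" for a b and M :: "'m measure"
  proof -
    have sb [measurable]: "(\<lambda>x. snd (b x)) \<in> borel_measurable M" "(\<lambda>x. fst (b x)) \<in> borel_measurable M"
      by (rule measurable_compose[OF _ snd_borel_measurable] measurable_compose[OF _ fst_borel_measurable], measurable)+
    have "(\<lambda>x. P' i (y - fst (b x) - a x *\<^sub>R snd (b x))) \<in> borel_measurable M" if "i \<in> Basis" for i
      by (rule measurable_compose[OF _ P'_meas[OF that]]) measurable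
    then show ?thesis
      unfolding D_def by (intro borel_measurable_times borel_measurable_uminus borel_measurable_sum
          borel_measurable_scaleR borel_measurable_inner borel_measurable_const sb(1)
          measurable_compose[OF sb(1) test_function_measurable[OF Q]])
  qed
  obtain BP where BP: "BP \<ge> 0" "\<And>x y. norm (frechet_derivative P (at x) y) \<le> BP * norm y"
    using test_function_derivative_bound[OF P] by blast
  obtain R where R: "R > 0" "\<And>x. R < norm x \<Longrightarrow> Q x = 0" using Q by (metis test_function_support)
  obtain BQ where BQ: "BQ > 0" "\<And>x. norm (Q x) \<le> BQ" using Q by (metis test_function_bounded)
  define M where "M = BP * R * BQ"
  have D_bound: "norm (D s z) \<le> M" for s z
  proof (cases "norm (snd z) \<le> R")
    case True
    have "norm (D s z) = norm (frechet_derivative P (at (y - fst z - s *\<^sub>R snd z)) (snd z)) * norm (Q (snd z))"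
      unfolding D_alt by (simp add: norm_mult)
    also have "\<dots> \<le> (BP * R) * BQ"
      using True BP R BQ by (intro mult_mono order_trans[OF BP(2)] mult_left_mono) auto
    finally show ?thesis by (simp add: M_def)
  next
    case False
    then have "D s z = 0" using R unfolding D_def by simp
    then show ?thesis using BP R BQ by (simp add: M_def)
  qed
  have ds: "((\<lambda>s. \<theta> y s z) has_vector_derivative D s z) (at s within S)" for s S z
  proof -
    have "((\<lambda>s. y - fst z - s *\<^sub>R snd z) has_derivative (\<lambda>h. - (h *\<^sub>R snd z))) (at s)"
      by (auto intro!: derivative_eq_intros)
    from has_derivative_compose[OF this test_function_has_derivative[OF P]]
    have "((\<lambda>s. P (y - fst z - s *\<^sub>R snd z)) has_derivative (\<lambda>h. frechet_derivative P (at (y - fst z - s *\<^sub>R snd z)) (- (h *\<^sub>R snd z)))) (at s)" .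
    from has_derivative_mult_left[OF this, of "Q (snd z)"]
    have "((\<lambda>s. \<theta> y s z) has_derivative (\<lambda>h. frechet_derivative P (at (y - fst z - s *\<^sub>R snd z)) (- (h *\<^sub>R snd z)) * Q (snd z))) (at s)"
      unfolding \<theta>_def .
    moreover have "linear (frechet_derivative P (at (y - fst z - s *\<^sub>R snd z)))"
      using test_function_has_derivative[OF P] has_derivative_linear by blast
    then have "(\<lambda>h. frechet_derivative P (at (y - fst z - s *\<^sub>R snd z)) (- (h *\<^sub>R snd z)) * Q (snd z)) = (\<lambda>h. h *\<^sub>R D s z)"
      unfolding D_alt by (auto simp: linear_neg linear_scale)
    ultimately have "((\<lambda>s. \<theta> y s z) has_vector_derivative D s z) (at s)"
      unfolding has_vector_derivative_def by simp
    then show ?thesis by (rule has_vector_derivative_at_within)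
  qed
  have cont: "continuous_on {0..t} (\<lambda>s. D s z)" for z
    unfolding D_def
    by (intro continuous_intros continuous_on_compose2[OF test_function_continuous[OF P'_test]]) auto
  have ftc: "(LINT s|lborel. indicator {0..t} s *\<^sub>R D s z) = \<theta> y t z - \<theta> y 0 z" for z
    by (rule integral_FTC_atLeastAtMost[OF t ds cont])
  have \<theta>_test: "test_function (\<theta> y s)" for s
    unfolding \<theta>_def by (rule test_function_shear_product[OF P Q])
  have frechet: "frechet_derivative (\<theta> y s) (at z) (snd z, 0) = D s z" for s z
  proof -
    have "((\<lambda>z. y - fst z - s *\<^sub>R snd z) has_derivative (\<lambda>h. - fst h - s *\<^sub>R snd h)) (at z)"
      by (auto intro!: derivative_eq_intros)
    note 1 = has_derivative_compose[OF this test_function_has_derivative[OF P]]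
    have "((\<lambda>z. snd z) has_derivative snd) (at z)" by (auto intro!: derivative_eq_intros)
    note 2 = has_derivative_compose[OF this test_function_has_derivative[OF Q]]
    have lQ: "linear (frechet_derivative Q (at (snd z)))" and lP: "linear (frechet_derivative P (at x))" for x
      using test_function_has_derivative[OF P] test_function_has_derivative[OF Q] has_derivative_linear by blast+
    have "frechet_derivative (\<theta> y s) (at z) = (\<lambda>h. P (y - fst z - s *\<^sub>R snd z) * frechet_derivative Q (at (snd z)) (snd h)
        + frechet_derivative P (at (y - fst z - s *\<^sub>R snd z)) (- fst h - s *\<^sub>R snd h) * Q (snd z))"
      unfolding \<theta>_def by (rule frechet_derivative_at[OF has_derivative_mult[OF 1 2], symmetric])
    then show ?thesis unfolding D_alt by (simp add: linear_0[OF lQ] linear_neg[OF lP])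
  qed
  have key: "ennreal (norm (LINT z|lborel. f z *\<^sub>R D s z)) \<le> (\<integral>\<^sup>+z. norm (g z) * shear_weight \<gamma> P Q s (y - fst z) \<partial>lborel)" for s
  proof -
    let ?b = "\<lambda>z. bessel \<gamma> (\<lambda>w. \<theta> y s (fst z, w)) (snd z)"
    have eq: "- (LINT z|lebesgue. f z *\<^sub>R D s z) = (LINT z|lebesgue. g z * ?b z)"
    proof -
      have "frechet_derivative (\<theta> y s) (at (x, v)) (v, 0) = D s (x, v)" for x v
        using frechet[of s "(x, v)"] by simp
      then have "- (LINT (x, v)|lebesgue. f (x, v) *\<^sub>R D s (x, v))
          = (LINT (x, v)|lebesgue. g (x, v) * bessel \<gamma> (\<lambda>w. \<theta> y s (x, w)) v)"
        using tr[unfolded transport_equation_def, rule_format, OF \<theta>_test, of s] by simp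
      then show ?thesis by (simp only: case_prod_unfold prod.collapse)
    qed
    have lb: "(LINT z|lebesgue. f z *\<^sub>R D s z) = (LINT z|lborel. f z *\<^sub>R D s z)"
      by (rule integral_completion) measurable
    have "norm (LINT z|lborel. f z *\<^sub>R D s z) = norm (LINT z|lebesgue. g z * ?b z)"
      unfolding eq[symmetric] norm_minus_cancel lb ..
    also have "ennreal \<dots> \<le> (\<integral>\<^sup>+z. norm (g z * ?b z) \<partial>lebesgue)"
      by (rule norm_integral_le_nn_integral)
    also have "\<dots> = (\<integral>\<^sup>+z. norm (g z * ?b z) \<partial>lborel)" by (rule nn_integral_completion)
    also have "\<dots> \<le> (\<integral>\<^sup>+z. norm (g z) * shear_weight \<gamma> P Q s (y - fst z) \<partial>lborel)"
    proof (rule nn_integral_mono)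
      fix z :: "(real^'d) \<times> (real^'d)"
      have "(\<lambda>w. \<theta> y s (fst z, w)) = (\<lambda>w. P ((y - fst z) - s *\<^sub>R w) * Q w)" by (simp add: \<theta>_def)
      then have "ennreal (norm (?b z)) \<le> shear_weight \<gamma> P Q s (y - fst z)"
        unfolding shear_weight_def by (simp only:) (rule norm_bessel_le, measurable)
      then show "ennreal (norm (g z * ?b z)) \<le> norm (g z) * shear_weight \<gamma> P Q s (y - fst z)"
        by (simp add: norm_mult ennreal_mult mult_left_mono)
    qed
    finally show ?thesis .
  qed
  have "(LINT z|lborel. f z *\<^sub>R (\<theta> y t z - \<theta> y 0 z)) = (LINT z|lborel. LINT s|lborel. indicator {0..t} s *\<^sub>R (f z *\<^sub>R D s z))"
  proof (intro Bochner_Integration.integral_cong refl)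
    fix z
    have "f z *\<^sub>R (\<theta> y t z - \<theta> y 0 z) = (LINT s|lborel. complex_of_real (f z) * (indicator {0..t} s *\<^sub>R D s z))"
      unfolding ftc[symmetric] scaleR_conv_of_real[of "f z"] by (rule integral_mult_right_zero[symmetric])
    also have "\<dots> = (LINT s|lborel. indicator {0..t} s *\<^sub>R (f z *\<^sub>R D s z))"
      by (simp add: scaleR_conv_of_real mult.left_commute)
    finally show "f z *\<^sub>R (\<theta> y t z - \<theta> y 0 z) = (LINT s|lborel. indicator {0..t} s *\<^sub>R (f z *\<^sub>R D s z))" .
  qed
  also have "\<dots> = (LINT s|lborel. LINT z|lborel. indicator {0..t} s *\<^sub>R (f z *\<^sub>R D s z))"
  proof (rule fubini_swap[where f = "\<lambda>s. complex_of_real (indicator {0..t} s)" and g = "\<lambda>z. complex_of_real (M * f z)"])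
    show "integrable lborel (\<lambda>s. complex_of_real (indicator {0..t} s))"
      using t by (intro integrable_of_real integrable_real_indicator) auto
    show "integrable lborel (\<lambda>z. complex_of_real (M * f z))"
      by (intro integrable_of_real integrable_mult_right f)
    have "M \<ge> 0" using BP R BQ by (simp add: M_def)
    then show "norm (indicator {0..t} s *\<^sub>R (f z *\<^sub>R D s z)) \<le> norm (complex_of_real (indicator {0..t} s)) * norm (complex_of_real (M * f z))" for s z
      using D_bound[of s z] mult_left_mono[OF D_bound[of s z], of "\<bar>f z\<bar>"]
      by (simp add: indicator_def abs_mult norm_mult mult.commute)
  qed (unfold split_beta, measurable)
  also have "\<dots> = (LINT s|lborel. indicator {0..t} s *\<^sub>R (LINT z|lborel. f z *\<^sub>R D s z))"
    by (intro Bochner_Integration.integral_cong refl) (simp add: indicator_def)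
  finally have "ennreal (norm (LINT z|lborel. f z *\<^sub>R (\<theta> y t z - \<theta> y 0 z)))
      \<le> (\<integral>\<^sup>+s. norm (indicator {0..t} s *\<^sub>R (LINT z|lborel. f z *\<^sub>R D s z)) \<partial>lborel)"
    by (simp only: norm_integral_le_nn_integral)
  also have "\<dots> \<le> (\<integral>\<^sup>+s\<in>{0..t}. (\<integral>\<^sup>+z. norm (g z) * shear_weight \<gamma> P Q s (y - fst z) \<partial>lborel) \<partial>lborel)"
    using key by (intro nn_integral_mono) (auto simp: indicator_def)
  finally show ?thesis .
qed

lemma transport_error_le:
  fixes P Q :: "real^'d \<Rightarrow> complex" and f :: "(real^'d) \<times> (real^'d) \<Rightarrow> real"
  assumes P: "test_function P" and Q: "test_function Q" and t: "0 \<le> t"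
    and f: "integrable lborel f" and g: "g \<in> borel_measurable borel"
    and tr: "transport_equation \<gamma> f g"
    and Kb: "\<And>s. 0 \<le> s \<Longrightarrow> s \<le> t \<Longrightarrow> (\<integral>\<^sup>+y. shear_weight \<gamma> P Q s y \<partial>lborel) \<le> Kb"
  shows "(\<integral>\<^sup>+y. norm (LINT z|lborel. f z *\<^sub>R (P (y - fst z - t *\<^sub>R snd z) * Q (snd z) - P (y - fst z) * Q (snd z))) \<partial>lborel)
    \<le> ennreal t * (Kb * L1norm g)"
proof -
  note [measurable] = g test_function_measurable[OF P] test_function_measurable[OF Q]
  have "(\<integral>\<^sup>+y. norm (LINT z|lborel. f z *\<^sub>R (P (y - fst z - t *\<^sub>R snd z) * Q (snd z) - P (y - fst z) * Q (snd z))) \<partial>lborel)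
      \<le> (\<integral>\<^sup>+y. (\<integral>\<^sup>+s\<in>{0..t}. (\<integral>\<^sup>+z. norm (g z) * shear_weight \<gamma> P Q s (y - fst z) \<partial>lborel) \<partial>lborel) \<partial>lborel)"
    using transport_integrated[OF P Q t f g tr] by (intro nn_integral_mono) simp
  also have "\<dots> = (\<integral>\<^sup>+s. (\<integral>\<^sup>+y. (\<integral>\<^sup>+z. norm (g z) * shear_weight \<gamma> P Q s (y - fst z) \<partial>lborel) * indicator {0..t} s \<partial>lborel) \<partial>lborel)"
    by (rule lborel_pair.Fubini') measurable
  also have "\<dots> = (\<integral>\<^sup>+s\<in>{0..t}. (\<integral>\<^sup>+y. (\<integral>\<^sup>+z. norm (g z) * shear_weight \<gamma> P Q s (y - fst z) \<partial>lborel) \<partial>lborel) \<partial>lborel)"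
    by (intro nn_integral_cong nn_integral_multc) measurable
  also have "\<dots> \<le> (\<integral>\<^sup>+s\<in>{0..t}. (Kb * L1norm g) \<partial>lborel)"
  proof (rule nn_integral_mono)
    fix s :: real
    show "(\<integral>\<^sup>+y. (\<integral>\<^sup>+z. norm (g z) * shear_weight \<gamma> P Q s (y - fst z) \<partial>lborel) \<partial>lborel) * indicator {0..t} s
        \<le> (Kb * L1norm g) * indicator {0..t} s"
    proof (cases "s \<in> {0..t}")
      case True
      have "(\<integral>\<^sup>+y. (\<integral>\<^sup>+z. norm (g z) * shear_weight \<gamma> P Q s (y - fst z) \<partial>lborel) \<partial>lborel)
          = (\<integral>\<^sup>+z. (\<integral>\<^sup>+y. norm (g z) * shear_weight \<gamma> P Q s (y - fst z) \<partial>lborel) \<partial>lborel)"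
        by (rule lborel_pair.Fubini') measurable
      also have "\<dots> = (\<integral>\<^sup>+z. norm (g z) * (\<integral>\<^sup>+y. shear_weight \<gamma> P Q s y \<partial>lborel) \<partial>lborel)"
        by (simp add: nn_integral_cmult nn_integral_lborel_shift[of "\<lambda>y. shear_weight \<gamma> P Q s y"])
      also have "\<dots> = L1norm g * (\<integral>\<^sup>+y. shear_weight \<gamma> P Q s y \<partial>lborel)"
        by (rule nn_integral_multc) measurable
      also have "\<dots> \<le> L1norm g * Kb"
        using True by (intro mult_left_mono Kb) auto
      finally show ?thesis using True by (simp add: mult.commute)
    qed simp
  qed
  also have "\<dots> = ennreal t * (Kb * L1norm g)"
    using t by (subst nn_integral_cmult_indicator) (simp_all add: mult.commute)
  finally show ?thesis .
qed

text \<open>Rescaling the position shows that a kernel at scale \<open>1 / r\<close> sees the shear \<open>r s\<close> instead of \<open>s\<close>.  The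
  exponent \<open>k\<close> exceeds \<open>\<bar>\<gamma>\<bar>\<close> by \<open>2 D\<close>, which leaves an integrable weight in \<open>\<xi>\<close>.\<close>

lemma shear_weight_bound:
  fixes N Q :: "real^'d \<Rightarrow> complex"
  assumes N: "test_function N" and Q: "test_function Q"
  shows "\<exists>C\<ge>0. \<exists>k::nat. \<forall>r>0. \<forall>s\<ge>0. \<forall>T\<ge>1. r * s \<le> T \<longrightarrow>
     (\<integral>\<^sup>+y. shear_weight \<gamma> (dil r N) Q s y \<partial>lborel) \<le> ennreal (C * T ^ k)"
proof -
  note [measurable] = test_function_measurable[OF N] test_function_measurable[OF Q]
  define k0 where "k0 = nat \<lceil>\<bar>\<gamma>\<bar>\<rceil>"
  define k where "k = k0 + 2 * DIM(real^'d)"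
  let ?w = "\<lambda>\<xi>::real^'d. 1 / (1 + norm \<xi>) ^ (2 * DIM(real^'d))"
  obtain C where C: "C \<ge> 0" "\<And>T \<tau> \<xi>. 1 \<le> T \<Longrightarrow> 0 \<le> \<tau> \<Longrightarrow> \<tau> \<le> T \<Longrightarrow>
      ennreal ((1 + norm \<xi>) ^ k) * (\<integral>\<^sup>+z. norm (fourier (\<lambda>w. N (z - \<tau> *\<^sub>R w) * Q w) \<xi>) \<partial>lborel) \<le> ennreal (C * T ^ k)"
    using fourier_shear_decay[OF N Q, of k] by blast
  let ?W = "LINT \<xi>|lborel. ?w \<xi>"
  have W: "?W \<ge> 0" by (intro integral_nonneg_AE AE_I2) simp
  have "(\<integral>\<^sup>+y. shear_weight \<gamma> (dil r N) Q s y \<partial>lborel) \<le> ennreal (C * ?W * T ^ k)"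
    if r: "r > 0" and s: "s \<ge> 0" and T: "T \<ge> 1" and rs: "r * s \<le> T" for r s T
  proof -
    have scale: "(\<integral>\<^sup>+z. norm (fourier (\<lambda>w. dil r N (z - s *\<^sub>R w) * Q w) \<xi>) \<partial>lborel)
        = (\<integral>\<^sup>+z. norm (fourier (\<lambda>w. N (z - (r * s) *\<^sub>R w) * Q w) \<xi>) \<partial>lborel)" for \<xi>
    proof -
      have "fourier (\<lambda>w. dil r N (z - s *\<^sub>R w) * Q w) \<xi> = complex_of_real (r ^ DIM(real^'d)) * fourier (\<lambda>w. N ((0 + r *\<^sub>R z) - (r * s) *\<^sub>R w) * Q w) \<xi>" for z
        by (simp add: fourier_lborel dil_def scaleR_right_diff_distrib mult.left_commute mult.assoc del: DIM_cart of_real_power)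
      then have "(\<integral>\<^sup>+z. norm (fourier (\<lambda>w. dil r N (z - s *\<^sub>R w) * Q w) \<xi>) \<partial>lborel)
         = (\<integral>\<^sup>+z. ennreal (\<bar>r\<bar> ^ DIM(real^'d)) * ennreal (norm (fourier (\<lambda>w. N ((0 + r *\<^sub>R z) - (r * s) *\<^sub>R w) * Q w) \<xi>)) \<partial>lborel)"
        using r by (simp add: norm_mult ennreal_mult norm_power del: DIM_cart)
      also have "\<dots> = ennreal (\<bar>r\<bar> ^ DIM(real^'d)) * (\<integral>\<^sup>+z. ennreal (norm (fourier (\<lambda>w. N ((0 + r *\<^sub>R z) - (r * s) *\<^sub>R w) * Q w) \<xi>)) \<partial>lborel)"
        by (rule nn_integral_cmult) measurable
      also have "\<dots> = (\<integral>\<^sup>+z. norm (fourier (\<lambda>w. N (z - (r * s) *\<^sub>R w) * Q w) \<xi>) \<partial>lborel)"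
        using r by (intro nn_integral_lborel_affine[symmetric]) auto
      finally show ?thesis .
    qed
    have "(\<integral>\<^sup>+y. shear_weight \<gamma> (dil r N) Q s y \<partial>lborel)
        = (\<integral>\<^sup>+\<xi>. \<integral>\<^sup>+y. ennreal (bessel_weight \<gamma> \<xi>) * norm (fourier (\<lambda>w. dil r N (y - s *\<^sub>R w) * Q w) \<xi>) \<partial>lborel \<partial>lborel)"
      unfolding shear_weight_def by (rule lborel_pair.Fubini') measurable
    also have "\<dots> = (\<integral>\<^sup>+\<xi>. ennreal (bessel_weight \<gamma> \<xi>) * (\<integral>\<^sup>+z. norm (fourier (\<lambda>w. N (z - (r * s) *\<^sub>R w) * Q w) \<xi>) \<partial>lborel) \<partial>lborel)"
      unfolding scale[symmetric] by (intro nn_integral_cong nn_integral_cmult) measurable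
    also have "\<dots> \<le> (\<integral>\<^sup>+\<xi>. ennreal (C * T ^ k) * ennreal (?w \<xi>) \<partial>lborel)"
    proof (rule nn_integral_mono)
      fix \<xi> :: "real^'d"
      let ?J = "\<integral>\<^sup>+z. norm (fourier (\<lambda>w. N (z - (r * s) *\<^sub>R w) * Q w) \<xi>) \<partial>lborel"
      have pos: "(1 + norm \<xi>) ^ (2 * DIM(real^'d)) > 0" by (simp add: add_pos_nonneg)
      have "bessel_weight \<gamma> \<xi> \<le> ?w \<xi> * (1 + norm \<xi>) ^ k"
        using bessel_weight_le[of \<gamma> \<xi>] pos less_imp_neq[OF add_pos_nonneg[OF zero_less_one norm_ge_zero[of \<xi>]]] by (simp add: k_def k0_def power_add del: DIM_cart)
      then have "ennreal (bessel_weight \<gamma> \<xi>) * ?J \<le> ennreal (?w \<xi> * (1 + norm \<xi>) ^ k) * ?J"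
        by (intro mult_right_mono ennreal_leI) auto
      also have "\<dots> = ennreal (?w \<xi>) * (ennreal ((1 + norm \<xi>) ^ k) * ?J)"
        by (subst ennreal_mult) (auto simp: mult.assoc)
      also have "\<dots> \<le> ennreal (?w \<xi>) * ennreal (C * T ^ k)"
        using r s by (intro mult_left_mono C T rs) auto
      finally show "ennreal (bessel_weight \<gamma> \<xi>) * ?J \<le> ennreal (C * T ^ k) * ennreal (?w \<xi>)"
        by (simp only: mult.commute)
    qed
    also have "\<dots> = ennreal (C * T ^ k) * ennreal ?W"
      by (subst nn_integral_cmult) (auto simp: nn_integral_eq_integral integrable_weight)
    also have "\<dots> = ennreal (C * ?W * T ^ k)"
      using C(1) T W by (subst ennreal_mult[symmetric]) (auto simp: mult_ac)
    finally show ?thesis .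
  qed
  moreover have "C * ?W \<ge> 0" using C(1) W by simp
  ultimately show ?thesis by blast
qed

section \<open>Velocity averages\<close>

text \<open>Multiplication by a smooth cut-off almost commutes with a kernel at scale \<open>1 / r\<close>: the commutator
  contains an increment of the cut-off over a distance of order \<open>1 / r\<close>.\<close>

lemma conv_cutoff_commutator:
  fixes N X :: "'a::euclidean_space \<Rightarrow> complex"
  assumes N: "test_function N" and X: "test_function X"
  shows "\<exists>C\<ge>0. \<forall>h r. integrable lborel h \<longrightarrow> r > 0 \<longrightarrow>
    (L1norm (conv (dil r N) (\<lambda>v. h v * X v)))
      \<le> ennreal C * (L1norm (conv (dil r N) h) + ennreal (1 / r) * L1norm h)"
proof -
  note [measurable] = test_function_measurable[OF N] test_function_measurable[OF X]
  obtain B where B: "B > 0" "\<And>x. norm (X x) \<le> B" using X by (metis test_function_bounded)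
  obtain L where L: "L \<ge> 0" "\<And>x y. norm (X (x - y) - X x) \<le> L * norm y" using test_function_lipschitz[OF X] by blast
  obtain M where M: "regular_kernel M N" using regular_kernel_test_function[OF N] by blast
  have M0: "M \<ge> 0" using M by (simp add: regular_kernel_def)
  define C where "C = max B (L * M)"
  have "L1norm (conv (dil r N) (\<lambda>v. h v * X v))
      \<le> ennreal C * (L1norm (conv (dil r N) h) + ennreal (1 / r) * L1norm h)"
    if h: "integrable lborel h" and r: "r > 0" for h and r :: real
  proof -
    note [measurable] = borel_measurable_integrable[OF h, simplified]
    let ?N = "dil r N"
    have Nr: "test_function ?N" using N r by (intro test_function_dil) auto
    have hX: "integrable lborel (\<lambda>v. h v * X v)"
    proof (rule Bochner_Integration.integrable_bound)
      show "integrable lborel (\<lambda>v. B *\<^sub>R h v)" by (intro integrable_scaleR_right h)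
      show "AE v in lborel. norm (h v * X v) \<le> norm (B *\<^sub>R h v)"
        using B by (intro AE_I2) (simp add: norm_mult mult.commute[of B] mult_left_mono)
    qed measurable
    have "ennreal (norm (conv ?N (\<lambda>v. h v * X v) w))
        \<le> ennreal B * norm (conv ?N h w) + (\<integral>\<^sup>+v. ennreal L * (norm (w - v) * norm (?N (w - v))) * norm (h v) \<partial>lborel)" for w
    proof -
      have "conv ?N (\<lambda>v. h v * X v) w - X w * conv ?N h w
          = (LINT v|lborel. ?N (w - v) * (h v * X v) - X w * (?N (w - v) * h v))"
        unfolding conv_def
        by (subst Bochner_Integration.integral_diff)
           (auto intro!: integrable_conv_integrand[OF Nr] hX h)
      then have eq: "conv ?N (\<lambda>v. h v * X v) w
          = X w * conv ?N h w + (LINT v|lborel. ?N (w - v) * h v * (X v - X w))"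
        by (simp add: algebra_simps)
      have "ennreal (norm (LINT v|lborel. ?N (w - v) * h v * (X v - X w)))
          \<le> (\<integral>\<^sup>+v. norm (?N (w - v) * h v * (X v - X w)) \<partial>lborel)"
        by (rule norm_integral_le_nn_integral)
      also have "\<dots> \<le> (\<integral>\<^sup>+v. ennreal L * (norm (w - v) * norm (?N (w - v))) * norm (h v) \<partial>lborel)"
      proof (rule nn_integral_mono)
        fix v
        have "norm (?N (w - v) * h v * (X v - X w)) = norm (?N (w - v)) * norm (h v) * norm (X (w - (w - v)) - X w)"
          by (simp add: norm_mult)
        also have "\<dots> \<le> norm (?N (w - v)) * norm (h v) * (L * norm (w - v))" by (intro mult_left_mono L) simp
        finally show "ennreal (norm (?N (w - v) * h v * (X v - X w))) \<le> ennreal L * (norm (w - v) * norm (?N (w - v))) * norm (h v)"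
          using L(1) by (simp add: ennreal_mult[symmetric] mult_ac ennreal_leI)
      qed
      finally have 2: "ennreal (norm (LINT v|lborel. ?N (w - v) * h v * (X v - X w)))
          \<le> (\<integral>\<^sup>+v. ennreal L * (norm (w - v) * norm (?N (w - v))) * norm (h v) \<partial>lborel)" .
      have "norm (conv ?N (\<lambda>v. h v * X v) w) \<le> B * norm (conv ?N h w) + norm (LINT v|lborel. ?N (w - v) * h v * (X v - X w))"
        unfolding eq using B by (intro norm_triangle_le add_right_mono) (simp add: norm_mult mult_right_mono)
      then have "ennreal (norm (conv ?N (\<lambda>v. h v * X v) w)) \<le> ennreal B * norm (conv ?N h w) + ennreal (norm (LINT v|lborel. ?N (w - v) * h v * (X v - X w)))"
        using B(1) by (simp add: ennreal_mult[symmetric] ennreal_plus[symmetric] ennreal_leI del: ennreal_plus)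
      also have "\<dots> \<le> ennreal B * norm (conv ?N h w) + (\<integral>\<^sup>+v. ennreal L * (norm (w - v) * norm (?N (w - v))) * norm (h v) \<partial>lborel)"
        by (intro add_left_mono 2)
      finally show ?thesis .
    qed
    then have "L1norm (conv ?N (\<lambda>v. h v * X v))
      \<le> (\<integral>\<^sup>+w. ennreal B * norm (conv ?N h w) + (\<integral>\<^sup>+v. ennreal L * (norm (w - v) * norm (?N (w - v))) * norm (h v) \<partial>lborel) \<partial>lborel)"
      by (intro nn_integral_mono)
    also have "\<dots> = ennreal B * L1norm (conv ?N h) + (\<integral>\<^sup>+w. \<integral>\<^sup>+v. ennreal L * (norm (w - v) * norm (?N (w - v))) * norm (h v) \<partial>lborel \<partial>lborel)"
      by (subst nn_integral_add) (auto simp: nn_integral_cmult)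
    also have "(\<integral>\<^sup>+w. \<integral>\<^sup>+v. ennreal L * (norm (w - v) * norm (?N (w - v))) * norm (h v) \<partial>lborel \<partial>lborel)
        = (\<integral>\<^sup>+v. \<integral>\<^sup>+w. ennreal L * (norm (w - v) * norm (?N (w - v))) * norm (h v) \<partial>lborel \<partial>lborel)"
      by (rule lborel_pair.Fubini') measurable
    also have "\<dots> = (\<integral>\<^sup>+v. (ennreal L * (\<integral>\<^sup>+w. norm w * norm (?N w) \<partial>lborel)) * norm (h v) \<partial>lborel)"
    proof (rule nn_integral_cong)
      fix v
      have "(\<integral>\<^sup>+w. ennreal L * (norm (w - v) * norm (?N (w - v))) * norm (h v) \<partial>lborel)
          = (\<integral>\<^sup>+w. ennreal L * (norm (w - v) * norm (?N (w - v))) \<partial>lborel) * norm (h v)"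
        by (rule nn_integral_multc) measurable
      also have "(\<integral>\<^sup>+w. ennreal L * (norm (w - v) * norm (?N (w - v))) \<partial>lborel) = ennreal L * (\<integral>\<^sup>+w. norm (w - v) * norm (?N (w - v)) \<partial>lborel)"
        by (rule nn_integral_cmult) measurable
      also have "(\<integral>\<^sup>+w. norm (w - v) * norm (?N (w - v)) \<partial>lborel) = (\<integral>\<^sup>+w. norm w * norm (?N w) \<partial>lborel)"
        by (rule nn_integral_lborel_shift[of "\<lambda>w. ennreal (norm w * norm (?N w))"]) measurable
      finally show "(\<integral>\<^sup>+w. ennreal L * (norm (w - v) * norm (?N (w - v))) * norm (h v) \<partial>lborel)
         = (ennreal L * (\<integral>\<^sup>+w. norm w * norm (?N w) \<partial>lborel)) * norm (h v)" .
    qed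
    also have "\<dots> = (ennreal L * (\<integral>\<^sup>+w. norm w * norm (?N w) \<partial>lborel)) * L1norm h"
      by (rule nn_integral_cmult) measurable
    also have "ennreal B * L1norm (conv ?N h) + \<dots>
      \<le> ennreal C * L1norm (conv ?N h) + (ennreal C * ennreal (1 / r)) * L1norm h"
    proof (intro add_mono mult_right_mono)
      have "ennreal L * (\<integral>\<^sup>+w. norm w * norm (?N w) \<partial>lborel) \<le> ennreal L * ennreal (M / r)"
        by (intro mult_left_mono nn_integral_dil_moment[OF M r]) simp
      also have "\<dots> = ennreal (L * M) * ennreal (1 / r)"
        using L(1) M0 r by (simp add: ennreal_mult[symmetric])
      also have "\<dots> \<le> ennreal C * ennreal (1 / r)" by (intro mult_right_mono ennreal_leI) (auto simp: C_def)
      finally show "ennreal L * (\<integral>\<^sup>+w. norm w * norm (?N w) \<partial>lborel) \<le> ennreal C * ennreal (1 / r)" .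
    qed (auto simp: C_def intro: ennreal_leI)
    finally show ?thesis by (simp add: distrib_left mult.assoc)
  qed
  moreover have "C \<ge> 0" using B by (simp add: C_def)
  ultimately show ?thesis by blast
qed

lemma integral_lborel_product:
  fixes G :: "('a::euclidean_space) \<times> ('b::euclidean_space) \<Rightarrow> complex"
  assumes "integrable lborel G"
  shows "(LINT z|lborel. G z) = (LINT x|lborel. LINT v|lborel. G (x, v))"
  using lborel_pair.integral_fst'[of G] assms by (simp add: lborel_prod)

lemma nn_integral_lborel_product:
  fixes G :: "('a::euclidean_space) \<times> ('b::euclidean_space) \<Rightarrow> ennreal"
  assumes "G \<in> borel_measurable borel"
  shows "(\<integral>\<^sup>+z. G z \<partial>lborel) = (\<integral>\<^sup>+x. \<integral>\<^sup>+v. G (x, v) \<partial>lborel \<partial>lborel)"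
  using lborel.nn_integral_fst[of G lborel] assms by (simp add: lborel_prod)

lemma integrable_mult_bounded:
  fixes F H :: "'a::euclidean_space \<Rightarrow> complex"
  assumes F: "integrable lborel F" and [measurable]: "H \<in> borel_measurable borel" and B: "\<And>x. norm (H x) \<le> B"
  shows "integrable lborel (\<lambda>x. F x * H x)"
proof (rule Bochner_Integration.integrable_bound)
  note [measurable] = borel_measurable_integrable[OF F, simplified]
  show "integrable lborel (\<lambda>x. B *\<^sub>R F x)" by (intro integrable_scaleR_right F)
  show "(\<lambda>x. F x * H x) \<in> borel_measurable lborel" by measurable
  show "AE x in lborel. norm (F x * H x) \<le> norm (B *\<^sub>R F x)"
  proof (rule AE_I2)
    fix x
    have "norm (H x) \<le> \<bar>B\<bar>" using B[of x] by linarith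
    then show "norm (F x * H x) \<le> norm (B *\<^sub>R F x)" by (simp add: norm_mult mult.commute[of "norm (F x)"] mult_right_mono)
  qed
qed

text \<open>Dispersion: with \<open>y = x + t w\<close> the position kernel at scale \<open>1 / r\<close>, evaluated at
  \<open>y - x - t v = t (w - v)\<close>, becomes a velocity kernel at scale \<open>1 / (t r)\<close>.\<close>

lemma dispersed_average_le:
  fixes F :: "(real^'d) \<times> (real^'d) \<Rightarrow> complex"
  assumes F: "integrable lborel F" and N: "test_function N" and r: "r > 0" and t: "t > 0"
  shows "(\<integral>\<^sup>+y. norm (LINT z|lborel. F z * dil r N (y - fst z - t *\<^sub>R snd z)) \<partial>lborel)
    \<le> (\<integral>\<^sup>+x. L1norm (conv (dil (t * r) N) (\<lambda>v. F (x, v))) \<partial>lborel)"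
proof -
  note [measurable] = borel_measurable_integrable[OF F, simplified] test_function_measurable[OF N]
  have F_pair [measurable]: "F \<in> borel_measurable (borel \<Otimes>\<^sub>M borel)" by (simp add: borel_prod)
  have Nr: "test_function (dil r N)" using N r by (intro test_function_dil) auto
  obtain B where B: "\<And>x. norm (dil r N x) \<le> B" using Nr by (metis test_function_bounded)
  have "ennreal (norm (LINT z|lborel. F z * dil r N (y - fst z - t *\<^sub>R snd z)))
      \<le> (\<integral>\<^sup>+x. norm (LINT v|lborel. F (x, v) * dil r N (y - x - t *\<^sub>R v)) \<partial>lborel)" for y
  proof -
    have "integrable lborel (\<lambda>z. F z * dil r N (y - fst z - t *\<^sub>R snd z))"
      by (rule integrable_mult_bounded[OF F _ B]) measurable
    from integral_lborel_product[OF this]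
    have "(LINT z|lborel. F z * dil r N (y - fst z - t *\<^sub>R snd z)) = (LINT x|lborel. LINT v|lborel. F (x, v) * dil r N (y - x - t *\<^sub>R v))"
      by simp
    then show ?thesis by (simp only: norm_integral_le_nn_integral)
  qed
  then have "(\<integral>\<^sup>+y. norm (LINT z|lborel. F z * dil r N (y - fst z - t *\<^sub>R snd z)) \<partial>lborel)
      \<le> (\<integral>\<^sup>+y. \<integral>\<^sup>+x. norm (LINT v|lborel. F (x, v) * dil r N (y - x - t *\<^sub>R v)) \<partial>lborel \<partial>lborel)"
    by (intro nn_integral_mono)
  also have "\<dots> = (\<integral>\<^sup>+x. \<integral>\<^sup>+y. norm (LINT v|lborel. F (x, v) * dil r N (y - x - t *\<^sub>R v)) \<partial>lborel \<partial>lborel)"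
    by (rule lborel_pair.Fubini') measurable
  also have "\<dots> = (\<integral>\<^sup>+x. L1norm (conv (dil (t * r) N) (\<lambda>v. F (x, v))) \<partial>lborel)"
  proof (rule nn_integral_cong)
    fix x
    have Fx [measurable]: "(\<lambda>v. F (x, v)) \<in> borel_measurable borel" by measurable
    have "(\<integral>\<^sup>+y. norm (LINT v|lborel. F (x, v) * dil r N (y - x - t *\<^sub>R v)) \<partial>lborel)
        = (\<integral>\<^sup>+y. norm (LINT v|lborel. F (x, v) * dil r N (y - t *\<^sub>R v)) \<partial>lborel)"
      by (rule nn_integral_lborel_shift[of "\<lambda>y. ennreal (norm (LINT v|lborel. F (x, v) * dil r N (y - t *\<^sub>R v)))"]) measurable
    also have "\<dots> = ennreal (\<bar>t\<bar> ^ DIM(real^'d)) * (\<integral>\<^sup>+w. norm (LINT v|lborel. F (x, v) * dil r N (0 + t *\<^sub>R w - t *\<^sub>R v)) \<partial>lborel)"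
      using t by (intro nn_integral_lborel_affine) auto
    also have "\<dots> = (\<integral>\<^sup>+w. ennreal (\<bar>t\<bar> ^ DIM(real^'d)) * norm (LINT v|lborel. F (x, v) * dil r N (0 + t *\<^sub>R w - t *\<^sub>R v)) \<partial>lborel)"
      by (rule nn_integral_cmult[symmetric]) measurable
    also have "\<dots> = L1norm (conv (dil (t * r) N) (\<lambda>v. F (x, v)))"
    proof (rule nn_integral_cong)
      fix w
      have "conv (dil (t * r) N) (\<lambda>v. F (x, v)) w
          = (LINT v|lborel. complex_of_real (t ^ DIM(real^'d)) * (F (x, v) * dil r N (0 + t *\<^sub>R w - t *\<^sub>R v)))"
        unfolding conv_def dil_def
        by (intro Bochner_Integration.integral_cong refl)
           (simp add: power_mult_distrib scaleR_right_diff_distrib mult_ac)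
      also have "\<dots> = complex_of_real (t ^ DIM(real^'d)) * (LINT v|lborel. F (x, v) * dil r N (0 + t *\<^sub>R w - t *\<^sub>R v))"
        by (rule integral_mult_right_zero)
      finally have "norm (conv (dil (t * r) N) (\<lambda>v. F (x, v)) w)
          = \<bar>t\<bar> ^ DIM(real^'d) * norm (LINT v|lborel. F (x, v) * dil r N (0 + t *\<^sub>R w - t *\<^sub>R v))"
        by (simp only: norm_mult norm_of_real power_abs)
      then show "ennreal (\<bar>t\<bar> ^ DIM(real^'d)) * norm (LINT v|lborel. F (x, v) * dil r N (0 + t *\<^sub>R w - t *\<^sub>R v))
          = ennreal (norm (conv (dil (t * r) N) (\<lambda>v. F (x, v)) w))"
        by (simp add: ennreal_mult)
    qed
    finally show "(\<integral>\<^sup>+y. norm (LINT v|lborel. F (x, v) * dil r N (y - x - t *\<^sub>R v)) \<partial>lborel)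
        = L1norm (conv (dil (t * r) N) (\<lambda>v. F (x, v)))" .
  qed
  finally show ?thesis .
qed

lemma suminf_div:
  fixes a :: "nat \<Rightarrow> ennreal"
  assumes p: "p > 0"
  shows "(\<Sum>m. a (m div p)) = of_nat p * (\<Sum>j. a j)"
proof -
  have "(\<Sum>m. a (m div p)) = (\<Sum>m. \<Sum>j. a j * (if j = m div p then 1 else 0))"
  proof (rule arg_cong[where f = suminf], rule ext)
    fix m
    have "(\<Sum>j. a j * (if j = m div p then 1 else 0)) = (\<Sum>j\<in>{m div p}. a j * (if j = m div p then 1 else 0))"
      by (rule suminf_finite) auto
    then show "a (m div p) = (\<Sum>j. a j * (if j = m div p then 1 else 0))" by simp
  qed
  also have "\<dots> = (\<Sum>j. \<Sum>m. a j * (if j = m div p then 1 else 0))" by (rule ennreal_suminf_swap)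
  also have "\<dots> = (\<Sum>j. of_nat p * a j)"
  proof (rule arg_cong[where f = suminf], rule ext)
    fix j
    have eq: "j = m div p \<longleftrightarrow> m \<in> {j * p..<j * p + p}" for m
    proof
      assume "j = m div p"
      then show "m \<in> {j * p..<j * p + p}"
        using p dividend_less_div_times[of p m] by (simp add: add.commute)
    next
      assume "m \<in> {j * p..<j * p + p}"
      then show "j = m div p" by (intro div_nat_eqI[symmetric]) (auto simp: mult.commute)
    qed
    have "(\<Sum>m. a j * (if j = m div p then 1 else 0)) = (\<Sum>m\<in>{j * p..<j * p + p}. a j * (if j = m div p then 1 else 0))"
      using eq by (intro suminf_finite) auto
    also have "\<dots> = (\<Sum>m\<in>{j * p..<j * p + p}. a j)" using eq by (intro sum.cong) auto
    finally show "(\<Sum>m. a j * (if j = m div p then 1 else 0)) = of_nat p * a j" by simp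
  qed
  finally show ?thesis by simp
qed

lemma osc_norm_measurable [measurable]:
  fixes G :: "'a::euclidean_space \<Rightarrow> complex" and f :: "'b::euclidean_space \<times> 'a \<Rightarrow> complex"
  assumes [measurable]: "G \<in> borel_measurable borel" and f: "f \<in> borel_measurable borel"
  shows "(\<lambda>x. osc_norm G (\<lambda>v. f (x, v))) \<in> borel_measurable borel"
proof -
  have [measurable]: "f \<in> borel_measurable (borel \<Otimes>\<^sub>M borel)" using f by (simp add: borel_prod)
  show ?thesis unfolding osc_norm_def conv_def by measurable
qed

text \<open>For the position scale \<open>2\<^sup>-\<^sup>m\<close> the flow is followed up to time \<open>t = 2\<^bsup>j - m\<^esup>\<close> with \<open>j = m div (k + 2)\<close>.
  The transported term is an oscillation in \<open>v\<close> at scale \<open>2\<^sup>-\<^sup>j\<close>; the error \<open>t 2\<^bsup>jk\<^esup>\<close> is at most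
  \<open>2\<^sup>-\<^sup>j\<close> because \<open>(k + 2) j \<le> m\<close>.  Each \<open>j\<close> is used for \<open>k + 2\<close> values of \<open>m\<close>, so all sums converge.\<close>

lemma velocity_average_osc_norm:
  fixes G X :: "real^'d \<Rightarrow> complex"
  assumes G: "test_function G" and X: "test_function X"
  shows "\<exists>C\<ge>0. \<forall>f g. integrable lborel f \<longrightarrow> integrable lborel g \<longrightarrow> transport_equation \<gamma> f g \<longrightarrow>
    osc_norm G (\<lambda>x. LINT v|lborel. complex_of_real (f (x, v)) * X v)
      \<le> ennreal C * ((\<integral>\<^sup>+x. osc_norm G (\<lambda>v. complex_of_real (f (x, v))) \<partial>lborel)
           + L1norm f + L1norm g)"
proof -
  define N where "N = (\<lambda>x. dil 2 G x - G x)"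
  have N: "test_function N" unfolding N_def by (intro test_function_diff test_function_dil G) simp
  note [measurable] = test_function_measurable[OF G] test_function_measurable[OF X] test_function_measurable[OF N]
  obtain C1 k where C1: "C1 \<ge> 0" "\<And>r s T. r > 0 \<Longrightarrow> s \<ge> 0 \<Longrightarrow> T \<ge> 1 \<Longrightarrow> r * s \<le> T \<Longrightarrow>
     (\<integral>\<^sup>+y. shear_weight \<gamma> (dil r N) X s y \<partial>lborel) \<le> ennreal (C1 * T ^ k)"
    using shear_weight_bound[OF N X, of \<gamma>] by blast
  obtain C2 where C2: "C2 \<ge> 0" "\<And>h r. integrable lborel h \<Longrightarrow> r > 0 \<Longrightarrow>
    (L1norm (conv (dil r N) (\<lambda>v. h v * X v)))
      \<le> ennreal C2 * (L1norm (conv (dil r N) h) + ennreal (1 / r) * L1norm h)"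
    using conv_cutoff_commutator[OF N X] by blast
  obtain B where B: "B > 0" "\<And>x. norm (X x) \<le> B" using X by (metis test_function_bounded)
  define I where "I = (LINT x|lborel. norm (G x))"
  have I: "I \<ge> 0" by (simp add: I_def)
  define p where "p = k + 2"
  have p: "p > 0" by (simp add: p_def)
  define C where "C = I * B + real p * (2 * C2 + 2 * C1)"
  have C: "C \<ge> 0" using I B C1 C2 by (simp add: C_def)
  have "osc_norm G (\<lambda>x. LINT v|lborel. complex_of_real (f (x, v)) * X v)
      \<le> ennreal C * ((\<integral>\<^sup>+x. osc_norm G (\<lambda>v. complex_of_real (f (x, v))) \<partial>lborel)
           + L1norm f + L1norm g)"
    if f: "integrable lborel f" and g: "integrable lborel g" and tr: "transport_equation \<gamma> f g" for f g
  proof -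
    note gm = borel_measurable_integrable[OF g, simplified]
    note [measurable] = borel_measurable_integrable[OF f, simplified]
    define fc where "fc z = complex_of_real (f z)" for z
    have fc: "integrable lborel fc" unfolding fc_def[abs_def] by (intro integrable_of_real f)
    note fcm [measurable] = borel_measurable_integrable[OF fc, simplified]
    have fc_pair [measurable]: "fc \<in> borel_measurable (borel \<Otimes>\<^sub>M borel)" using fcm by (simp add: borel_prod)
    define F where "F z = fc z * X (snd z)" for z
    have F: "integrable lborel F" unfolding F_def[abs_def] by (rule integrable_mult_bounded[OF fc _ B(2)]) measurable
    note Fm [measurable] = borel_measurable_integrable[OF F, simplified]
    have F_pair [measurable]: "F \<in> borel_measurable (borel \<Otimes>\<^sub>M borel)" using Fm by (simp add: borel_prod)
    define \<rho> where "\<rho> x = (LINT v|lborel. F (x, v))" for x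
    have \<rho>_meas [measurable]: "\<rho> \<in> borel_measurable borel" unfolding \<rho>_def[abs_def] by measurable
    define Ob where "Ob = (\<integral>\<^sup>+x. osc_norm G (\<lambda>v. fc (x, v)) \<partial>lborel)"
    define Fn where "Fn = L1norm f"
    define Gn where "Gn = L1norm g"
    have Fn_alt: "Fn = (\<integral>\<^sup>+x. \<integral>\<^sup>+v. norm (fc (x, v)) \<partial>lborel \<partial>lborel)"
      unfolding Fn_def by (subst nn_integral_lborel_product[symmetric]) (auto simp: fc_def)
    have \<rho>_norm: "L1norm \<rho> \<le> ennreal B * Fn"
    proof -
      have "L1norm \<rho> \<le> (\<integral>\<^sup>+x. \<integral>\<^sup>+v. norm (F (x, v)) \<partial>lborel \<partial>lborel)"
        unfolding \<rho>_def by (intro nn_integral_mono norm_integral_le_nn_integral)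
      also have "\<dots> \<le> (\<integral>\<^sup>+x. \<integral>\<^sup>+v. ennreal B * norm (fc (x, v)) \<partial>lborel \<partial>lborel)"
        using B by (intro nn_integral_mono) (simp add: F_def norm_mult mult.commute[of B] mult_left_mono ennreal_leI flip: ennreal_mult)
      also have "\<dots> = ennreal B * Fn"
        unfolding Fn_alt by (simp add: nn_integral_cmult)
      finally show ?thesis .
    qed
    have conv_\<rho>: "conv H \<rho> y = (LINT z|lborel. F z * H (y - fst z))" if H: "test_function H" for H y
    proof -
      note [measurable] = test_function_measurable[OF H]
      obtain BH where BH: "\<And>x. norm (H x) \<le> BH" using H by (metis test_function_bounded)
      have "integrable lborel (\<lambda>z. F z * H (y - fst z))" by (rule integrable_mult_bounded[OF F _ BH]) measurable
      from integral_lborel_product[OF this]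
      have "(LINT z|lborel. F z * H (y - fst z)) = (LINT x|lborel. LINT v|lborel. F (x, v) * H (y - x))" by simp
      also have "\<dots> = (LINT x|lborel. \<rho> x * H (y - x))" unfolding \<rho>_def by simp
      finally show ?thesis by (simp add: conv_def mult.commute)
    qed
    define A where "A j = (\<integral>\<^sup>+x. L1norm (conv (dil (2 ^ j) N) (\<lambda>v. fc (x, v))) \<partial>lborel)" for j :: nat
    define a where "a j = ennreal C2 * (A j + ennreal ((1 / 2) ^ j) * Fn) + ennreal C1 * (ennreal ((1 / 2) ^ j) * Gn)" for j
    have step: "L1norm (conv (dil (2 ^ m) N) \<rho>) \<le> a (m div p)" for m
    proof -
      define j where "j = m div p"
      define r where "r = (2::real) ^ m"
      define t where "t = (2::real) ^ j / 2 ^ m"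
      have rt: "r > 0" "t > 0" "r * t = 2 ^ j" "t * r = 2 ^ j" by (auto simp: r_def t_def)
      let ?P = "dil r N"
      have P: "test_function ?P" using N rt by (intro test_function_dil) auto
      note [measurable] = test_function_measurable[OF P]
      obtain BP where BP: "\<And>x. norm (?P x) \<le> BP" using P by (metis test_function_bounded)
      let ?M = "\<lambda>y. LINT z|lborel. F z * ?P (y - fst z - t *\<^sub>R snd z)"
      let ?E = "\<lambda>y. LINT z|lborel. f z *\<^sub>R (?P (y - fst z - t *\<^sub>R snd z) * X (snd z) - ?P (y - fst z) * X (snd z))"
      have split: "conv ?P \<rho> y = ?M y - ?E y" for y
      proof -
        have i1: "integrable lborel (\<lambda>z. F z * ?P (y - fst z - t *\<^sub>R snd z))"
          by (rule integrable_mult_bounded[OF F _ BP]) measurable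
        have i2: "integrable lborel (\<lambda>z. F z * ?P (y - fst z))"
          by (rule integrable_mult_bounded[OF F _ BP]) measurable
        have "?E y = (LINT z|lborel. F z * ?P (y - fst z - t *\<^sub>R snd z) - F z * ?P (y - fst z))"
          by (intro Bochner_Integration.integral_cong refl) (simp add: F_def fc_def scaleR_conv_of_real algebra_simps)
        also have "\<dots> = ?M y - conv ?P \<rho> y"
          unfolding conv_\<rho>[OF P] by (rule Bochner_Integration.integral_diff[OF i1 i2])
        finally show ?thesis by simp
      qed
      have M_meas: "?M \<in> borel_measurable borel" by measurable
      have E_meas: "?E \<in> borel_measurable borel"
      proof -
        have "?E = (\<lambda>y. ?M y - conv ?P \<rho> y)" using split by (auto simp: fun_eq_iff)
        also have "\<dots> \<in> borel_measurable borel" using M_meas by measurable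
        finally show ?thesis .
      qed
      have "L1norm (conv ?P \<rho>) \<le> (\<integral>\<^sup>+y. ennreal (norm (?M y)) + ennreal (norm (?E y)) \<partial>lborel)"
        unfolding split by (intro nn_integral_mono) (simp add: norm_triangle_ineq4 ennreal_leI flip: ennreal_plus)
      also have "\<dots> = L1norm ?M + L1norm ?E"
        using M_meas E_meas by (intro nn_integral_add) measurable
      also have "\<dots> \<le> ennreal C2 * (A j + ennreal ((1 / 2) ^ j) * Fn) + ennreal C1 * (ennreal ((1 / 2) ^ j) * Gn)"
      proof (rule add_mono)
        have "L1norm ?M \<le> (\<integral>\<^sup>+x. L1norm (conv (dil (2 ^ j) N) (\<lambda>v. F (x, v))) \<partial>lborel)"
          using dispersed_average_le[OF F N rt(1,2)] unfolding rt(4) .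
        also have "\<dots> \<le> (\<integral>\<^sup>+x. ennreal C2 * ((L1norm (conv (dil (2 ^ j) N) (\<lambda>v. fc (x, v))))
              + ennreal ((1 / 2) ^ j) * (\<integral>\<^sup>+v. norm (fc (x, v)) \<partial>lborel)) \<partial>lborel)"
        proof (rule nn_integral_mono_AE)
          have "integrable (lborel \<Otimes>\<^sub>M lborel) fc" using fc by (simp add: lborel_prod)
          then have "AE x in lborel. integrable lborel (\<lambda>v. fc (x, v))" by (rule lborel_pair.AE_integrable_fst')
          then show "AE x in lborel. L1norm (conv (dil (2 ^ j) N) (\<lambda>v. F (x, v)))
             \<le> ennreal C2 * ((L1norm (conv (dil (2 ^ j) N) (\<lambda>v. fc (x, v))))
              + ennreal ((1 / 2) ^ j) * (\<integral>\<^sup>+v. norm (fc (x, v)) \<partial>lborel))"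
          proof (eventually_elim)
            case (elim x)
            from C2(2)[OF elim, of "2 ^ j"] show ?case by (simp add: F_def power_one_over)
          qed
        qed
        also have "\<dots> = ennreal C2 * (A j + ennreal ((1 / 2) ^ j) * Fn)"
        proof -
          have [measurable]: "(\<lambda>x. L1norm (conv (dil (2 ^ j) N) (\<lambda>v. fc (x, v)))) \<in> borel_measurable borel"
            unfolding conv_def by measurable
          show ?thesis unfolding A_def Fn_alt by (simp add: nn_integral_cmult nn_integral_add)
        qed
        finally show "L1norm ?M \<le> ennreal C2 * (A j + ennreal ((1 / 2) ^ j) * Fn)" .
        have "L1norm ?E \<le> ennreal t * (ennreal (C1 * (2 ^ j) ^ k) * Gn)"
          unfolding Gn_def
        proof (rule transport_error_le[OF P X _ f gm tr])
          show "0 \<le> t" using rt by simp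
          show "(\<integral>\<^sup>+y. shear_weight \<gamma> ?P X s y \<partial>lborel) \<le> ennreal (C1 * (2 ^ j) ^ k)" if "0 \<le> s" "s \<le> t" for s
            using rt that mult_left_mono[OF that(2), of r] by (intro C1(2)) auto
        qed
        also have "\<dots> = ennreal (t * (C1 * (2 ^ j) ^ k)) * Gn"
          using C1(1) rt by (subst ennreal_mult) (auto simp: mult.assoc)
        also have "t * (C1 * (2 ^ j) ^ k) = C1 * (t * (2 ^ j) ^ k)" by simp
        also have "ennreal \<dots> * Gn \<le> ennreal (C1 * (1 / 2) ^ j) * Gn"
        proof (intro mult_right_mono ennreal_leI mult_left_mono C1(1))
          have "j * p \<le> m" unfolding j_def by simp
          then have "j + j * k + j \<le> m" by (simp add: p_def algebra_simps)
          then have "(2::real) ^ (j + j * k + j) \<le> 2 ^ m" by (intro power_increasing) auto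
          then have le: "2 ^ j * (2 ^ j) ^ k * 2 ^ j \<le> (2::real) ^ m" by (simp only: power_add power_mult)
          have "t * (2 ^ j) ^ k = (2 ^ j * (2 ^ j) ^ k) / 2 ^ m" by (simp add: t_def)
          also have "\<dots> \<le> 1 / 2 ^ j"
            using le by (intro divide_le_eq[THEN iffD2] ; simp add: pos_le_divide_eq)
          finally show "t * (2 ^ j) ^ k \<le> (1 / 2) ^ j" by (simp only: power_one_over)
        qed simp
        also have "\<dots> = ennreal C1 * (ennreal ((1 / 2) ^ j) * Gn)"
          using C1(1) by (simp add: ennreal_mult mult.assoc)
        finally show "L1norm ?E \<le> ennreal C1 * (ennreal ((1 / 2) ^ j) * Gn)" .
      qed
      finally show ?thesis unfolding a_def j_def r_def .
    qed
    have half: "(\<Sum>j. ennreal ((1 / 2) ^ j)) = 2"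
      by (subst suminf_ennreal2) (use geometric_sums[of "1 / 2 :: real"] in \<open>auto simp: sums_iff\<close>)
    have AOb: "(\<Sum>j. A j) \<le> Ob"
    proof -
      have [measurable]: "(\<lambda>x. L1norm (conv (dil (2 ^ j) N) (\<lambda>v. fc (x, v)))) \<in> borel_measurable borel" for j
        unfolding conv_def by measurable
      have "(\<Sum>j. A j) = (\<integral>\<^sup>+x. (\<Sum>j. L1norm (conv (dil (2 ^ j) N) (\<lambda>v. fc (x, v)))) \<partial>lborel)"
        unfolding A_def by (rule nn_integral_suminf[symmetric]) measurable
      also have "\<dots> \<le> Ob" unfolding Ob_def osc_norm_def N_def[symmetric] by (intro nn_integral_mono) simp
      finally show ?thesis .
    qed
    have "(\<Sum>m. L1norm (conv (dil (2 ^ m) N) \<rho>)) \<le> (\<Sum>m. a (m div p))"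
      by (intro suminf_le step) auto
    also have "\<dots> = of_nat p * (\<Sum>j. a j)" by (rule suminf_div[OF p])
    also have "(\<Sum>j. a j) = ennreal C2 * ((\<Sum>j. A j) + 2 * Fn) + ennreal C1 * (2 * Gn)"
      unfolding a_def by (simp add: suminf_add[symmetric] half)
    also have "of_nat p * \<dots> \<le> of_nat p * (ennreal C2 * (2 * (Ob + Fn)) + ennreal C1 * (2 * Gn))"
    proof (intro mult_left_mono add_right_mono)
      have "(\<Sum>j. A j) + 2 * Fn \<le> 2 * Ob + 2 * Fn" using AOb by (intro add_right_mono) (simp add: mult_2 add_increasing)
      then show "(\<Sum>j. A j) + 2 * Fn \<le> 2 * (Ob + Fn)" by (simp add: distrib_left)
    qed auto
    also have "\<dots> \<le> of_nat p * (ennreal C2 * (2 * (Ob + Fn + Gn)) + ennreal C1 * (2 * (Ob + Fn + Gn)))"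
    proof -
      have le1: "Ob + Fn \<le> Ob + Fn + Gn" by (simp add: add_increasing2)
      have le2: "Gn \<le> Ob + Fn + Gn" by (simp add: add_increasing)
      show ?thesis
        by (rule mult_left_mono[OF add_mono[OF mult_left_mono[OF mult_left_mono[OF le1]]
              mult_left_mono[OF mult_left_mono[OF le2]]]]) auto
    qed
    also have "\<dots> = ennreal (real p * (2 * C2 + 2 * C1)) * (Ob + Fn + Gn)"
      using C1(1) C2(1) by (simp add: ennreal_mult ennreal_plus ennreal_of_nat_eq_real_of_nat distrib_right distrib_left mult_ac)
    finally have 1: "(\<Sum>m. L1norm (conv (dil (2 ^ m) N) \<rho>)) \<le> ennreal (real p * (2 * C2 + 2 * C1)) * (Ob + Fn + Gn)" .
    have "L1norm (conv G \<rho>) \<le> L1norm G * L1norm \<rho>"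
      by (rule conv_young) measurable
    also have "\<dots> \<le> ennreal I * (ennreal B * Fn)"
      using nn_integral_eq_integral[OF integrable_norm[OF test_function_integrable[OF G]]]
      by (intro mult_mono \<rho>_norm) (auto simp: I_def)
    also have "\<dots> = ennreal (I * B) * Fn" using I B by (simp add: ennreal_mult mult.assoc)
    also have "\<dots> \<le> ennreal (I * B) * (Ob + Fn + Gn)" by (intro mult_left_mono) (auto simp: add_increasing add_increasing2)
    finally have "osc_norm G \<rho> \<le> ennreal (I * B) * (Ob + Fn + Gn) + ennreal (real p * (2 * C2 + 2 * C1)) * (Ob + Fn + Gn)"
      unfolding osc_norm_def N_def[symmetric] by (intro add_mono 1)
    also have "\<dots> = ennreal C * (Ob + Fn + Gn)"
      using I B C1(1) C2(1) unfolding C_def by (subst ennreal_plus) (auto simp: distrib_right)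
    finally show ?thesis
      unfolding \<rho>_def[abs_def] F_def Ob_def Fn_def Gn_def fc_def by simp
  qed
  then show ?thesis using C by blast
qed

section \<open>Borel representatives\<close>

lemma fourier_cong_AE:
  fixes u u' :: "real^'d \<Rightarrow> complex"
  assumes u [measurable]: "u \<in> borel_measurable borel" and ae: "AE v in lborel. u' v = u v"
  shows "fourier u' \<xi> = fourier u \<xi>"
proof -
  have ael: "AE v in lebesgue. u' v = u v" using ae by (rule AE_completion)
  have ul: "u \<in> borel_measurable lebesgue" by (rule measurable_completion) simp
  have ul': "u' \<in> borel_measurable lebesgue"
    by (rule borel_measurable_AE[OF ul]) (use ael in eventually_elim, simp)
  have wl: "(\<lambda>v. exp (- (\<i> * complex_of_real (\<xi> \<bullet> v)))) \<in> borel_measurable lebesgue"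
    by (rule measurable_completion) measurable
  show ?thesis
    unfolding fourier_def
  proof (rule integral_cong_AE)
    show "(\<lambda>v. exp (- (\<i> * complex_of_real (\<xi> \<bullet> v))) * u' v) \<in> borel_measurable lebesgue"
      "(\<lambda>v. exp (- (\<i> * complex_of_real (\<xi> \<bullet> v))) * u v) \<in> borel_measurable lebesgue"
      using wl ul ul' by (auto intro: borel_measurable_times)
    show "AE v in lebesgue. exp (- (\<i> * complex_of_real (\<xi> \<bullet> v))) * u' v = exp (- (\<i> * complex_of_real (\<xi> \<bullet> v))) * u v"
      using ael by eventually_elim simp
  qed
qed

text \<open>The sections of a Borel representative agree almost everywhere with those of the original function
  only for almost every \<open>x\<close>; their Besov norms then agree for these \<open>x\<close>.\<close>

lemma besov_norm_cong_AE:
  fixes u u' :: "real^'d \<Rightarrow> complex"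
  assumes u: "u \<in> borel_measurable borel" and ae: "AE v in lborel. u' v = u v"
  shows "besov_norm \<psi> \<phi> u' = besov_norm \<psi> \<phi> u"
proof -
  have ael: "AE v in lebesgue. u' v = u v" using ae by (rule AE_completion)
  have ul: "u \<in> borel_measurable lebesgue" by (rule measurable_completion) (simp add: u)
  have ul': "u' \<in> borel_measurable lebesgue"
    by (rule borel_measurable_AE[OF ul]) (use ael in eventually_elim, simp)
  have "integrable lebesgue u' \<longleftrightarrow> integrable lebesgue u"
    by (rule integrable_cong_AE[OF ul' ul ael])
  moreover have "fourier_multiplier m u' = fourier_multiplier m u" for m
    unfolding fourier_multiplier_def by (simp add: fourier_cong_AE[OF u ae])
  ultimately show ?thesis by (simp add: besov_norm_def)
qed

lemma transport_equation_cong_AE: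
  fixes f f' :: "(real^'d) \<times> (real^'d) \<Rightarrow> real" and g g' :: "(real^'d) \<times> (real^'d) \<Rightarrow> complex"
  assumes f: "f \<in> borel_measurable lebesgue" "f' \<in> borel_measurable lebesgue" "AE z in lebesgue. f z = f' z"
    and g: "g \<in> borel_measurable lebesgue" "g' \<in> borel_measurable lebesgue" "AE z in lebesgue. g z = g' z"
    and tr: "transport_equation \<gamma> f g"
  shows "transport_equation \<gamma> f' g'"
  unfolding transport_equation_def
proof (intro allI impI)
  fix \<theta> :: "(real^'d) \<times> (real^'d) \<Rightarrow> complex" assume \<theta>: "test_function \<theta>"
  note [measurable] = test_function_measurable[OF \<theta>]
  let ?D = "\<lambda>z. frechet_derivative \<theta> (at z) (snd z, 0)"
  let ?b = "\<lambda>z. bessel \<gamma> (\<lambda>w. \<theta> (fst z, w)) (snd z)"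
  have Dm: "?D \<in> borel_measurable lebesgue"
  proof (rule measurable_completion)
    have "?D = (\<lambda>z. \<Sum>i\<in>Basis. ((snd z, 0) \<bullet> i) *\<^sub>R frechet_derivative \<theta> (at z) i)"
      using test_function_has_derivative[OF \<theta>] by (intro ext frechet_derivative_Basis_expand) (auto simp: differentiable_def)
    also have "\<dots> \<in> borel_measurable lborel"
    proof (intro borel_measurable_sum borel_measurable_scaleR)
      fix i :: "(real^'d) \<times> (real^'d)" assume i: "i \<in> Basis"
      show "(\<lambda>z. frechet_derivative \<theta> (at z) i) \<in> borel_measurable lborel"
        using test_function_measurable[OF test_function_deriv[OF \<theta> i]] by simp
      have "(\<lambda>z::(real^'d) \<times> (real^'d). (snd z, 0) \<bullet> i) \<in> borel_measurable borel"
        by (intro borel_measurable_continuous_onI continuous_intros)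
      then show "(\<lambda>z::(real^'d) \<times> (real^'d). (snd z, 0) \<bullet> i) \<in> borel_measurable lborel" by simp
    qed
    finally show "?D \<in> borel_measurable lborel" .
  qed
  have bm: "?b \<in> borel_measurable lebesgue"
  proof (rule measurable_completion)
    have \<theta>p [measurable]: "\<theta> \<in> borel_measurable (borel \<Otimes>\<^sub>M borel)" using test_function_measurable[OF \<theta>] by (simp add: borel_prod)
    have eq: "?b z = (LINT \<xi>|lborel. wave \<xi> (snd z) * (complex_of_real (bessel_weight \<gamma> \<xi>) * (LINT w|lborel. wave (-\<xi>) w * \<theta> (fst z, w)))) / complex_of_real ((2 * pi) ^ CARD('d))" for z
    proof -
      have m [measurable]: "(\<lambda>w. \<theta> (fst z, w)) \<in> borel_measurable borel" by measurable
      show ?thesis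
        unfolding bessel_def fourier_multiplier_def bessel_weight_def[symmetric]
        by (subst inverse_fourier_lborel, measurable) (simp add: fourier_lborel[OF m])
    qed
    have "?b \<in> borel_measurable (lborel \<Otimes>\<^sub>M lborel)" unfolding eq by measurable
    then show "?b \<in> borel_measurable lborel" by (simp add: lborel_prod)
  qed
  have "(LINT z|lebesgue. f' z *\<^sub>R ?D z) = (LINT z|lebesgue. f z *\<^sub>R ?D z)"
  proof (rule integral_cong_AE)
    show "AE z in lebesgue. f' z *\<^sub>R ?D z = f z *\<^sub>R ?D z" using f(3) by eventually_elim simp
  qed (intro borel_measurable_scaleR f Dm)+
  moreover have "(LINT z|lebesgue. g' z * ?b z) = (LINT z|lebesgue. g z * ?b z)"
  proof (rule integral_cong_AE)
    show "AE z in lebesgue. g' z * ?b z = g z * ?b z" using g(3) by eventually_elim simp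
  qed (intro borel_measurable_times g bm)+
  moreover have "- (LINT z|lebesgue. f z *\<^sub>R ?D z) = (LINT z|lebesgue. g z * ?b z)"
    using tr[unfolded transport_equation_def, rule_format, OF \<theta>] by (simp only: case_prod_unfold prod.collapse)
  ultimately show "- (LINT (x, v)|lebesgue. f' (x, v) *\<^sub>R frechet_derivative \<theta> (at (x, v)) (v, 0))
      = (LINT (x, v)|lebesgue. g' (x, v) * bessel \<gamma> (\<lambda>w. \<theta> (x, w)) v)"
    by (simp only: case_prod_unfold prod.collapse)
qed

lemma AE_lborel_product_sections:
  fixes P :: "('a::euclidean_space) \<times> ('b::euclidean_space) \<Rightarrow> bool"
  assumes "AE z in lborel. P z"
  shows "AE x in lborel. AE v in lborel. P (x, v)"
proof -
  have "AE z in lborel \<Otimes>\<^sub>M lborel. P z" unfolding lborel_prod by (rule assms)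
  then show ?thesis by (rule lborel_pair.AE_pair)
qed

lemma completion_ex_borel_measurable_complex:
  fixes g :: "'a \<Rightarrow> complex"
  assumes g: "g \<in> borel_measurable (completion M)"
  obtains g' where "g' \<in> borel_measurable M" "AE x in M. g x = g' x"
proof -
  have "(\<lambda>x. Re (g x)) \<in> borel_measurable (completion M)" "(\<lambda>x. Im (g x)) \<in> borel_measurable (completion M)"
    using g by measurable
  then obtain a b where [measurable]: "a \<in> borel_measurable M" "b \<in> borel_measurable M"
      and ab: "AE x in M. Re (g x) = a x" "AE x in M. Im (g x) = b x"
    by (metis completion_ex_borel_measurable_real)
  show ?thesis
  proof
    show "(\<lambda>x. Complex (a x) (b x)) \<in> borel_measurable M"
      unfolding Complex_eq by measurable
    show "AE x in M. g x = Complex (a x) (b x)"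
      using ab by eventually_elim (simp add: complex_eq_iff)
  qed
qed

section \<open>Equi-integrability\<close>

text \<open>The function \<open>b\<close> may be non-measurable, which makes the lemma applicable to the Besov norm of the
  section at \<open>x\<close> as a function of \<open>x\<close>.\<close>

lemma nn_integral_le_const_mult:
  fixes h b :: "'a \<Rightarrow> ennreal"
  assumes [measurable]: "h \<in> borel_measurable M" and c: "c > 0" and le: "AE x in M. h x \<le> ennreal c * b x"
  shows "(\<integral>\<^sup>+x. h x \<partial>M) \<le> ennreal c * (\<integral>\<^sup>+x. b x \<partial>M)"
proof -
  have 1: "ennreal c * (ennreal (1 / c) * t) = t" for t
    using c by (simp add: mult.assoc[symmetric] ennreal_mult[symmetric])
  have 2: "ennreal (1 / c) * (ennreal c * t) = t" for t
    using c by (simp add: mult.assoc[symmetric] ennreal_mult[symmetric])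
  have "(\<integral>\<^sup>+x. h x \<partial>M) = ennreal c * (\<integral>\<^sup>+x. ennreal (1 / c) * h x \<partial>M)"
    by (simp add: nn_integral_cmult 1)
  also have "\<dots> \<le> ennreal c * (\<integral>\<^sup>+x. b x \<partial>M)"
  proof (intro mult_left_mono nn_integral_mono_AE)
    show "AE x in M. ennreal (1 / c) * h x \<le> b x"
      using le by eventually_elim (metis 2 mult_left_mono zero_le)
  qed simp
  finally show ?thesis .
qed

lemma small_parameters:
  fixes K S \<epsilon> :: real
  assumes K: "K > 0" and S: "S \<ge> 0" and \<epsilon>: "\<epsilon> > 0"
  obtains n :: nat and \<beta> :: real where "n > 0" "\<beta> > 0"
    "(ennreal (K / n) + ennreal (K * 2 ^ n) * ennreal \<beta>) * ennreal S \<le> ennreal \<epsilon>"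
proof -
  obtain n :: nat where n: "2 * K * S / \<epsilon> < n" using reals_Archimedean2 by blast
  have n0: "n > 0"
  proof (rule ccontr)
    assume "\<not> n > 0"
    then have "2 * K * S / \<epsilon> < 0" using n by simp
    moreover have "2 * K * S / \<epsilon> \<ge> 0" using K S \<epsilon> by simp
    ultimately show False by simp
  qed
  define \<beta> where "\<beta> = \<epsilon> / (2 * (K * 2 ^ n * S + 1))"
  have den: "K * 2 ^ n * S + 1 > 0" using K S by (simp add: add_nonneg_pos)
  have \<beta>: "\<beta> > 0" using den \<epsilon> by (simp add: \<beta>_def)
  have 1: "K / n * S \<le> \<epsilon> / 2" using n n0 \<epsilon> by (simp add: field_simps)
  have "K * 2 ^ n * \<beta> * S = (K * 2 ^ n * S) / (K * 2 ^ n * S + 1) * (\<epsilon> / 2)"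
    unfolding \<beta>_def using den by (simp add: field_simps)
  also have "\<dots> \<le> 1 * (\<epsilon> / 2)" using den \<epsilon> K S by (intro mult_right_mono) (auto simp: divide_le_eq_1)
  finally have "(K / n + K * 2 ^ n * \<beta>) * S \<le> \<epsilon>" using 1 unfolding distrib_right by linarith
  moreover have "(ennreal (K / n) + ennreal (K * 2 ^ n) * ennreal \<beta>) * ennreal S = ennreal ((K / n + K * 2 ^ n * \<beta>) * S)"
    using K S \<beta> by (simp add: ennreal_mult ennreal_plus)
  ultimately show ?thesis using that[OF n0 \<beta>] by (simp add: ennreal_leI)
qed

theorem theorem5p2:
  fixes \<psi> \<phi> :: "real^'d \<Rightarrow> real"
    and f :: "nat \<Rightarrow> (real^'d) \<times> (real^'d) \<Rightarrow> real"
    and g :: "nat \<Rightarrow> (real^'d) \<times> (real^'d) \<Rightarrow> complex"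
    and \<gamma> :: real
  assumes "littlewood_paley \<psi> \<phi>"
    and "bounded_in_L1_besov \<psi> \<phi> f"
    and "\<And>n. AE z in lebesgue. 0 \<le> f n z"
    and "bounded_in_L1 g"
    and "\<And>n. transport_equation \<gamma> (f n) (g n)"
  shows "equi_integrable f"
proof -
  note lpf = littlewood_paley_facts[OF assms(1)]
  define q where "q = (\<lambda>x. complex_of_real (\<psi> x))"
  have q: "test_function q" using lpf(1) by (simp add: q_def)
  note [measurable] = test_function_measurable[OF q]
  have psi_meas [measurable]: "\<psi> \<in> borel_measurable borel"
  proof -
    have "(\<lambda>x. Re (q x)) \<in> borel_measurable borel" by measurable
    then show ?thesis by (simp add: q_def)
  qed
  have f_meas: "f n \<in> borel_measurable lebesgue" for n using assms(2) by (simp add: bounded_in_L1_besov_def)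
  obtain S0 where S0: "\<And>n. (\<integral>\<^sup>+x. besov_norm \<psi> \<phi> (\<lambda>v. complex_of_real (f n (x, v))) \<partial>lebesgue) \<le> ennreal S0"
    using assms(2) by (auto simp: bounded_in_L1_besov_def)
  define S where "S = max S0 0"
  have S: "S \<ge> 0" by (simp add: S_def)
  have besov: "(\<integral>\<^sup>+x. besov_norm \<psi> \<phi> (\<lambda>v. complex_of_real (f n (x, v))) \<partial>lborel) \<le> ennreal S" for n
    using S0[of n] order_trans[OF _ ennreal_leI[of S0 S]] by (simp add: nn_integral_completion S_def)
  \<comment> \<open>Fubini's theorem is applied to Borel representatives, because a Lebesgue measurable function on the
    product space need not be measurable for the product \<open>\<sigma>\<close>-algebra.\<close>
  have "\<exists>f'. f' \<in> borel_measurable borel \<and> (\<forall>z. 0 \<le> f' z) \<and> (AE z in lborel. f n z = f' z)" for n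
  proof -
    obtain h where h: "h \<in> borel_measurable lborel" "AE z in lborel. f n z = h z"
      using completion_ex_borel_measurable_real[OF f_meas] by blast
    have "AE z in lborel. 0 \<le> f n z" using assms(3) by (simp add: AE_completion_iff)
    with h(2) have "AE z in lborel. f n z = max 0 (h z)" by eventually_elim simp
    moreover have "(\<lambda>z. max 0 (h z)) \<in> borel_measurable borel" using h(1) by simp
    ultimately show ?thesis by (intro exI[of _ "\<lambda>z. max 0 (h z)"]) auto
  qed
  then obtain f' where f'[measurable]: "\<And>n. f' n \<in> borel_measurable borel" and f'0: "\<And>n z. 0 \<le> f' n z"
      and ff': "\<And>n. AE z in lborel. f n z = f' n z"
    by metis
  have f'_pair [measurable]: "f' n \<in> borel_measurable (borel \<Otimes>\<^sub>M borel)" for n using f' by (simp add: borel_prod)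
  have f'_sec [measurable]: "(\<lambda>v. f' n (x, v)) \<in> borel_measurable borel" for n x by measurable
  obtain G0 where g_int: "\<And>n. integrable lebesgue (g n)" and G0: "\<And>n. (LINT z|lebesgue. norm (g n z)) \<le> G0"
    using assms(4) by (auto simp: bounded_in_L1_def)
  have "\<exists>g'. g' \<in> borel_measurable borel \<and> (AE z in lborel. g n z = g' z)" for n
  proof -
    obtain h where "h \<in> borel_measurable lborel" "AE z in lborel. g n z = h z"
      using completion_ex_borel_measurable_complex[OF borel_measurable_integrable[OF g_int]] by blast
    then show ?thesis by auto
  qed
  then obtain g' where g'[measurable]: "\<And>n. g' n \<in> borel_measurable borel" and gg': "\<And>n. AE z in lborel. g n z = g' n z"
    by metis
  have g'l: "g' n \<in> borel_measurable lebesgue" and f'l: "f' n \<in> borel_measurable lebesgue" for n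
    by (rule measurable_completion; simp)+
  have g'_norm: "L1norm (g' n) \<le> ennreal G0" for n
  proof -
    have "L1norm (g' n) = L1norm (g n)"
      by (rule nn_integral_cong_AE) (use gg'[of n] in eventually_elim, simp)
    also have "\<dots> = (\<integral>\<^sup>+z. norm (g n z) \<partial>lebesgue)" by (simp add: nn_integral_completion)
    also have "\<dots> = ennreal (LINT z|lebesgue. norm (g n z))" by (intro nn_integral_eq_integral integrable_norm g_int) simp
    also have "\<dots> \<le> ennreal G0" by (intro ennreal_leI G0)
    finally show ?thesis .
  qed
  have g'_int: "integrable lborel (g' n)" for n
    using g'_norm[of n] le_less_trans unfolding integrable_iff_bounded by (auto simp: top.not_eq_extremum[symmetric] top_unique)
  have tr': "transport_equation \<gamma> (f' n) (g' n)" for n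
    by (rule transport_equation_cong_AE[OF f_meas f'l AE_completion[OF ff'] borel_measurable_integrable[OF g_int] g'l AE_completion[OF gg'] assms(5)])
  \<comment> \<open>If the section at \<open>x\<close> is not integrable, its Besov norm is infinite and the bounds below are trivial.\<close>
  obtain C0 where C0: "C0 > 0" "\<And>u. u \<in> borel_measurable borel \<Longrightarrow> osc_norm q u \<le> ennreal C0 * besov_norm \<psi> \<phi> u"
    using osc_norm_le_besov_norm[OF assms(1)] unfolding q_def by blast
  obtain K where K: "K > 0"
    and K1: "\<And>u. integrable lborel u \<Longrightarrow> (\<forall>x. 0 \<le> u x) \<Longrightarrow> (\<integral>\<^sup>+x. ennreal (u x) \<partial>lborel) \<le> ennreal K * osc_norm q (\<lambda>x. complex_of_real (u x))"
    and K2: "\<And>u n E. integrable lborel u \<Longrightarrow> (\<forall>x. 0 \<le> u x) \<Longrightarrow> n > 0 \<Longrightarrow> E \<in> sets borel \<Longrightarrow> (\<integral>\<^sup>+x\<in>E. ennreal (u x) \<partial>lborel)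
       \<le> (ennreal (K / real n) + ennreal (K * 2 ^ n) * emeasure lborel E) * osc_norm q (\<lambda>x. complex_of_real (u x))"
  proof -
    have "\<exists>K>0. \<forall>u. integrable lborel u \<longrightarrow> (\<forall>x. 0 \<le> u x) \<longrightarrow>
      (\<integral>\<^sup>+x. ennreal (u x) \<partial>lborel) \<le> ennreal K * osc_norm q (\<lambda>x. complex_of_real (u x)) \<and>
      (\<forall>n E. n > 0 \<longrightarrow> E \<in> sets borel \<longrightarrow> (\<integral>\<^sup>+x\<in>E. ennreal (u x) \<partial>lborel)
         \<le> (ennreal (K / real n) + ennreal (K * 2 ^ n) * emeasure lborel E) * osc_norm q (\<lambda>x. complex_of_real (u x)))"
      unfolding q_def by (rule osc_norm_equi_integrable[OF lpf(1,3)]) (rule lpf(6))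
    then show ?thesis
    proof (elim exE conjE)
      fix K :: real
      assume "K > 0" and K': "\<forall>u. integrable lborel u \<longrightarrow> (\<forall>x. 0 \<le> u x) \<longrightarrow>
        (\<integral>\<^sup>+x. ennreal (u x) \<partial>lborel) \<le> ennreal K * osc_norm q (\<lambda>x. complex_of_real (u x)) \<and>
        (\<forall>n E. n > 0 \<longrightarrow> E \<in> sets borel \<longrightarrow> (\<integral>\<^sup>+x\<in>E. ennreal (u x) \<partial>lborel)
           \<le> (ennreal (K / real n) + ennreal (K * 2 ^ n) * emeasure lborel E) * osc_norm q (\<lambda>x. complex_of_real (u x)))"
      show thesis
        by (rule that[OF \<open>K > 0\<close>]; use K' in blast)
    qed
  qed
  let ?b = "\<lambda>n x. besov_norm \<psi> \<phi> (\<lambda>v. complex_of_real (f n (x, v)))"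
  have besov_eq: "AE x in lborel. ?b n x = besov_norm \<psi> \<phi> (\<lambda>v. complex_of_real (f' n (x, v)))" for n
    using AE_lborel_product_sections[OF ff'[of n]]
  proof eventually_elim
    case (elim x)
    show ?case
      by (rule besov_norm_cong_AE) (measurable, use elim in eventually_elim, simp)
  qed
  have besov_top: "besov_norm \<psi> \<phi> (\<lambda>v. complex_of_real (f' n (x, v))) = \<infinity>" if "\<not> integrable lborel (\<lambda>v. f' n (x, v))" for n x
  proof -
    have "\<not> integrable lborel (\<lambda>v. complex_of_real (f' n (x, v)))" using that by (simp add: complex_of_real_integrable_eq)
    then show ?thesis by (simp add: besov_norm_def integrable_completion)
  qed
  have osc_AE: "AE x in lborel. osc_norm q (\<lambda>v. complex_of_real (f' n (x, v))) \<le> ennreal C0 * ?b n x" for n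
    using besov_eq[of n] by eventually_elim (simp add: C0(2))
  have mass_AE: "AE x in lborel. (\<integral>\<^sup>+v. ennreal (f' n (x, v)) \<partial>lborel) \<le> ennreal (K * C0) * ?b n x" for n
    using besov_eq[of n]
  proof eventually_elim
    case (elim x)
    show ?case
    proof (cases "integrable lborel (\<lambda>v. f' n (x, v))")
      case True
      have "(\<integral>\<^sup>+v. ennreal (f' n (x, v)) \<partial>lborel) \<le> ennreal K * osc_norm q (\<lambda>v. complex_of_real (f' n (x, v)))"
        using K1[OF True] f'0 by simp
      also have "\<dots> \<le> ennreal K * (ennreal C0 * ?b n x)" unfolding elim by (intro mult_left_mono C0(2)) auto
      finally show ?thesis using K C0(1) by (simp add: ennreal_mult mult.assoc)
    next
      case False
      then show ?thesis unfolding elim besov_top[OF False] using K C0(1) by (simp add: ennreal_mult_top)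
    qed
  qed
  have f'_mass: "(\<integral>\<^sup>+z. ennreal (f' n z) \<partial>lborel) \<le> ennreal (K * C0 * S)" for n
  proof -
    have "(\<integral>\<^sup>+z. ennreal (f' n z) \<partial>lborel) = (\<integral>\<^sup>+x. \<integral>\<^sup>+v. ennreal (f' n (x, v)) \<partial>lborel \<partial>lborel)"
      by (rule nn_integral_lborel_product) measurable
    also have "\<dots> \<le> ennreal (K * C0) * (\<integral>\<^sup>+x. ?b n x \<partial>lborel)"
      by (rule nn_integral_le_const_mult[OF _ _ mass_AE]) (use K C0 in \<open>measurable, simp\<close>)
    also have "\<dots> \<le> ennreal (K * C0) * ennreal S" by (intro mult_left_mono besov) simp
    finally show ?thesis using K C0 S by (simp add: ennreal_mult)
  qed
  have f'_int: "integrable lborel (f' n)" for n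
    using f'_mass[of n] f'0 le_less_trans unfolding integrable_iff_bounded by (auto simp: top.not_eq_extremum[symmetric] top_unique)
  have osc_mass: "(\<integral>\<^sup>+x. osc_norm q (\<lambda>v. complex_of_real (f' n (x, v))) \<partial>lborel) \<le> ennreal (C0 * S)" for n
  proof -
    have "(\<lambda>x. osc_norm q (\<lambda>v. complex_of_real (f' n (x, v)))) \<in> borel_measurable borel"
      using osc_norm_measurable[of q "\<lambda>z. complex_of_real (f' n z)"] by simp
    then have "(\<integral>\<^sup>+x. osc_norm q (\<lambda>v. complex_of_real (f' n (x, v))) \<partial>lborel) \<le> ennreal C0 * (\<integral>\<^sup>+x. ?b n x \<partial>lborel)"
      by (intro nn_integral_le_const_mult C0(1) osc_AE) simp
    also have "\<dots> \<le> ennreal C0 * ennreal S" by (intro mult_left_mono besov) simp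
    finally show ?thesis using C0 S by (simp add: ennreal_mult)
  qed
  have abs_eq: "(\<integral>\<^sup>+z\<in>A. ennreal \<bar>f n z\<bar> \<partial>lebesgue) = (\<integral>\<^sup>+z\<in>A. ennreal (f' n z) \<partial>lborel)" for n A
  proof -
    have "(\<integral>\<^sup>+z\<in>A. ennreal \<bar>f n z\<bar> \<partial>lborel) = (\<integral>\<^sup>+z\<in>A. ennreal (f' n z) \<partial>lborel)"
      by (rule nn_integral_cong_AE) (use ff'[of n] in eventually_elim, simp add: f'0)
    then show ?thesis by (simp add: nn_integral_completion)
  qed
  have loc: "bounded_in_L1_loc f"
    unfolding bounded_in_L1_loc_def
  proof (intro conjI allI impI f_meas exI)
    fix A :: "((real^'d) \<times> (real^'d)) set" and n
    have "(\<integral>\<^sup>+z\<in>A. ennreal (f' n z) \<partial>lborel) \<le> (\<integral>\<^sup>+z. ennreal (f' n z) \<partial>lborel)"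
      by (intro nn_integral_mono) (auto simp: indicator_def)
    then show "(\<integral>\<^sup>+z\<in>A. ennreal \<bar>f n z\<bar> \<partial>lebesgue) \<le> ennreal (K * C0 * S)"
      unfolding abs_eq using f'_mass[of n] by (rule order_trans)
  qed
  show ?thesis
    unfolding equi_integrable_def
  proof (intro conjI loc allI impI)
    fix \<eta> :: real and Kc :: "((real^'d) \<times> (real^'d)) set"
    assume \<eta>: "\<eta> > 0" and Kc: "compact Kc"
    obtain R where R: "R > 0" "\<And>z. z \<in> Kc \<Longrightarrow> norm z \<le> R"
      using compact_imp_bounded[OF Kc] unfolding bounded_pos by blast
    define \<kappa> where "\<kappa> v = \<psi> ((1 / (4 * R)) *\<^sub>R v)" for v
    have \<kappa>0: "0 \<le> \<kappa> v" for v using lpf(3) by (simp add: \<kappa>_def)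
    have \<kappa>1: "\<kappa> v = 1" if "norm v \<le> R" for v
      unfolding \<kappa>_def using that R(1) by (intro lpf(6)) (simp add: field_simps)
    define X where "X v = complex_of_real (\<kappa> v)" for v
    have X: "test_function X"
      using test_function_dilate[OF q, of "1 / (4 * R)"] R(1) by (simp add: X_def[abs_def] \<kappa>_def q_def)
    have \<kappa>_meas [measurable]: "\<kappa> \<in> borel_measurable borel" unfolding \<kappa>_def[abs_def] by measurable
    obtain BX where BX: "\<And>v. norm (X v) \<le> BX" using X by (metis test_function_bounded)
    define \<rho> where "\<rho> n x = (LINT v|lborel. f' n (x, v) * \<kappa> v)" for n x
    have \<rho>0: "0 \<le> \<rho> n x" for n x unfolding \<rho>_def using f'0 \<kappa>0 by (intro integral_nonneg_AE AE_I2) simp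
    have \<rho>_meas [measurable]: "\<rho> n \<in> borel_measurable borel" for n unfolding \<rho>_def[abs_def] by measurable
    have prod_int: "integrable lborel (\<lambda>z. f' n z * \<kappa> (snd z))" for n
    proof -
      have "integrable lborel (\<lambda>z. complex_of_real (f' n z) * X (snd z))"
        using f'_int[of n] test_function_measurable[OF X]
        by (intro integrable_mult_bounded[OF _ _ BX]) (auto intro: integrable_of_real)
      then have "integrable lborel (\<lambda>z. complex_of_real (f' n z * \<kappa> (snd z)))" by (simp add: X_def)
      then show ?thesis by (simp only: complex_of_real_integrable_eq)
    qed
    then have prod_pair: "integrable (lborel \<Otimes>\<^sub>M lborel) (\<lambda>z. f' n z * \<kappa> (snd z))" for n by (simp add: lborel_prod)
    have \<rho>_int: "integrable lborel (\<rho> n)" for n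
      using lborel_pair.integrable_fst'[OF prod_pair[of n]] by (simp add: \<rho>_def[abs_def])
    have \<rho>_nn: "AE x in lborel. (\<integral>\<^sup>+v. ennreal (f' n (x, v) * \<kappa> v) \<partial>lborel) = ennreal (\<rho> n x)" for n
      using lborel_pair.AE_integrable_fst'[OF prod_pair[of n]]
      by eventually_elim (simp add: \<rho>_def nn_integral_eq_integral f'0 \<kappa>0)
    obtain Cv where Cv: "Cv \<ge> 0" "\<And>f g. integrable lborel f \<Longrightarrow> integrable lborel g \<Longrightarrow> transport_equation \<gamma> f g \<Longrightarrow>
      osc_norm q (\<lambda>x. LINT v|lborel. complex_of_real (f (x, v)) * X v)
        \<le> ennreal Cv * ((\<integral>\<^sup>+x. osc_norm q (\<lambda>v. complex_of_real (f (x, v))) \<partial>lborel)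
             + L1norm f + L1norm g)"
      using velocity_average_osc_norm[OF q X, of \<gamma>] by blast
    define S2 where "S2 = Cv * (C0 * S + K * C0 * S + \<bar>G0\<bar>)"
    have S2: "S2 \<ge> 0" unfolding S2_def using Cv(1) C0(1) K S by (intro mult_nonneg_nonneg add_nonneg_nonneg) auto
    have \<rho>_osc: "osc_norm q (\<lambda>x. complex_of_real (\<rho> n x)) \<le> ennreal S2" for n
    proof -
      have "osc_norm q (\<lambda>x. complex_of_real (\<rho> n x)) = osc_norm q (\<lambda>x. LINT v|lborel. complex_of_real (f' n (x, v)) * X v)"
        unfolding \<rho>_def X_def by (simp flip: of_real_mult)
      also have "\<dots> \<le> ennreal Cv * ((\<integral>\<^sup>+x. osc_norm q (\<lambda>v. complex_of_real (f' n (x, v))) \<partial>lborel)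
             + L1norm (f' n) + L1norm (g' n))"
        by (rule Cv(2)[OF f'_int g'_int tr'])
      also have "\<dots> \<le> ennreal Cv * (ennreal (C0 * S) + ennreal (K * C0 * S) + ennreal \<bar>G0\<bar>)"
        using f'_mass[of n] f'0 by (intro mult_left_mono add_mono osc_mass order_trans[OF g'_norm ennreal_leI]) auto
      also have "\<dots> = ennreal S2"
        unfolding S2_def using Cv(1) C0(1) K S by (simp add: ennreal_mult ennreal_plus)
      finally show ?thesis .
    qed
    \<comment> \<open>\<open>\<alpha>\<close> bounds the measure of the set of bad positions, \<open>\<beta>\<close> that of the sections over the good ones; by
      Chebyshev's inequality \<open>\<bar>\<Omega>\<bar> < \<alpha> \<beta>\<close> ensures both.\<close>
    obtain n1 \<alpha> where n1: "n1 > 0" "\<alpha> > 0" "(ennreal (K / real n1) + ennreal (K * 2 ^ n1) * ennreal \<alpha>) * ennreal S2 \<le> ennreal (\<eta> / 4)"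
      using small_parameters[OF K S2, of "\<eta> / 4"] \<eta> by auto
    have CS: "C0 * S \<ge> 0" using C0 S by simp
    obtain n2 \<beta> where n2: "n2 > 0" "\<beta> > 0" "(ennreal (K / real n2) + ennreal (K * 2 ^ n2) * ennreal \<beta>) * ennreal (C0 * S) \<le> ennreal (\<eta> / 4)"
      using small_parameters[OF K CS, of "\<eta> / 4"] \<eta> by auto
    show "\<exists>\<delta>>0. \<forall>\<Omega>. \<Omega> \<in> sets lebesgue \<and> emeasure lebesgue \<Omega> < ennreal \<delta> \<longrightarrow>
           (\<forall>n. (\<integral>\<^sup>+z\<in>\<Omega> \<inter> Kc. ennreal \<bar>f n z\<bar> \<partial>lebesgue) < ennreal \<eta>)"
    proof (intro exI conjI allI impI)
      show "\<alpha> * \<beta> > 0" using n1 n2 by simp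
      fix \<Omega> :: "((real^'d) \<times> (real^'d)) set" and n
      assume \<Omega>: "\<Omega> \<in> sets lebesgue \<and> emeasure lebesgue \<Omega> < ennreal (\<alpha> * \<beta>)"
      define \<Omega>' where "\<Omega>' = main_part lborel \<Omega>"
      have \<Omega>'_meas [measurable]: "\<Omega>' \<in> sets borel" using \<Omega> main_part_sets[of \<Omega> lborel] by (simp add: \<Omega>'_def)
      have \<Omega>'_pair [measurable]: "\<Omega>' \<in> sets (borel \<Otimes>\<^sub>M borel)" unfolding borel_prod by (rule \<Omega>'_meas)
      have \<Omega>'_em: "emeasure lborel \<Omega>' < ennreal (\<alpha> * \<beta>)"
        unfolding \<Omega>'_def emeasure_completion[OF conjunct1[OF \<Omega>], symmetric] by (rule conjunct2[OF \<Omega>])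
      have \<Omega>'_AE: "AE z in lborel. z \<in> \<Omega> \<longrightarrow> z \<in> \<Omega>'"
      proof -
        obtain Z where Z: "Z \<in> null_sets lborel" "null_part lborel \<Omega> \<subseteq> Z" using null_part[of \<Omega> lborel] \<Omega> by auto
        have "\<Omega> = \<Omega>' \<union> null_part lborel \<Omega>" using \<Omega> by (simp add: \<Omega>'_def main_part_null_part_Un)
        with Z(2) have "z \<in> \<Omega> \<longrightarrow> z \<in> \<Omega>'" if "z \<notin> Z" for z using that by auto
        then show ?thesis using AE_not_in[OF Z(1)] by (auto elim: eventually_mono)
      qed
      define sec where "sec x = {v. (x, v) \<in> \<Omega>'}" for x
      have sec_meas [measurable]: "sec x \<in> sets borel" for x
        using measurable_sets[of "\<lambda>v. (x, v)" borel "borel \<Otimes>\<^sub>M borel" \<Omega>'] \<Omega>'_pair by (simp add: sec_def vimage_def)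
      have em_sec [measurable]: "(\<lambda>x. emeasure lborel (sec x)) \<in> borel_measurable borel"
      proof -
        have "(\<lambda>x. \<integral>\<^sup>+v. indicator \<Omega>' (x, v) \<partial>lborel) \<in> borel_measurable borel" by measurable
        moreover have "(\<integral>\<^sup>+v. indicator \<Omega>' (x, v) \<partial>lborel) = emeasure lborel (sec x)" for x
        proof -
          have "(\<integral>\<^sup>+v. indicator \<Omega>' (x, v) \<partial>lborel) = (\<integral>\<^sup>+v. indicator (sec x) v \<partial>lborel)"
            by (intro nn_integral_cong) (simp add: indicator_def sec_def)
          then show ?thesis by simp
        qed
        ultimately show ?thesis by simp
      qed
      define A where "A = {x. ennreal \<beta> < emeasure lborel (sec x)}"
      have A_meas [measurable]: "A \<in> sets borel" unfolding A_def by measurable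
      have A_em: "emeasure lborel A \<le> ennreal \<alpha>"
      proof -
        have "ennreal \<beta> * emeasure lborel A = (\<integral>\<^sup>+x. ennreal \<beta> * indicator A x \<partial>lborel)"
          by (simp add: nn_integral_cmult_indicator)
        also have "\<dots> \<le> (\<integral>\<^sup>+x. emeasure lborel (sec x) \<partial>lborel)"
          by (intro nn_integral_mono) (auto simp: indicator_def A_def)
        also have "\<dots> = (\<integral>\<^sup>+x. \<integral>\<^sup>+v. indicator \<Omega>' (x, v) \<partial>lborel \<partial>lborel)"
        proof (rule nn_integral_cong)
          fix x
          have "(\<integral>\<^sup>+v. indicator \<Omega>' (x, v) \<partial>lborel) = (\<integral>\<^sup>+v. indicator (sec x) v \<partial>lborel)"
            by (intro nn_integral_cong) (simp add: indicator_def sec_def)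
          then show "emeasure lborel (sec x) = (\<integral>\<^sup>+v. indicator \<Omega>' (x, v) \<partial>lborel)" by simp
        qed
        also have "\<dots> = (\<integral>\<^sup>+z. indicator \<Omega>' z \<partial>lborel)" by (rule nn_integral_lborel_product[symmetric]) measurable
        also have "\<dots> = emeasure lborel \<Omega>'" by simp
        also have "\<dots> \<le> ennreal (\<alpha> * \<beta>)" using \<Omega>'_em by simp
        finally have "ennreal (1 / \<beta>) * (ennreal \<beta> * emeasure lborel A) \<le> ennreal (1 / \<beta>) * ennreal (\<alpha> * \<beta>)"
          by (rule mult_left_mono) simp
        then show ?thesis using n1 n2 by (simp add: mult.assoc[symmetric] ennreal_mult[symmetric])
      qed
      have "(\<integral>\<^sup>+z\<in>\<Omega> \<inter> Kc. ennreal \<bar>f n z\<bar> \<partial>lebesgue) = (\<integral>\<^sup>+z\<in>\<Omega> \<inter> Kc. ennreal (f' n z) \<partial>lborel)"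
        by (rule abs_eq)
      also have "\<dots> \<le> (\<integral>\<^sup>+z. (ennreal (f' n z) * indicator \<Omega>' z) * indicator (- A) (fst z)
           + ennreal (f' n z * \<kappa> (snd z)) * indicator A (fst z) \<partial>lborel)"
      proof (rule nn_integral_mono_AE)
        show "AE z in lborel. ennreal (f' n z) * indicator (\<Omega> \<inter> Kc) z \<le> (ennreal (f' n z) * indicator \<Omega>' z) * indicator (- A) (fst z)
           + ennreal (f' n z * \<kappa> (snd z)) * indicator A (fst z)"
          using \<Omega>'_AE
        proof eventually_elim
          case (elim z)
          have "\<kappa> (snd z) = 1" if "z \<in> Kc"
            using R(2)[OF that] norm_snd_le[of "snd z" "fst z"] by (intro \<kappa>1) simp
          with elim show ?case by (auto simp: indicator_def)
        qed
      qed
      also have "\<dots> = (\<integral>\<^sup>+x. \<integral>\<^sup>+v. (ennreal (f' n (x, v)) * indicator \<Omega>' (x, v)) * indicator (- A) x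
           + ennreal (f' n (x, v) * \<kappa> v) * indicator A x \<partial>lborel \<partial>lborel)"
      proof -
        define H where "H z = (ennreal (f' n z) * indicator \<Omega>' z) * indicator (- A) (fst z)
           + ennreal (f' n z * \<kappa> (snd z)) * indicator A (fst z)" for z
        have "H \<in> borel_measurable (borel \<Otimes>\<^sub>M borel)" unfolding H_def[abs_def] by measurable
        then have "(\<integral>\<^sup>+z. H z \<partial>lborel) = (\<integral>\<^sup>+x. \<integral>\<^sup>+v. H (x, v) \<partial>lborel \<partial>lborel)"
          unfolding borel_prod by (rule nn_integral_lborel_product)
        then show ?thesis unfolding H_def fst_conv snd_conv .
      qed
      also have "\<dots> = (\<integral>\<^sup>+x. (\<integral>\<^sup>+v\<in>sec x. ennreal (f' n (x, v)) \<partial>lborel) * indicator (- A) x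
           + (\<integral>\<^sup>+v. ennreal (f' n (x, v) * \<kappa> v) \<partial>lborel) * indicator A x \<partial>lborel)"
      proof (rule nn_integral_cong)
        fix x
        have "(\<integral>\<^sup>+v. (ennreal (f' n (x, v)) * indicator \<Omega>' (x, v)) * indicator (- A) x
           + ennreal (f' n (x, v) * \<kappa> v) * indicator A x \<partial>lborel)
          = (\<integral>\<^sup>+v. (ennreal (f' n (x, v)) * indicator (sec x) v) * indicator (- A) x
           + ennreal (f' n (x, v) * \<kappa> v) * indicator A x \<partial>lborel)"
          by (intro nn_integral_cong) (simp add: indicator_def sec_def)
        also have "\<dots> = (\<integral>\<^sup>+v\<in>sec x. ennreal (f' n (x, v)) \<partial>lborel) * indicator (- A) x
           + (\<integral>\<^sup>+v. ennreal (f' n (x, v) * \<kappa> v) \<partial>lborel) * indicator A x"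
          by (subst nn_integral_add) (auto simp: nn_integral_multc)
        finally show "(\<integral>\<^sup>+v. (ennreal (f' n (x, v)) * indicator \<Omega>' (x, v)) * indicator (- A) x
           + ennreal (f' n (x, v) * \<kappa> v) * indicator A x \<partial>lborel)
          = (\<integral>\<^sup>+v\<in>sec x. ennreal (f' n (x, v)) \<partial>lborel) * indicator (- A) x
           + (\<integral>\<^sup>+v. ennreal (f' n (x, v) * \<kappa> v) \<partial>lborel) * indicator A x" .
      qed
      also have "\<dots> = (\<integral>\<^sup>+x. (\<integral>\<^sup>+v\<in>sec x. ennreal (f' n (x, v)) \<partial>lborel) * indicator (- A) x \<partial>lborel)
           + (\<integral>\<^sup>+x. (\<integral>\<^sup>+v. ennreal (f' n (x, v) * \<kappa> v) \<partial>lborel) * indicator A x \<partial>lborel)"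
      proof (rule nn_integral_add)
        have "(\<lambda>x. (\<integral>\<^sup>+v. ennreal (f' n (x, v)) * indicator \<Omega>' (x, v) \<partial>lborel) * indicator (- A) x) \<in> borel_measurable lborel" by measurable
        then show "(\<lambda>x. (\<integral>\<^sup>+v\<in>sec x. ennreal (f' n (x, v)) \<partial>lborel) * indicator (- A) x) \<in> borel_measurable lborel"
          by (simp add: sec_def indicator_def)
      qed measurable
      also have "\<dots> \<le> ennreal (\<eta> / 4) + ennreal (\<eta> / 4)"
      proof (rule add_mono)
        define c where "c = K / real n2 + K * 2 ^ n2 * \<beta>"
        have c: "c > 0" "ennreal c = ennreal (K / real n2) + ennreal (K * 2 ^ n2) * ennreal \<beta>"
          using K n2 by (auto simp: c_def ennreal_plus ennreal_mult add_pos_pos)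
        have "(\<integral>\<^sup>+x. (\<integral>\<^sup>+v\<in>sec x. ennreal (f' n (x, v)) \<partial>lborel) * indicator (- A) x \<partial>lborel)
          \<le> ennreal (c * C0) * (\<integral>\<^sup>+x. ?b n x \<partial>lborel)"
        proof (rule nn_integral_le_const_mult)
          have "(\<lambda>x. (\<integral>\<^sup>+v. ennreal (f' n (x, v)) * indicator \<Omega>' (x, v) \<partial>lborel) * indicator (- A) x) \<in> borel_measurable lborel" by measurable
          then show "(\<lambda>x. (\<integral>\<^sup>+v\<in>sec x. ennreal (f' n (x, v)) \<partial>lborel) * indicator (- A) x) \<in> borel_measurable lborel"
            by (simp add: sec_def indicator_def)
          show "c * C0 > 0" using c C0 by simp
          show "AE x in lborel. (\<integral>\<^sup>+v\<in>sec x. ennreal (f' n (x, v)) \<partial>lborel) * indicator (- A) x \<le> ennreal (c * C0) * ?b n x"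
            using besov_eq[of n]
          proof eventually_elim
            case (elim x)
            show ?case
            proof (cases "integrable lborel (\<lambda>v. f' n (x, v)) \<and> x \<notin> A")
              case True
              then have "emeasure lborel (sec x) \<le> ennreal \<beta>" by (simp add: A_def not_less)
              then have le: "ennreal (K / real n2) + ennreal (K * 2 ^ n2) * emeasure lborel (sec x) \<le> ennreal c"
                unfolding c(2) by (intro add_left_mono mult_left_mono) auto
              have "(\<integral>\<^sup>+v\<in>sec x. ennreal (f' n (x, v)) \<partial>lborel)
                \<le> (ennreal (K / real n2) + ennreal (K * 2 ^ n2) * emeasure lborel (sec x)) * osc_norm q (\<lambda>v. complex_of_real (f' n (x, v)))"
                using True f'0 n2(1) by (intro K2) auto
              also have "\<dots> \<le> ennreal c * (ennreal C0 * ?b n x)"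
                unfolding elim by (intro mult_mono le C0(2)) auto
              finally show ?thesis using True c C0(1) by (simp add: ennreal_mult mult.assoc)
            next
              case False
              then consider "x \<in> A" | "\<not> integrable lborel (\<lambda>v. f' n (x, v))" by blast
              then show ?thesis
              proof cases
                case 2
                show ?thesis unfolding elim besov_top[OF 2] using c C0(1) by (simp add: ennreal_mult_top)
              qed simp
            qed
          qed
        qed
        also have "\<dots> \<le> ennreal (c * C0) * ennreal S" by (intro mult_left_mono besov) simp
        also have "\<dots> = ennreal c * ennreal (C0 * S)" using c C0 S by (simp add: ennreal_mult mult.assoc)
        also have "\<dots> \<le> ennreal (\<eta> / 4)" unfolding c(2) by (rule n2(3))
        finally show "(\<integral>\<^sup>+x. (\<integral>\<^sup>+v\<in>sec x. ennreal (f' n (x, v)) \<partial>lborel) * indicator (- A) x \<partial>lborel) \<le> ennreal (\<eta> / 4)" .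
        have "(\<integral>\<^sup>+x. (\<integral>\<^sup>+v. ennreal (f' n (x, v) * \<kappa> v) \<partial>lborel) * indicator A x \<partial>lborel) = (\<integral>\<^sup>+x\<in>A. ennreal (\<rho> n x) \<partial>lborel)"
          by (rule nn_integral_cong_AE) (use \<rho>_nn[of n] in eventually_elim, simp)
        also have "\<dots> \<le> (ennreal (K / real n1) + ennreal (K * 2 ^ n1) * emeasure lborel A) * osc_norm q (\<lambda>x. complex_of_real (\<rho> n x))"
          using \<rho>0 n1(1) by (intro K2 \<rho>_int) auto
        also have "\<dots> \<le> (ennreal (K / real n1) + ennreal (K * 2 ^ n1) * ennreal \<alpha>) * ennreal S2"
          by (intro mult_mono add_left_mono mult_left_mono A_em \<rho>_osc) auto
        also have "\<dots> \<le> ennreal (\<eta> / 4)" by (rule n1(3))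
        finally show "(\<integral>\<^sup>+x. (\<integral>\<^sup>+v. ennreal (f' n (x, v) * \<kappa> v) \<partial>lborel) * indicator A x \<partial>lborel) \<le> ennreal (\<eta> / 4)" .
      qed
      also have "\<dots> = ennreal (\<eta> / 2)" using \<eta> by (subst ennreal_plus[symmetric]) auto
      also have "\<dots> < ennreal \<eta>" using \<eta> by (intro ennreal_lessI) auto
      finally show "(\<integral>\<^sup>+z\<in>\<Omega> \<inter> Kc. ennreal \<bar>f n z\<bar> \<partial>lebesgue) < ennreal \<eta>" .
    qed
  qed
qed

end
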